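(* Let $A$ be a finite simplicial complex and let $|A|=\mathrm{dom}(\beta^\infty A)/R$ be its topological realization. Then $|A|$ is homeomorphic to the geometric realization $|A|_{\mathbb R}$ by a homeomorphism that, for each subcomplex $B$ of $A$, maps $|B|$ onto the geometric subcomplex $|B|_{\mathbb R}$ of $|A|_{\mathbb R}$.
   Context: Complexes, barycentric subdivisions $\beta^kC$, elementary selections ($s\colon\beta C\to C$ with $s(\sigma)\in\sigma$) are as usual; $\mathcal{S}(A)$ is the smallest family of simplicial maps containing all elementary selections $\beta^{k+1}A\to\beta^kA$, the identity $1_A$, closed under composition and under $f\mapsto\beta f$ (where $\beta f(\sigma)=f_*(\sigma)$); it is a projective Fra\"iss\'e category. A neat sequence $(f_n)$ of morphisms ($\mathrm{dom}(f_n)=\mathrm{codom}(f_{n+1})$) in a category $\mathcal F$ is generic if (i) for every object $o$ there are $n$ and $e\in\mathcal F$ with $\mathrm{dom}(e)=\mathrm{dom}(f_n)$, $\mathrm{codom}(e)=o$, and (ii) for every $n$ and $e\in\mathcal F$ with $\mathrm{codom}(e)=\mathrm{codom}(f_n)$ there are $m>n$ and $e'\in\mathcal F$ with $f_n\circ\dots\circ f_m=e\circ e'$. Let $(f_n)$, $f_n\colon A_{n+1}\to A_n$, be a generic sequence for $\mathcal S(A)$ (so each $A_n=\beta^{k_n}A$). $\beta^\infty A$ is the profinite complex whose vertex set $\mathrm{dom}(\beta^\infty A)$ is the inverse limit of the discrete sets $\mathrm{dom}(A_n)$ under the $f_n$ (with projections $f^\infty_n$), a finite set being a face iff its image under $f^\infty_k$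 is a face of $A_k$ for every $k$. $R$ is the relation $xRy\iff\{x,y\}\in\beta^\infty A$ on $\mathrm{dom}(\beta^\infty A)$; it is an equivalence relation, and $|A|$ is the quotient space. For a subcomplex $B$ of $A$, the maps $f_n$ restrict to maps $\beta^{k_{n+1}}B\to\beta^{k_n}B$, and $\beta^\infty B$ is the subcomplex of $\beta^\infty A$ obtained as the inverse limit of these restrictions; $|B|$ is the image of $\mathrm{dom}(\beta^\infty B)$ in $|A|$. Identifying $\mathrm{dom}(A)$ with $\{0,\dots,m\}$, $|A|_{\mathbb R}=\{x\in\mathbb R^{m+1}:x_i\ge0,\ \sum_ix_i=\sum_{i\in\sigma}x_i=1\text{ for some }\sigma\in A\}$, and $|B|_{\mathbb R}$ is defined in the same way with $\sigma$ ranging over $B$. *)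

theory Defs
  imports "HOL-Analysis.Analysis" "HOL-Library.FSet"
begin

text \<open>A complex is given by its set of faces, which are nonempty finite sets; \<open>verts\<close> is
  the vertex set, written \<open>dom\<close> in the literature on projective Fraisse limits.\<close>

type_synonym 'v scomplex = "'v fset set"

definition is_complex :: "'v scomplex \<Rightarrow> bool" where
  "is_complex C \<longleftrightarrow> {||} \<notin> C \<and> (\<forall>\<sigma>\<in>C. \<forall>\<tau>. \<tau> |\<subseteq>| \<sigma> \<and> \<tau> \<noteq> {||} \<longrightarrow> \<tau> \<in> C)"

definition verts :: "'v scomplex \<Rightarrow> 'v set" where
  "verts C = (\<Union>\<sigma>\<in>C. fset \<sigma>)"

text \<open>The vertices of the barycentric subdivision are the faces of the given complex. For all
  iterated subdivisions of a complex with vertices in \<open>'a\<close> to have the same type, vertices are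
  hereditarily finite sets over \<open>'a\<close>.\<close>

datatype 'a vert = Atom 'a | Face (the_face: "'a vert fset")

definition sd :: "'a vert scomplex \<Rightarrow> 'a vert scomplex" where
  "sd C = {Face |`| S | S. S \<noteq> {||} \<and> fset S \<subseteq> C \<and>
             (\<forall>\<sigma>\<in>fset S. \<forall>\<tau>\<in>fset S. \<sigma> |\<subseteq>| \<tau> \<or> \<tau> |\<subseteq>| \<sigma>)}"

definition bsd :: "nat \<Rightarrow> 'a scomplex \<Rightarrow> 'a vert scomplex" where
  "bsd k A = (sd ^^ k) ((\<lambda>\<sigma>. Atom |`| \<sigma>) ` A)"

text \<open>A map of complexes carries its domain and codomain; the underlying function is
  \<open>undefined\<close> off the vertices of the domain, so that equality of records is equality of maps.\<close>

record 'v smap =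
  src :: "'v scomplex"
  tgt :: "'v scomplex"
  fn :: "'v \<Rightarrow> 'v"

definition simplicial :: "'v smap \<Rightarrow> bool" where
  "simplicial f \<longleftrightarrow> is_complex (src f) \<and> is_complex (tgt f) \<and>
     fn f \<in> extensional (verts (src f)) \<and> (\<forall>\<sigma>\<in>src f. fn f |`| \<sigma> \<in> tgt f)"

definition id_smap :: "'v scomplex \<Rightarrow> 'v smap" where
  "id_smap C = \<lparr>src = C, tgt = C, fn = (\<lambda>v\<in>verts C. v)\<rparr>"

definition comp_smap :: "'v smap \<Rightarrow> 'v smap \<Rightarrow> 'v smap" where
  "comp_smap f g = \<lparr>src = src g, tgt = tgt f, fn = (\<lambda>v\<in>verts (src g). fn f (fn g v))\<rparr>"

definition sd_smap :: "'a vert smap \<Rightarrow> 'a vert smap" where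
  "sd_smap f = \<lparr>src = sd (src f), tgt = sd (tgt f),
     fn = (\<lambda>v\<in>verts (sd (src f)). Face (fn f |`| the_face v))\<rparr>"

definition elementary_selection :: "'a vert scomplex \<Rightarrow> 'a vert smap \<Rightarrow> bool" where
  "elementary_selection C s \<longleftrightarrow> src s = sd C \<and> tgt s = C \<and>
     fn s \<in> extensional (verts (sd C)) \<and> (\<forall>\<sigma>\<in>C. fn s (Face \<sigma>) |\<in>| \<sigma>)"

inductive_set selection_maps :: "'a scomplex \<Rightarrow> 'a vert smap set" for A :: "'a scomplex" where
  selection: "elementary_selection (bsd k A) s \<Longrightarrow> s \<in> selection_maps A"
| ident: "id_smap (bsd 0 A) \<in> selection_maps A"
| comp: "f \<in> selection_maps A \<Longrightarrow> g \<in> selection_maps A \<Longrightarrow> src f = tgt g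
           \<Longrightarrow> comp_smap f g \<in> selection_maps A"
| subdiv: "f \<in> selection_maps A \<Longrightarrow> sd_smap f \<in> selection_maps A"

text \<open>A category of complexes is identified with its set of morphisms.\<close>

definition objects :: "'v smap set \<Rightarrow> 'v scomplex set" where
  "objects F = src ` F \<union> tgt ` F"

text \<open>For \<open>n \<le> m\<close> this is the composite of \<open>f n, f (n + 1), \<dots>, f m\<close>, with \<open>f m\<close> applied first.\<close>

definition seq_comp :: "(nat \<Rightarrow> 'v smap) \<Rightarrow> nat \<Rightarrow> nat \<Rightarrow> 'v smap" where
  "seq_comp f n m = foldr comp_smap (map f [n..<m]) (f m)"

definition neat :: "(nat \<Rightarrow> 'v smap) \<Rightarrow> bool" where
  "neat f \<longleftrightarrow> (\<forall>n. src (f n) = tgt (f (Suc n)))"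

definition generic :: "'v smap set \<Rightarrow> (nat \<Rightarrow> 'v smap) \<Rightarrow> bool" where
  "generic F f \<longleftrightarrow> (\<forall>n. f n \<in> F) \<and> neat f \<and>
     (\<forall>C\<in>objects F. \<exists>n. \<exists>e\<in>F. src e = src (f n) \<and> tgt e = C) \<and>
     (\<forall>n. \<forall>e\<in>F. tgt e = tgt (f n) \<longrightarrow>
        (\<exists>m>n. \<exists>e'\<in>F. tgt e' = src e \<and> seq_comp f n m = comp_smap e e'))"

definition lim_verts :: "(nat \<Rightarrow> 'v smap) \<Rightarrow> (nat \<Rightarrow> 'v) set" where
  "lim_verts f = {x. \<forall>n. x n \<in> verts (tgt (f n)) \<and> fn (f n) (x (Suc n)) = x n}"

definition lim_complex :: "(nat \<Rightarrow> 'v smap) \<Rightarrow> (nat \<Rightarrow> 'v) scomplex" where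
  "lim_complex f = {K. K \<noteq> {||} \<and> fset K \<subseteq> lim_verts f \<and> (\<forall>k. (\<lambda>x. x k) |`| K \<in> tgt (f k))}"

definition lim_topology :: "(nat \<Rightarrow> 'v smap) \<Rightarrow> (nat \<Rightarrow> 'v) topology" where
  "lim_topology f =
     subtopology (product_topology (\<lambda>n. discrete_topology (verts (tgt (f n)))) UNIV) (lim_verts f)"

definition lim_rel :: "(nat \<Rightarrow> 'v smap) \<Rightarrow> ((nat \<Rightarrow> 'v) \<times> (nat \<Rightarrow> 'v)) set" where
  "lim_rel f = {(x, y). x \<in> lim_verts f \<and> y \<in> lim_verts f \<and> {|x, y|} \<in> lim_complex f}"

definition quotient_topology :: "'b topology \<Rightarrow> ('b \<times> 'b) set \<Rightarrow> 'b set topology" where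
  "quotient_topology X R =
     topology (\<lambda>U. U \<subseteq> topspace X // R \<and> openin X {x \<in> topspace X. R `` {x} \<in> U})"

definition realization :: "(nat \<Rightarrow> 'v smap) \<Rightarrow> (nat \<Rightarrow> 'v) set topology" where
  "realization f = quotient_topology (lim_topology f) (lim_rel f)"

text \<open>Unless \<open>A\<close> is empty, its iterated subdivisions are pairwise distinct, so the
  least \<open>k\<close> is the only one.\<close>

definition level :: "'a scomplex \<Rightarrow> 'a vert scomplex \<Rightarrow> nat" where
  "level A C = (LEAST k. C = bsd k A)"

definition restrict_seq ::
    "'a scomplex \<Rightarrow> (nat \<Rightarrow> 'a vert smap) \<Rightarrow> 'a scomplex \<Rightarrow> nat \<Rightarrow> 'a vert smap" where
  "restrict_seq A f B n =
     (let C = bsd (level A (src (f n))) B; D = bsd (level A (tgt (f n))) B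
      in \<lparr>src = C, tgt = D, fn = restrict (fn (f n)) (verts C)\<rparr>)"

definition subrealization ::
    "'a scomplex \<Rightarrow> (nat \<Rightarrow> 'a vert smap) \<Rightarrow> 'a scomplex \<Rightarrow> (nat \<Rightarrow> 'a vert) set set" where
  "subrealization A f B = (\<lambda>x. lim_rel f `` {x}) ` lim_verts (restrict_seq A f B)"

text \<open>Points have one real coordinate for each vertex of the ambient complex \<open>A\<close>.\<close>

definition geom_points :: "'a scomplex \<Rightarrow> 'a scomplex \<Rightarrow> ('a \<Rightarrow> real) set" where
  "geom_points A B = {x \<in> extensional (verts A). (\<forall>i\<in>verts A. 0 \<le> x i) \<and>
     (\<exists>\<sigma>\<in>B. (\<Sum>i\<in>verts A. x i) = 1 \<and> (\<Sum>i\<in>fset \<sigma>. x i) = 1)}"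

definition geom_realization :: "'a scomplex \<Rightarrow> ('a \<Rightarrow> real) topology" where
  "geom_realization A = subtopology (powertop_real (verts A)) (geom_points A A)"

lemma openin_quotient_topology:
  "openin (quotient_topology X R) U \<longleftrightarrow>
     U \<subseteq> topspace X // R \<and> openin X {x \<in> topspace X. R `` {x} \<in> U}"
proof -
  have "istopology (\<lambda>U. U \<subseteq> topspace X // R \<and> openin X {x \<in> topspace X. R `` {x} \<in> U})"
    unfolding istopology_def
  proof (intro conjI allI impI; (elim conjE)?)
    fix S T
    assume "openin X {x \<in> topspace X. R `` {x} \<in> S}" "openin X {x \<in> topspace X. R `` {x} \<in> T}"
    then have "openin X ({x \<in> topspace X. R `` {x} \<in> S} \<inter> {x \<in> topspace X. R `` {x} \<in> T})"
      by (rule openin_Int)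
    then show "openin X {x \<in> topspace X. R `` {x} \<in> S \<inter> T}"
      by (rule back_subst[of "openin X"]) auto
  next
    fix \<K>
    assume "\<forall>K\<in>\<K>. K \<subseteq> topspace X // R \<and> openin X {x \<in> topspace X. R `` {x} \<in> K}"
    then have "openin X (\<Union>K\<in>\<K>. {x \<in> topspace X. R `` {x} \<in> K})"
      by blast
    then show "openin X {x \<in> topspace X. R `` {x} \<in> \<Union>\<K>}"
      by (rule back_subst[of "openin X"]) auto
  qed auto
  then show ?thesis
    by (simp add: quotient_topology_def topology_inverse')
qed

lemma topspace_quotient_topology: "topspace (quotient_topology X R) = topspace X // R"
proof
  show "topspace (quotient_topology X R) \<subseteq> topspace X // R"
    by (auto simp: topspace_def openin_quotient_topology)
  have "{x \<in> topspace X. R `` {x} \<in> topspace X // R} = topspace X"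
    by (auto simp: quotient_def)
  then have "openin (quotient_topology X R) (topspace X // R)"
    by (simp add: openin_quotient_topology)
  then show "topspace X // R \<subseteq> topspace (quotient_topology X R)"
    by (rule openin_subset)
qed

lemma quotient_map_quotient_topology:
  "quotient_map X (quotient_topology X R) (\<lambda>x. R `` {x})"
  by (auto simp: quotient_map_def openin_quotient_topology topspace_quotient_topology quotient_def)

lemma topspace_lim_topology: "topspace (lim_topology f) = lim_verts f"
  by (auto simp: lim_topology_def lim_verts_def PiE_def)

lemma topspace_realization: "topspace (realization f) = lim_verts f // lim_rel f"
  by (simp add: realization_def topspace_quotient_topology topspace_lim_topology)

lemma topspace_geom_realization: "topspace (geom_realization A) = geom_points A A"
  by (auto simp: geom_realization_def geom_points_def PiE_def)

lemma bsd_0: "bsd 0 A = (\<lambda>\<sigma>. Atom |`| \<sigma>) ` A"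
  by (simp add: bsd_def)

lemma bsd_Suc: "bsd (Suc k) A = sd (bsd k A)"
  by (simp add: bsd_def)

lemma verts_sd: "verts (sd C) = Face ` C"
proof
  show "verts (sd C) \<subseteq> Face ` C"
    by (auto simp: verts_def sd_def)
  show "Face ` C \<subseteq> verts (sd C)"
  proof
    fix v assume "v \<in> Face ` C"
    then obtain \<sigma> where \<sigma>: "\<sigma> \<in> C" "v = Face \<sigma>" by blast
    have "Face |`| {|\<sigma>|} \<in> sd C"
      unfolding sd_def using \<sigma> by (intro CollectI exI[of _ "{|\<sigma>|}"]) auto
    then show "v \<in> verts (sd C)"
      using \<sigma> by (force simp: verts_def)
  qed
qed

lemma is_complex_sd: "is_complex (sd C)"
  unfolding is_complex_def
proof (intro conjI ballI allI impI; (elim conjE)?)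
  show "{||} \<notin> sd C" by (auto simp: sd_def)
next
  fix \<sigma> \<tau> assume "\<sigma> \<in> sd C" and \<tau>: "\<tau> |\<subseteq>| \<sigma>" "\<tau> \<noteq> {||}"
  then obtain S where S: "\<sigma> = Face |`| S" "fset S \<subseteq> C"
    "\<forall>\<sigma>\<in>fset S. \<forall>\<tau>\<in>fset S. \<sigma> |\<subseteq>| \<tau> \<or> \<tau> |\<subseteq>| \<sigma>"
    by (auto simp: sd_def)
  obtain T where T: "T |\<subseteq>| S" "\<tau> = Face |`| T"
    using \<tau> S(1) subset_fimage_iff by metis
  have "fset T \<subseteq> fset S" using T(1) by (simp add: less_eq_fset.rep_eq)
  then show "\<tau> \<in> sd C"
    unfolding sd_def using T(2) \<tau>(2) S(2,3) by (intro CollectI exI[of _ T] conjI) blast+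
qed

lemma is_complex_bsd:
  assumes "is_complex A" shows "is_complex (bsd k A)"
proof (cases k)
  case 0
  show ?thesis
    unfolding is_complex_def 0 bsd_0
  proof (intro conjI ballI allI impI; (elim conjE)?)
    show "{||} \<notin> (\<lambda>\<sigma>. Atom |`| \<sigma>) ` A"
      using assms by (auto simp: is_complex_def)
  next
    fix \<sigma> \<tau> assume "\<sigma> \<in> (\<lambda>\<sigma>. Atom |`| \<sigma>) ` A" and \<tau>: "\<tau> |\<subseteq>| \<sigma>" "\<tau> \<noteq> {||}"
    then obtain \<rho> where \<rho>: "\<rho> \<in> A" "\<sigma> = Atom |`| \<rho>" by blast
    obtain \<pi> where \<pi>: "\<pi> |\<subseteq>| \<rho>" "\<tau> = Atom |`| \<pi>"
      using \<tau> \<rho>(2) subset_fimage_iff by metis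
    then have "\<pi> \<in> A" using assms \<rho> \<tau> by (auto simp: is_complex_def)
    then show "\<tau> \<in> (\<lambda>\<sigma>. Atom |`| \<sigma>) ` A" using \<pi> by blast
  qed
next
  case (Suc j)
  then show ?thesis by (simp add: bsd_Suc is_complex_sd)
qed

lemma objects_selection_maps: "objects (selection_maps A) = range (\<lambda>k. bsd k A)"
proof
  have "src f \<in> range (\<lambda>k. bsd k A) \<and> tgt f \<in> range (\<lambda>k. bsd k A)"
    if "f \<in> selection_maps A" for f
    using that
  proof induction
    case (selection k s)
    then show ?case by (auto simp: elementary_selection_def simp flip: bsd_Suc)
  qed (auto simp: id_smap_def comp_smap_def sd_smap_def simp flip: bsd_Suc)
  then show "objects (selection_maps A) \<subseteq> range (\<lambda>k. bsd k A)"
    by (auto simp: objects_def)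
  have "\<exists>f\<in>selection_maps A. src f = bsd k A" for k
  proof (induction k)
    case 0
    show ?case by (rule bexI[OF _ selection_maps.ident]) (simp add: id_smap_def)
  next
    case (Suc k)
    then obtain f where "f \<in> selection_maps A" "src f = bsd k A" by blast
    then show ?case
      by (intro bexI[OF _ selection_maps.subdiv[of f]]) (simp_all add: sd_smap_def bsd_Suc)
  qed
  then show "range (\<lambda>k. bsd k A) \<subseteq> objects (selection_maps A)"
    by (force simp: objects_def)
qed

lemma fchain_greatest:
  fixes S :: "'b fset fset"
  assumes "S \<noteq> {||}" and "\<forall>\<sigma>\<in>fset S. \<forall>\<tau>\<in>fset S. \<sigma> |\<subseteq>| \<tau> \<or> \<tau> |\<subseteq>| \<sigma>"
  shows "\<exists>\<mu>\<in>fset S. \<forall>\<sigma>\<in>fset S. \<sigma> |\<subseteq>| \<mu>"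
  using assms
proof (induction S)
  case empty
  then show ?case by simp
next
  case (insert x S)
  show ?case
  proof (cases "S = {||}")
    case True
    then show ?thesis by simp
  next
    case False
    then obtain \<mu> where "\<mu> \<in> fset S" "\<forall>\<sigma>\<in>fset S. \<sigma> |\<subseteq>| \<mu>"
      using insert by auto
    moreover have "x |\<subseteq>| \<mu> \<or> \<mu> |\<subseteq>| x"
      using insert.prems(2) \<open>\<mu> \<in> fset S\<close> by blast
    ultimately show ?thesis
      by (metis finsert_iff order_refl order_trans)
  qed
qed

lemma simplicial_selection_maps:
  assumes "is_complex A" and "f \<in> selection_maps A"
  shows "simplicial f"
  using assms(2)
proof induction
  case (selection k s)
  let ?C = "bsd k A"
  have C: "is_complex ?C" using assms(1) by (rule is_complex_bsd)
  have "fn s |`| \<kappa> \<in> ?C" if \<kappa>: "\<kappa> \<in> sd ?C" for \<kappa>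
  proof -
    from \<kappa> obtain S where S: "\<kappa> = Face |`| S" "S \<noteq> {||}" "fset S \<subseteq> ?C"
      "\<forall>\<sigma>\<in>fset S. \<forall>\<tau>\<in>fset S. \<sigma> |\<subseteq>| \<tau> \<or> \<tau> |\<subseteq>| \<sigma>"
      unfolding sd_def by blast
    obtain \<mu> where \<mu>: "\<mu> \<in> fset S" "\<forall>\<sigma>\<in>fset S. \<sigma> |\<subseteq>| \<mu>"
      using fchain_greatest[OF S(2,4)] by blast
    have "fn s (Face \<sigma>) |\<in>| \<mu>" if "\<sigma> \<in> fset S" for \<sigma>
    proof -
      have "fn s (Face \<sigma>) |\<in>| \<sigma>"
        using selection S(3) that by (auto simp: elementary_selection_def)
      then show ?thesis using \<mu>(2) that by blast
    qed
    then have "fn s |`| \<kappa> |\<subseteq>| \<mu>" unfolding S(1) by blast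
    moreover have "fn s |`| \<kappa> \<noteq> {||}" using S(1,2) by simp
    moreover have "\<mu> \<in> ?C" using \<mu>(1) S(3) by blast
    ultimately show ?thesis using C by (simp add: is_complex_def)
  qed
  then show ?case
    using selection C by (simp add: simplicial_def elementary_selection_def is_complex_sd)
next
  case ident
  have "(\<lambda>v\<in>verts (bsd 0 A). v) |`| \<sigma> = \<sigma>" if "\<sigma> \<in> bsd 0 A" for \<sigma>
  proof -
    have "\<And>v. v |\<in>| \<sigma> \<Longrightarrow> v \<in> verts (bsd 0 A)" using that by (auto simp: verts_def)
    then show ?thesis by force
  qed
  then show ?case
    using is_complex_bsd[OF assms(1)] by (simp add: simplicial_def id_smap_def)
next
  case (comp f g)
  have "(\<lambda>v\<in>verts (src g). fn f (fn g v)) |`| \<sigma> = fn f |`| fn g |`| \<sigma>" if "\<sigma> \<in> src g" for \<sigma>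
  proof -
    have "\<And>v. v |\<in>| \<sigma> \<Longrightarrow> v \<in> verts (src g)" using that by (auto simp: verts_def)
    then show ?thesis by (force simp: fimage_fimage)
  qed
  then show ?case
    using comp by (simp add: simplicial_def comp_smap_def fset.map_comp[symmetric] del: fset.map_comp)
next
  case (subdiv f)
  have "(\<lambda>v\<in>verts (sd (src f)). Face (fn f |`| the_face v)) |`| \<kappa> \<in> sd (tgt f)"
    if \<kappa>: "\<kappa> \<in> sd (src f)" for \<kappa>
  proof -
    from \<kappa> obtain S where S: "\<kappa> = Face |`| S" "S \<noteq> {||}" "fset S \<subseteq> src f"
      "\<forall>\<sigma>\<in>fset S. \<forall>\<tau>\<in>fset S. \<sigma> |\<subseteq>| \<tau> \<or> \<tau> |\<subseteq>| \<sigma>"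
      unfolding sd_def by blast
    let ?T = "(\<lambda>\<sigma>. fn f |`| \<sigma>) |`| S"
    have "\<And>\<sigma>. \<sigma> |\<in>| S \<Longrightarrow> Face \<sigma> \<in> verts (sd (src f))"
      using S(3) by (auto simp: verts_sd)
    then have "(\<lambda>v\<in>verts (sd (src f)). Face (fn f |`| the_face v)) |`| \<kappa> = Face |`| ?T"
      unfolding S(1) fimage_fimage by (intro fset.map_cong0) simp
    moreover have "fset ?T \<subseteq> tgt f"
      using S(3) subdiv.IH by (auto simp: simplicial_def)
    moreover have "\<forall>\<sigma>\<in>fset ?T. \<forall>\<tau>\<in>fset ?T. \<sigma> |\<subseteq>| \<tau> \<or> \<tau> |\<subseteq>| \<sigma>"
    proof -
      have "fn f |`| \<sigma> |\<subseteq>| fn f |`| \<tau> \<or> fn f |`| \<tau> |\<subseteq>| fn f |`| \<sigma>"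
        if "\<sigma> \<in> fset S" "\<tau> \<in> fset S" for \<sigma> \<tau>
        using S(4) that fimage_mono by metis
      then show ?thesis by simp
    qed
    moreover have "?T \<noteq> {||}" using S(2) by simp
    ultimately show ?thesis unfolding sd_def by blast
  qed
  then show ?case
    by (simp add: simplicial_def sd_smap_def is_complex_sd)
qed

end

theory Submission
  imports Defs
begin

text \<open>
  The realization of a selection map is a uniform limit of homeomorphisms that preserve every
  subcomplex: an elementary selection is the limit of subdivision maps whose weights concentrate
  on the selected vertices, compositions are clear, and for \<open>\<beta> f\<close> one conjugates an
  approximation of \<open>f\<close> by weighted subdivisions. Moreover some composites \<open>e\<close> of elementary
  selections send, under the identity of the underlying polyhedron, the closed star of each vertex
  \<open>u\<close> into the open star of \<open>e u\<close>, with mesh as small as desired. For a selection map \<open>g\<close> the map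
  \<open>g \<circ> e\<close> therefore has such a star approximation by a homeomorphism.

  Genericity makes the given sequence factor through maps \<open>e\<close> chosen in this way, hence it
  interleaves with a sequence of complexes carrying homeomorphisms \<open>\<Psi> i\<close> to \<open>|A|\<close>
  with mesh tending to 0. A point of the inverse limit is then sent to the unique point in the nested
  intersection of the images of the closed stars of its coordinates. Two points have the same image
  iff they lie in a common open star at every stage, which is the relation \<open>R\<close>.
\<close>

text \<open>Nothing is claimed about the single maps of the generic sequence. Even one elementary
  selection fails to be a star approximation of the subdivision map: the closed star of the
  barycentre of an edge contains both ends of the edge, and neither end lies in the open star of the
  other. Two subdivisions with well chosen selections do suffice, so pairs of selections are the
  building blocks of \<open>e\<close>.

  A selection map \<open>g\<close> is only uniformly close to homeomorphisms, and closeness keeps a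
  coordinate positive only if there is a margin. Compactness of the closed stars provides a margin
  \<delta> for \<open>e\<close>, and a homeomorphism within \<delta> of the realization of
  \<open>g\<close> then serves for the composite of \<open>g\<close> and \<open>e\<close>.

  That closed stars go into open stars matters once more in the limit: the limit point of a thread
  lies in open stars, so the vertices that two threads with the same limit have at one stage belong
  to the carrier of one point and hence span a face.

  Every homeomorphism in the construction maps the subdivisions of each subcomplex \<open>B\<close>
  onto each other, so one and the same sequence serves \<open>A\<close> and all its
  subcomplexes.\<close>

lemma Hausdorff_space_euclidean_fun:
  "Hausdorff_space (euclidean :: ('v \<Rightarrow> real) topology)"
  unfolding euclidean_product_topology[symmetric] by (simp add: Hausdorff_space_product_topology)

lemma continuous_on_coordinate: "continuous_on S (\<lambda>p. p i :: 'b::topological_space)"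
  by (rule continuous_on_subset[OF continuous_on_product_coordinates subset_UNIV])

text \<open>Minimise the l1-distance \<open>G\<close> over the compact set \<open>Z\<close> of pairs
  whose images are at l1-distance at least \<epsilon>. The minimum is positive, since
  \<open>G\<close> vanishes only on pairs of equal points, and those are not in \<open>Z\<close>.
  Uniformity is expressed coordinatewise because the topology on functions is the product
  topology.\<close>

lemma continuous_on_finite_uniform:
  fixes \<Phi> :: "('v \<Rightarrow> real) \<Rightarrow> 'w \<Rightarrow> real"
  assumes "compact S" and cont: "continuous_on S \<Phi>" and "finite V" "finite W"
    and V: "\<And>p v. p \<in> S \<Longrightarrow> v \<notin> V \<Longrightarrow> p v = 0"
    and W: "\<And>p w. p \<in> S \<Longrightarrow> w \<notin> W \<Longrightarrow> \<Phi> p w = 0"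
    and "\<epsilon> > 0"
  shows "\<exists>\<delta>>0. \<forall>p\<in>S. \<forall>q\<in>S. (\<forall>v. \<bar>p v - q v\<bar> < \<delta>) \<longrightarrow> (\<forall>w. \<bar>\<Phi> p w - \<Phi> q w\<bar> < \<epsilon>)"
proof -
  define F where "F = (\<lambda>z. \<Sum>w\<in>W. \<bar>\<Phi> (fst z) w - \<Phi> (snd z) w\<bar>)"
  define G where "G = (\<lambda>z::('v \<Rightarrow> real) \<times> ('v \<Rightarrow> real). \<Sum>v\<in>V. \<bar>fst z v - snd z v\<bar>)"
  have cfst: "continuous_on (S \<times> S) (\<lambda>z. \<Phi> (fst z) w)" and csnd: "continuous_on (S \<times> S) (\<lambda>z. \<Phi> (snd z) w)" for w
    by (rule continuous_on_compose2[OF continuous_on_product_then_coordinatewise[OF cont]],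
        auto intro: continuous_intros)+
  have cF: "continuous_on (S \<times> S) F"
    unfolding F_def by (intro continuous_intros cfst csnd)
  have cG: "continuous_on (S \<times> S) G"
    unfolding G_def
    by (intro continuous_intros continuous_on_product_then_coordinatewise) 
  define Z where "Z = {z \<in> S \<times> S. \<epsilon> \<le> F z}"
  have "closedin (top_of_set (S \<times> S)) Z"
    unfolding Z_def using continuous_closedin_preimage[OF cF, of "{\<epsilon>..}"]
    by (simp add: vimage_def Int_def)
  then have "compact Z"
    using assms(1) closedin_compact compact_Times by blast
  have small: "\<bar>\<Phi> p w - \<Phi> q w\<bar> < \<epsilon>" if "p \<in> S" "q \<in> S" "(p, q) \<notin> Z" for p q w
  proof (cases "w \<in> W")
    case True
    have "\<bar>\<Phi> p w - \<Phi> q w\<bar> \<le> F (p, q)"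
      unfolding F_def fst_conv snd_conv
      by (rule member_le_sum[OF True]) (auto simp: assms)
    then show ?thesis using that by (auto simp: Z_def)
  next
    case False
    then show ?thesis using W that \<open>\<epsilon> > 0\<close> by simp
  qed
  show ?thesis
  proof (cases "Z = {}")
    case True
    then show ?thesis using small by (intro exI[of _ 1]) auto
  next
    case False
    obtain z where z: "z \<in> Z" "\<And>y. y \<in> Z \<Longrightarrow> G z \<le> G y"
      using continuous_attains_inf[OF \<open>compact Z\<close> False, of G] cG
      by (metis (no_types, lifting) Z_def continuous_on_subset mem_Collect_eq subsetI)
    have "G z \<noteq> 0"
    proof
      assume "G z = 0"
      then have "\<forall>v\<in>V. fst z v = snd z v"
        unfolding G_def by (subst (asm) sum_nonneg_eq_0_iff) (auto simp: assms)
      then have "fst z = snd z"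
        using V[of "fst z"] V[of "snd z"] z(1) by (intro ext) (auto simp: Z_def)
      then have "F z = 0" by (simp add: F_def)
      then show False using z(1) \<open>\<epsilon> > 0\<close> by (simp add: Z_def)
    qed
    moreover have "G z \<ge> 0" by (simp add: G_def sum_nonneg)
    ultimately have "G z > 0" by simp
    \<comment> \<open>Coordinates within \<delta> bound the l1-distance by \<open>card V\<close>
      times \<delta>. The extra 1 makes this less than \<open>G z\<close> and covers empty
      \<open>V\<close>.\<close>
    define \<delta> where "\<delta> = G z / (real (card V) + 1)"
    have "\<delta> > 0" using \<open>G z > 0\<close> by (simp add: \<delta>_def)
    moreover have "(p, q) \<notin> Z" if "\<forall>v. \<bar>p v - q v\<bar> < \<delta>" for p q
    proof
      assume "(p, q) \<in> Z"
      then have "G z \<le> G (p, q)" by (rule z)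
      also have "\<dots> \<le> (\<Sum>v\<in>V. \<delta>)"
        unfolding G_def using that by (intro sum_mono) (auto intro: less_imp_le)
      also have "\<dots> = real (card V) * \<delta>" by simp
      also have "\<dots> < (real (card V) + 1) * \<delta>" using \<open>\<delta> > 0\<close> by (simp add: algebra_simps)
      also have "\<dots> = G z" by (simp add: \<delta>_def)
      finally show False by simp
    qed
    ultimately show ?thesis using small by (intro exI[of _ \<delta>]) simp
  qed
qed

section \<open>Points of the geometric realization\<close>

text \<open>Barycentric coordinates are extended by 0 to the whole type, unlike in
  \<open>geom_points\<close>. All complexes with the same type of vertices then share one ambient
  function space, and \<sigma> may be any face that contains the carrier.\<close>

definition points :: "'v scomplex \<Rightarrow> ('v \<Rightarrow> real) set" where
  "points C = {p. (\<forall>v. 0 \<le> p v) \<and> (\<exists>\<sigma>\<in>C. (\<forall>v. v |\<notin>| \<sigma> \<longrightarrow> p v = 0) \<and> sum p (fset \<sigma>) = 1)}"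

lemma pointsE:
  assumes "p \<in> points C"
  obtains \<sigma> where "\<sigma> \<in> C" "\<And>v. v |\<notin>| \<sigma> \<Longrightarrow> p v = 0" "\<And>v. 0 \<le> p v" "sum p (fset \<sigma>) = 1"
  using assms by (auto simp: points_def)

lemma points_nonneg: "p \<in> points C \<Longrightarrow> 0 \<le> p v"
  by (simp add: points_def)

lemma points_mono: "B \<subseteq> C \<Longrightarrow> points B \<subseteq> points C"
  by (auto simp: points_def)

lemma face_subset_verts: "\<sigma> \<in> C \<Longrightarrow> fset \<sigma> \<subseteq> verts C"
  by (auto simp: verts_def)

lemma finite_verts: "finite C \<Longrightarrow> finite (verts C)"
  by (auto simp: verts_def)

lemma verts_mono: "B \<subseteq> C \<Longrightarrow> verts B \<subseteq> verts C"
  by (auto simp: verts_def)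

lemma points_off_verts: "p \<in> points C \<Longrightarrow> v \<notin> verts C \<Longrightarrow> p v = 0"
  by (elim pointsE) (use face_subset_verts in blast)

lemma points_sum:
  assumes "p \<in> points C" "finite V" "verts C \<subseteq> V"
  shows "sum p V = 1"
proof -
  obtain \<sigma> where \<sigma>: "\<sigma> \<in> C" "\<And>v. v |\<notin>| \<sigma> \<Longrightarrow> p v = 0" "sum p (fset \<sigma>) = 1"
    using assms(1) by (rule pointsE) blast
  have "sum p V = sum p (fset \<sigma>)"
    using \<sigma>(2) face_subset_verts[OF \<sigma>(1)] assms by (intro sum.mono_neutral_right) auto
  then show ?thesis using \<sigma>(3) by simp
qed

lemma points_carrier:
  assumes "is_complex C" "p \<in> points C"
  obtains \<sigma> where "\<sigma> \<in> C" "\<And>v. v |\<in>| \<sigma> \<longleftrightarrow> 0 < p v" "sum p (fset \<sigma>) = 1"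
proof -
  obtain \<sigma> where \<sigma>: "\<sigma> \<in> C" "\<And>v. v |\<notin>| \<sigma> \<Longrightarrow> p v = 0" "\<And>v. 0 \<le> p v" "sum p (fset \<sigma>) = 1"
    using assms(2) by (rule pointsE) blast
  define \<tau> where "\<tau> = ffilter (\<lambda>v. 0 < p v) \<sigma>"
  have \<tau>: "v |\<in>| \<tau> \<longleftrightarrow> 0 < p v" for v
    using \<sigma>(2)[of v] by (cases "v |\<in>| \<sigma>") (auto simp: \<tau>_def)
  have "p v = 0" if "v |\<notin>| \<tau>" for v
    using \<tau>[of v] \<sigma>(3)[of v] that by simp
  then have sum: "sum p (fset \<tau>) = 1"
    unfolding \<sigma>(4)[symmetric] by (intro sum.mono_neutral_left) (auto simp: \<tau>_def)
  then have "\<tau> \<noteq> {||}" by auto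
  moreover have "\<tau> |\<subseteq>| \<sigma>" by (auto simp: \<tau>_def)
  ultimately have "\<tau> \<in> C" using assms(1) \<sigma>(1) by (auto simp: is_complex_def)
  then show ?thesis using that \<tau> sum by blast
qed

lemma points_ex_pos:
  assumes "p \<in> points C"
  shows "\<exists>v. 0 < p v"
proof (rule ccontr)
  assume "\<nexists>v. 0 < p v"
  then have "p v = 0" for v using points_nonneg[OF assms, of v] by (metis order_le_less)
  then show False using assms by (auto elim!: pointsE)
qed

lemma pos_imp_vert: "p \<in> points C \<Longrightarrow> 0 < p v \<Longrightarrow> v \<in> verts C"
  using points_off_verts by fastforce

text \<open>Each closed face is a closed subset of a product of copies of [0,1] and {0}, and there
  are finitely many faces.\<close>

lemma compact_points:
  fixes C :: "'v scomplex"
  assumes "finite C"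
  shows "compact (points C)"
proof -
  have "compact {p :: 'v \<Rightarrow> real. (\<forall>v. 0 \<le> p v) \<and> (\<forall>v. v |\<notin>| \<sigma> \<longrightarrow> p v = 0) \<and> sum p (fset \<sigma>) = 1}"
    (is "compact ?K") for \<sigma> :: "'v fset"
  proof -
    let ?P = "Pi\<^sub>E UNIV (\<lambda>v. if v |\<in>| \<sigma> then {0..1} else {0}) :: ('v \<Rightarrow> real) set"
    have "compactin (product_topology (\<lambda>_. euclidean) UNIV) ?P"
      by (subst compactin_PiE) auto
    then have "compact ?P" by (simp add: euclidean_product_topology)
    moreover have "closed {p :: 'v \<Rightarrow> real. sum p (fset \<sigma>) = 1}"
      by (intro closed_Collect_eq continuous_intros continuous_on_coordinate)
    moreover have "?K = ?P \<inter> {p. sum p (fset \<sigma>) = 1}"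
    proof
      show "?K \<subseteq> ?P \<inter> {p. sum p (fset \<sigma>) = 1}"
      proof
        fix p assume p: "p \<in> ?K"
        then have "p v \<le> 1" if "v |\<in>| \<sigma>" for v
          using member_le_sum[of v "fset \<sigma>" p] that by auto
        then show "p \<in> ?P \<inter> {p. sum p (fset \<sigma>) = 1}"
          using p by (auto simp: PiE_iff)
      qed
      show "?P \<inter> {p. sum p (fset \<sigma>) = 1} \<subseteq> ?K"
      proof
        fix p assume p: "p \<in> ?P \<inter> {p. sum p (fset \<sigma>) = 1}"
        then have "p v \<in> (if v |\<in>| \<sigma> then {0..1} else {0})" for v by (auto simp: PiE_iff)
        then have "0 \<le> p v \<and> (v |\<notin>| \<sigma> \<longrightarrow> p v = 0)" for v
          by (metis atLeastAtMost_iff order_refl singletonD)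
        then show "p \<in> ?K" using p by blast
      qed
    qed
    ultimately show "compact ?K" by (simp add: compact_Int_closed)
  qed
  then have "compact (\<Union>\<sigma>\<in>C. {p :: 'v \<Rightarrow> real. (\<forall>v. 0 \<le> p v) \<and> (\<forall>v. v |\<notin>| \<sigma> \<longrightarrow> p v = 0) \<and> sum p (fset \<sigma>) = 1})"
    by (intro compact_UN assms)
  moreover have "points C = (\<Union>\<sigma>\<in>C. {p. (\<forall>v. 0 \<le> p v) \<and> (\<forall>v. v |\<notin>| \<sigma> \<longrightarrow> p v = 0) \<and> sum p (fset \<sigma>) = 1})"
    by (auto simp: points_def)
  ultimately show ?thesis by (simp only:)
qed

definition vpoint :: "'v \<Rightarrow> 'v \<Rightarrow> real" where
  "vpoint v = (\<lambda>w. if w = v then 1 else 0)"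

lemma vpoint_in_points:
  assumes "is_complex C" "v \<in> verts C"
  shows "vpoint v \<in> points C"
proof -
  have "{|v|} \<in> C" using assms by (fastforce simp: verts_def is_complex_def)
  then show ?thesis unfolding points_def vpoint_def by (auto intro!: bexI[of _ "{|v|}"])
qed

lemma points_uniformly_continuous:
  fixes \<Phi> :: "('v \<Rightarrow> real) \<Rightarrow> 'w \<Rightarrow> real"
  assumes "finite C" "finite D" "continuous_on (points C) \<Phi>" "\<Phi> ` points C \<subseteq> points D" "\<epsilon> > 0"
  shows "\<exists>\<delta>>0. \<forall>p\<in>points C. \<forall>q\<in>points C. (\<forall>v. \<bar>p v - q v\<bar> < \<delta>) \<longrightarrow> (\<forall>w. \<bar>\<Phi> p w - \<Phi> q w\<bar> < \<epsilon>)"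
  by (rule continuous_on_finite_uniform[of _ _ "verts C" "verts D"])
     (use assms in \<open>auto simp: compact_points finite_verts points_off_verts\<close>)

section \<open>Weighted subdivision\<close>

lemma finite_sd:
  assumes "finite C"
  shows "finite (sd C)"
proof -
  have "sd C \<subseteq> (\<lambda>S. Face |`| S) ` {S. fset S \<subseteq> C}"
    by (auto simp: sd_def)
  moreover have "{S. fset S \<subseteq> C} = fset (fPow (Abs_fset C))"
    using assms by (auto simp: less_eq_fset.rep_eq Abs_fset_inverse)
  then have "finite {S. fset S \<subseteq> C}" by simp
  ultimately show ?thesis by (meson finite_imageI finite_subset)
qed

lemma finite_bsd: "finite A \<Longrightarrow> finite (bsd k A)"
  by (induction k) (simp_all add: bsd_0 bsd_Suc finite_sd)

lemma sd_mono: "B \<subseteq> C \<Longrightarrow> sd B \<subseteq> sd C"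
  unfolding sd_def by blast

lemma bsd_mono: "B \<subseteq> A \<Longrightarrow> bsd k B \<subseteq> bsd k A"
  by (induction k) (auto simp: bsd_0 bsd_Suc dest: sd_mono)

text \<open>The map from the subdivision to \<open>C\<close> that is affine on faces and sends the
  vertex \<open>Face \<sigma>\<close> to the point with coordinates \<open>w \<sigma>\<close>. With
  barycentric weights it is the usual identification of the two polyhedra.\<close>

definition wsub :: "'a vert scomplex \<Rightarrow> ('a vert fset \<Rightarrow> 'a vert \<Rightarrow> real) \<Rightarrow>
    ('a vert \<Rightarrow> real) \<Rightarrow> 'a vert \<Rightarrow> real" where
  "wsub C w p = (\<lambda>v. \<Sum>\<sigma>\<in>C. w \<sigma> v * p (Face \<sigma>))"

text \<open>Strict positivity places the chosen centre in the open face, which makes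
  \<open>wsub\<close> bijective. An elementary selection corresponds to degenerate weights on the
  boundary of this condition.\<close>

definition weights :: "'v scomplex \<Rightarrow> ('v fset \<Rightarrow> 'v \<Rightarrow> real) \<Rightarrow> bool" where
  "weights C w \<longleftrightarrow> (\<forall>\<sigma>\<in>C. (\<forall>v. v |\<in>| \<sigma> \<longrightarrow> 0 < w \<sigma> v) \<and> (\<forall>v. v |\<notin>| \<sigma> \<longrightarrow> w \<sigma> v = 0) \<and>
     sum (w \<sigma>) (fset \<sigma>) = 1)"

lemma weights_nonneg: "weights C w \<Longrightarrow> \<sigma> \<in> C \<Longrightarrow> 0 \<le> w \<sigma> v"
  by (cases "v |\<in>| \<sigma>") (auto simp: weights_def intro: less_imp_le)

lemma points_sd_vert: "p \<in> points (sd D) \<Longrightarrow> p v \<noteq> 0 \<Longrightarrow> v \<in> Face ` D"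
  using points_off_verts verts_sd by metis

lemma points_sd_chain:
  assumes "p \<in> points (sd D)" "p (Face \<sigma>) \<noteq> 0" "p (Face \<tau>) \<noteq> 0"
  shows "\<sigma> |\<subseteq>| \<tau> \<or> \<tau> |\<subseteq>| \<sigma>"
proof -
  obtain \<kappa> where \<kappa>: "\<kappa> \<in> sd D" "\<And>v. v |\<notin>| \<kappa> \<Longrightarrow> p v = 0"
    using assms(1) by (rule pointsE) blast
  then have "Face \<sigma> |\<in>| \<kappa>" "Face \<tau> |\<in>| \<kappa>" using assms by blast+
  then show ?thesis using \<kappa>(1) by (auto simp: sd_def)
qed

lemma points_sd_sum:
  assumes "finite C" "D \<subseteq> C" "p \<in> points (sd D)"
  shows "(\<Sum>\<sigma>\<in>C. p (Face \<sigma>)) = 1"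
proof -
  have "(\<Sum>\<sigma>\<in>C. p (Face \<sigma>)) = sum p (Face ` C)"
    by (simp add: sum.reindex inj_on_def)
  also have "\<dots> = 1"
    using assms by (intro points_sum[of _ "sd D"]) (auto simp: verts_sd)
  finally show ?thesis .
qed

lemma points_sdI:
  assumes "finite D" and nonneg: "\<And>v. 0 \<le> p v" and "\<And>v. p v \<noteq> 0 \<Longrightarrow> v \<in> Face ` D"
    and chain: "\<And>\<sigma> \<tau>. p (Face \<sigma>) \<noteq> 0 \<Longrightarrow> p (Face \<tau>) \<noteq> 0 \<Longrightarrow> \<sigma> |\<subseteq>| \<tau> \<or> \<tau> |\<subseteq>| \<sigma>"
    and sum: "(\<Sum>\<sigma>\<in>D. p (Face \<sigma>)) = 1"
  shows "p \<in> points (sd D)"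
proof -
  define S where "S = Abs_fset {\<sigma> \<in> D. p (Face \<sigma>) \<noteq> 0}"
  have S: "fset S = {\<sigma> \<in> D. p (Face \<sigma>) \<noteq> 0}"
    unfolding S_def using assms(1) by (simp add: Abs_fset_inverse)
  have "(\<Sum>\<sigma>\<in>fset S. p (Face \<sigma>)) = 1"
    unfolding S sum[symmetric] using assms(1) by (intro sum.mono_neutral_left) auto
  moreover have "(\<Sum>\<sigma>\<in>fset S. p (Face \<sigma>)) = sum p (fset (Face |`| S))"
    by (simp add: sum.reindex inj_on_def)
  ultimately have "sum p (fset (Face |`| S)) = 1" by simp
  moreover from this have "S \<noteq> {||}" by auto
  then have "Face |`| S \<in> sd D"
    unfolding sd_def using S chain by (intro CollectI exI[of _ S]) auto
  moreover have "p v = 0" if "v |\<notin>| Face |`| S" for v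
  proof (rule ccontr)
    assume "p v \<noteq> 0"
    then obtain \<sigma> where "\<sigma> \<in> D" "v = Face \<sigma>" using assms(3) by blast
    then have "\<sigma> \<in> fset S" using S \<open>p v \<noteq> 0\<close> by simp
    then show False using that \<open>v = Face \<sigma>\<close> by blast
  qed
  ultimately show ?thesis using nonneg unfolding points_def by blast
qed

lemma wsub_sum:
  assumes "finite C" "weights C w"
  shows "(\<Sum>v\<in>verts C. wsub C w p v) = (\<Sum>\<sigma>\<in>C. p (Face \<sigma>))"
proof -
  have "(\<Sum>v\<in>verts C. wsub C w p v) = (\<Sum>\<sigma>\<in>C. (\<Sum>v\<in>verts C. w \<sigma> v) * p (Face \<sigma>))"
    unfolding wsub_def by (subst sum.swap) (simp add: sum_distrib_right)
  also have "\<dots> = (\<Sum>\<sigma>\<in>C. p (Face \<sigma>))"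
  proof (rule sum.cong)
    fix \<sigma> assume \<sigma>: "\<sigma> \<in> C"
    have "(\<Sum>v\<in>verts C. w \<sigma> v) = sum (w \<sigma>) (fset \<sigma>)"
      using face_subset_verts[OF \<sigma>] finite_verts[OF assms(1)] assms(2) \<sigma>
      by (intro sum.mono_neutral_right) (auto simp: weights_def)
    then show "(\<Sum>v\<in>verts C. w \<sigma> v) * p (Face \<sigma>) = p (Face \<sigma>)"
      using assms(2) \<sigma> by (simp add: weights_def)
  qed simp
  finally show ?thesis .
qed

text \<open>A point of the subdivision is carried by a chain of faces, and the centres of all these
  faces lie in the greatest one, \<mu>.\<close>

lemma wsub_in_points:
  assumes "finite C" "weights C w" "D \<subseteq> C" "p \<in> points (sd D)"
  shows "wsub C w p \<in> points D"
proof -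
  obtain \<kappa> where \<kappa>: "\<kappa> \<in> sd D" "\<And>v. v |\<notin>| \<kappa> \<Longrightarrow> p v = 0"
    using assms(4) by (rule pointsE) blast
  from \<kappa>(1) obtain S where S: "\<kappa> = Face |`| S" "S \<noteq> {||}" "fset S \<subseteq> D"
    "\<forall>\<sigma>\<in>fset S. \<forall>\<tau>\<in>fset S. \<sigma> |\<subseteq>| \<tau> \<or> \<tau> |\<subseteq>| \<sigma>"
    unfolding sd_def by blast
  obtain \<mu> where \<mu>: "\<mu> \<in> fset S" "\<forall>\<sigma>\<in>fset S. \<sigma> |\<subseteq>| \<mu>"
    using fchain_greatest[OF S(2,4)] by blast
  have zero: "wsub C w p v = 0" if "v |\<notin>| \<mu>" for v
    unfolding wsub_def
  proof (intro sum.neutral ballI)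
    fix \<sigma> assume \<sigma>: "\<sigma> \<in> C"
    show "w \<sigma> v * p (Face \<sigma>) = 0"
    proof (cases "\<sigma> |\<in>| S")
      case True
      then have "v |\<notin>| \<sigma>" using \<mu> that by blast
      then show ?thesis using assms(2) \<sigma> by (simp add: weights_def)
    next
      case False
      then have "Face \<sigma> |\<notin>| \<kappa>" by (auto simp: S(1))
      then show ?thesis using \<kappa>(2) by simp
    qed
  qed
  have "\<mu> \<in> D" using \<mu> S(3) by blast
  have "sum (wsub C w p) (fset \<mu>) = sum (wsub C w p) (verts C)"
    using zero face_subset_verts[of \<mu> C] \<open>\<mu> \<in> D\<close> assms(1,3) finite_verts[of C]
    by (intro sum.mono_neutral_left) auto
  also have "\<dots> = 1"
    using wsub_sum[OF assms(1,2)] points_sd_sum[OF assms(1,3,4)] by simp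
  finally have "sum (wsub C w p) (fset \<mu>) = 1" .
  moreover have "0 \<le> wsub C w p v" for v
    unfolding wsub_def
    using weights_nonneg[OF assms(2)] points_nonneg[OF assms(4)] by (intro sum_nonneg) simp
  ultimately show ?thesis
    unfolding points_def using zero \<open>\<mu> \<in> D\<close> by blast
qed

lemma inj_on_wsub:
  assumes "finite C" "is_complex C" "weights C w"
  shows "inj_on (wsub C w) (points (sd C))"
proof (rule inj_onI, rule ccontr)
  fix p q
  assume p: "p \<in> points (sd C)" and q: "q \<in> points (sd C)" and eq: "wsub C w p = wsub C w q"
    and "p \<noteq> q"
  text \<open>At a largest face where \<open>p\<close> and \<open>q\<close> differ, some vertex sees the difference
    of the two coefficients and no smaller face of the chain of \<open>q\<close>.\<close>
  have key: False
    if p: "p \<in> points (sd C)" and q: "q \<in> points (sd C)" and eq: "wsub C w p = wsub C w q"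
      and \<sigma>: "\<sigma> \<in> C" "q (Face \<sigma>) < p (Face \<sigma>)"
      and max: "\<And>\<tau>. \<tau> \<in> C \<Longrightarrow> fcard \<sigma> < fcard \<tau> \<Longrightarrow> p (Face \<tau>) = q (Face \<tau>)" for p q \<sigma>
  proof -
    define S where "S = Abs_fset {\<tau> \<in> C. q (Face \<tau>) \<noteq> 0 \<and> fcard \<tau> \<le> fcard \<sigma> \<and> \<tau> \<noteq> \<sigma>}"
    have S: "fset S = {\<tau> \<in> C. q (Face \<tau>) \<noteq> 0 \<and> fcard \<tau> \<le> fcard \<sigma> \<and> \<tau> \<noteq> \<sigma>}"
      unfolding S_def using assms(1) by (simp add: Abs_fset_inverse)
    have "\<exists>v. v |\<in>| \<sigma> \<and> (\<forall>\<tau>\<in>fset S. v |\<notin>| \<tau>)"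
    proof (cases "S = {||}")
      case True
      have "\<sigma> \<noteq> {||}" using assms(2) \<sigma>(1) by (auto simp: is_complex_def)
      then show ?thesis using True by auto
    next
      case False
      have "\<forall>\<sigma>\<in>fset S. \<forall>\<tau>\<in>fset S. \<sigma> |\<subseteq>| \<tau> \<or> \<tau> |\<subseteq>| \<sigma>"
        using points_sd_chain[OF q] by (simp add: S)
      then obtain \<mu> where \<mu>: "\<mu> \<in> fset S" "\<forall>\<tau>\<in>fset S. \<tau> |\<subseteq>| \<mu>"
        using fchain_greatest[OF False] by blast
      \<comment> \<open>Since \<mu> has at most as many vertices as \<sigma>, inclusion would force
        \<mu> = \<sigma>, which \<open>S\<close> excludes.\<close>
      have "\<not> \<sigma> |\<subseteq>| \<mu>"
        using \<mu>(1) S by (auto dest: fcard_seteq)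
      then show ?thesis using \<mu>(2) by blast
    qed
    then obtain v where v: "v |\<in>| \<sigma>" "\<And>\<tau>. \<tau> \<in> fset S \<Longrightarrow> v |\<notin>| \<tau>" by blast
    have "0 < (\<Sum>\<tau>\<in>C. w \<tau> v * (p (Face \<tau>) - q (Face \<tau>)))"
    proof (rule sum_pos2[OF assms(1) \<sigma>(1)])
      show "0 < w \<sigma> v * (p (Face \<sigma>) - q (Face \<sigma>))"
        using \<sigma> v(1) assms(3) by (simp add: weights_def)
      fix \<tau> assume \<tau>: "\<tau> \<in> C"
      consider "\<tau> = \<sigma>" | "fcard \<sigma> < fcard \<tau>" | "\<tau> \<noteq> \<sigma>" "fcard \<tau> \<le> fcard \<sigma>" "v |\<in>| \<tau>"
        | "\<tau> \<noteq> \<sigma>" "fcard \<tau> \<le> fcard \<sigma>" "v |\<notin>| \<tau>"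
        by linarith
      then show "0 \<le> w \<tau> v * (p (Face \<tau>) - q (Face \<tau>))"
      proof cases
        case 1
        then show ?thesis using \<open>0 < w \<sigma> v * (p (Face \<sigma>) - q (Face \<sigma>))\<close> by simp
      next
        case 2
        then show ?thesis using max \<tau> by simp
      next
        case 3
        then have "q (Face \<tau>) = 0" using v(2)[of \<tau>] \<tau> by (auto simp: S)
        then show ?thesis
          using weights_nonneg[OF assms(3) \<tau>] points_nonneg[OF p] by simp
      next
        case 4
        then show ?thesis using assms(3) \<tau> by (simp add: weights_def)
      qed
    qed
    also have "\<dots> = wsub C w p v - wsub C w q v"
      by (simp add: wsub_def sum_subtractf right_diff_distrib)
    finally show False using eq by simp
  qed
  define T where "T = {\<tau> \<in> C. p (Face \<tau>) \<noteq> q (Face \<tau>)}"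
  have "T \<noteq> {}"
  proof
    assume "T = {}"
    then have "p v = q v" if "v \<in> Face ` C" for v
      using that by (auto simp: T_def)
    then have "p v = q v" for v
      using points_sd_vert[OF p, of v] points_sd_vert[OF q, of v] by metis
    then show False using \<open>p \<noteq> q\<close> by blast
  qed
  moreover have "finite T" using assms(1) by (simp add: T_def)
  ultimately have "Max (fcard ` T) \<in> fcard ` T" by (intro Max_in) auto
  then obtain \<sigma> where "\<sigma> \<in> T" "fcard \<sigma> = Max (fcard ` T)" by auto
  then have \<sigma>: "\<sigma> \<in> T" "\<And>\<tau>. \<tau> \<in> T \<Longrightarrow> fcard \<tau> \<le> fcard \<sigma>"
    using \<open>finite T\<close> by auto
  have max: "p (Face \<tau>) = q (Face \<tau>)" if "\<tau> \<in> C" "fcard \<sigma> < fcard \<tau>" for \<tau>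
    using \<sigma>(2)[of \<tau>] that by (force simp: T_def)
  have "q (Face \<sigma>) < p (Face \<sigma>) \<or> p (Face \<sigma>) < q (Face \<sigma>)"
    using \<sigma>(1) by (auto simp: T_def)
  then show False
    using key[OF p q eq _ _ max] key[OF q p eq[symmetric] _ _ max[symmetric]] \<sigma>(1)
    by (auto simp: T_def)
qed

text \<open>Peel off from \<open>q\<close> the largest multiple of the centre of its carrier
  \<sigma> that leaves no negative coordinate. The remainder is carried by a proper face of
  \<sigma>, so recursion produces a chain. The total mass of \<open>q\<close> is left free, and
  \<sigma> may be empty, because the remainders lose mass down to 0.\<close>

lemma wsub_cone_surj:
  assumes "finite C" "is_complex D" "weights C w" "D \<subseteq> C"
  shows "\<sigma> = {||} \<or> \<sigma> \<in> D \<Longrightarrow> (\<And>v. 0 \<le> q v) \<Longrightarrow> (\<And>v. v |\<in>| \<sigma> \<longleftrightarrow> 0 < q v) \<Longrightarrow>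
    \<exists>p. (\<forall>v. 0 \<le> p v) \<and> (\<forall>v. p v \<noteq> 0 \<longrightarrow> (\<exists>\<tau>\<in>D. \<tau> |\<subseteq>| \<sigma> \<and> v = Face \<tau>)) \<and>
      (\<forall>\<rho> \<tau>. p (Face \<rho>) \<noteq> 0 \<longrightarrow> p (Face \<tau>) \<noteq> 0 \<longrightarrow> \<rho> |\<subseteq>| \<tau> \<or> \<tau> |\<subseteq>| \<rho>) \<and> wsub C w p = q"
proof (induction "fcard \<sigma>" arbitrary: \<sigma> q rule: less_induct)
  case less
  show ?case
  proof (cases "\<sigma> = {||}")
    case True
    then have "q v = 0" for v using less.prems(2)[of v] less.prems(3)[of v] by simp
    then have "wsub C w (\<lambda>_. 0) = q" by (auto simp: wsub_def)
    then show ?thesis by (intro exI[of _ "\<lambda>_. 0"]) simp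
  next
    case False
    then have \<sigma>: "\<sigma> \<in> D" "\<sigma> \<in> C" using less.prems(1) assms(4) by auto
    have wpos: "\<And>v. v |\<in>| \<sigma> \<Longrightarrow> 0 < w \<sigma> v" and wzero: "\<And>v. v |\<notin>| \<sigma> \<Longrightarrow> w \<sigma> v = 0"
      using assms(3) \<sigma>(2) by (auto simp: weights_def)
    have qzero: "q v = 0" if "v |\<notin>| \<sigma>" for v
      using less.prems(2,3)[of v] that by simp
    \<comment> \<open>The largest \<open>c\<close> for which \<open>c\<close> times the centre stays
      below \<open>q\<close>; at a minimising vertex \<open>v0\<close> the remainder
      vanishes.\<close>
    define c where "c = Min ((\<lambda>v. q v / w \<sigma> v) ` fset \<sigma>)"
    have ne: "(\<lambda>v. q v / w \<sigma> v) ` fset \<sigma> \<noteq> {}" using False by auto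
    have "c \<in> (\<lambda>v. q v / w \<sigma> v) ` fset \<sigma>"
      unfolding c_def by (rule Min_in) (use ne in auto)
    then obtain v0 where v0: "v0 |\<in>| \<sigma>" "c = q v0 / w \<sigma> v0" by blast
    then have "c > 0" using wpos less.prems(3) by simp
    have cle: "c * w \<sigma> v \<le> q v" if "v |\<in>| \<sigma>" for v
    proof -
      have "c \<le> q v / w \<sigma> v" unfolding c_def using that by (intro Min_le) auto
      then show ?thesis using wpos[OF that] by (simp add: pos_le_divide_eq)
    qed
    define q' where "q' = (\<lambda>v. q v - c * w \<sigma> v)"
    have q'0: "q' v = 0" if "v |\<notin>| \<sigma>" for v using that qzero wzero by (simp add: q'_def)
    have q'nonneg: "0 \<le> q' v" for v
      using cle[of v] q'0[of v] by (cases "v |\<in>| \<sigma>") (auto simp: q'_def)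
    define \<sigma>' where "\<sigma>' = ffilter (\<lambda>v. 0 < q' v) \<sigma>"
    have \<sigma>': "v |\<in>| \<sigma>' \<longleftrightarrow> 0 < q' v" for v
      using q'0[of v] by (cases "v |\<in>| \<sigma>") (auto simp: \<sigma>'_def)
    have "q' v0 = 0" using v0 wpos[of v0] by (simp add: q'_def)
    then have "v0 |\<notin>| \<sigma>'" using \<sigma>' by simp
    then have sub: "\<sigma>' |\<subset>| \<sigma>" using v0 by (auto simp: \<sigma>'_def)
    then have "fcard \<sigma>' < fcard \<sigma>" by (rule pfsubset_fcard_mono)
    moreover have "\<sigma>' = {||} \<or> \<sigma>' \<in> D"
      using assms(2) \<sigma>(1) sub by (auto simp: is_complex_def)
    ultimately obtain p where p: "\<forall>v. 0 \<le> p v" "\<forall>v. p v \<noteq> 0 \<longrightarrow> (\<exists>\<tau>\<in>D. \<tau> |\<subseteq>| \<sigma>' \<and> v = Face \<tau>)"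
      "\<forall>\<rho> \<tau>. p (Face \<rho>) \<noteq> 0 \<longrightarrow> p (Face \<tau>) \<noteq> 0 \<longrightarrow> \<rho> |\<subseteq>| \<tau> \<or> \<tau> |\<subseteq>| \<rho>" "wsub C w p = q'"
      using less.hyps[of \<sigma>' q'] q'nonneg \<sigma>' by blast
    have psub: "\<tau> |\<subseteq>| \<sigma>'" if "p (Face \<tau>) \<noteq> 0" for \<tau> using p(2) that by blast
    then have p\<sigma>: "p (Face \<sigma>) = 0" using sub by (meson leD)
    \<comment> \<open>The faces used by \<open>p\<close> lie in the proper face \<sigma>' of
      \<sigma>, so the coefficient at \<open>Face \<sigma>\<close> was 0 and adding \<sigma> on top
      keeps the support a chain.\<close>
    define p' where "p' = p(Face \<sigma> := c)"
    have "wsub C w p' v = q v" for v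
    proof -
      have "wsub C w p' v = (\<Sum>\<tau>\<in>C. w \<tau> v * p (Face \<tau>) + (if \<tau> = \<sigma> then w \<sigma> v * c else 0))"
        unfolding wsub_def by (rule sum.cong) (auto simp: p'_def p\<sigma>)
      also have "\<dots> = q' v + w \<sigma> v * c"
        using assms(1) \<sigma>(2) p(4) by (simp add: sum.distrib wsub_def fun_eq_iff)
      finally show ?thesis by (simp add: q'_def)
    qed
    then have "wsub C w p' = q" by blast
    moreover have "\<forall>v. 0 \<le> p' v" using p(1) \<open>c > 0\<close> by (simp add: p'_def)
    moreover have "\<forall>v. p' v \<noteq> 0 \<longrightarrow> (\<exists>\<tau>\<in>D. \<tau> |\<subseteq>| \<sigma> \<and> v = Face \<tau>)"
      using p(2) sub \<sigma>(1) unfolding p'_def by (auto simp: less_le)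
    moreover have "\<forall>\<rho> \<tau>. p' (Face \<rho>) \<noteq> 0 \<longrightarrow> p' (Face \<tau>) \<noteq> 0 \<longrightarrow> \<rho> |\<subseteq>| \<tau> \<or> \<tau> |\<subseteq>| \<rho>"
      using p(3) psub sub unfolding p'_def by (auto simp: less_le)
    ultimately show ?thesis by blast
  qed
qed

text \<open>Injectivity is inherited from \<open>C\<close>, while the preimage is built from faces
  of \<open>D\<close>. One map is thus a bijection for all subcomplexes simultaneously.\<close>

lemma bij_betw_wsub:
  assumes "finite C" "is_complex C" "weights C w" "is_complex D" "D \<subseteq> C"
  shows "bij_betw (wsub C w) (points (sd D)) (points D)"
proof -
  have "inj_on (wsub C w) (points (sd D))"
    using inj_on_subset[OF inj_on_wsub[OF assms(1-3)]] points_mono sd_mono[OF assms(5)] by blast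
  moreover have "wsub C w ` points (sd D) \<subseteq> points D"
    using wsub_in_points[OF assms(1,3,5)] by blast
  moreover have "q \<in> wsub C w ` points (sd D)" if q: "q \<in> points D" for q
  proof -
    obtain \<sigma> where \<sigma>: "\<sigma> \<in> D" "\<And>v. v |\<in>| \<sigma> \<longleftrightarrow> 0 < q v" "sum q (fset \<sigma>) = 1"
      using points_carrier[OF assms(4) q] by blast
    obtain p where p: "\<forall>v. 0 \<le> p v" "\<forall>v. p v \<noteq> 0 \<longrightarrow> (\<exists>\<tau>\<in>D. \<tau> |\<subseteq>| \<sigma> \<and> v = Face \<tau>)"
      "\<forall>\<rho> \<tau>. p (Face \<rho>) \<noteq> 0 \<longrightarrow> p (Face \<tau>) \<noteq> 0 \<longrightarrow> \<rho> |\<subseteq>| \<tau> \<or> \<tau> |\<subseteq>| \<rho>" "wsub C w p = q"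
      using wsub_cone_surj[OF assms(1,4,3,5), of \<sigma> q] \<sigma> points_nonneg[OF q] by blast
    have "(\<Sum>\<sigma>\<in>C. p (Face \<sigma>)) = 1"
      using wsub_sum[OF assms(1,3), of p] p(4) points_sum[OF q finite_verts[OF assms(1)] verts_mono[OF assms(5)]]
      by simp
    moreover have "(\<Sum>\<sigma>\<in>C. p (Face \<sigma>)) = (\<Sum>\<sigma>\<in>D. p (Face \<sigma>))"
      using assms(1,5) p(2) by (intro sum.mono_neutral_right) auto
    ultimately have "p \<in> points (sd D)"
      using p finite_subset[OF assms(5,1)] by (intro points_sdI) auto
    then show ?thesis using p(4) by blast
  qed
  ultimately show ?thesis unfolding bij_betw_def by blast
qed

lemma continuous_on_wsub: "continuous_on S (wsub C w)"
  unfolding wsub_def by (intro continuous_intros continuous_on_coordinate)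

definition bary :: "'v fset \<Rightarrow> 'v \<Rightarrow> real" where
  "bary \<sigma> v = (if v |\<in>| \<sigma> then 1 / real (fcard \<sigma>) else 0)"

lemma fcard_pos: "\<sigma> \<noteq> {||} \<Longrightarrow> 0 < fcard \<sigma>"
  by (metis fcard_0_eq gr0I)

lemma face_nonempty: "is_complex C \<Longrightarrow> \<sigma> \<in> C \<Longrightarrow> \<sigma> \<noteq> {||}"
  by (auto simp: is_complex_def)

lemma bary_bounds: "0 \<le> bary \<sigma> v" "bary \<sigma> v \<le> 1"
proof -
  show "0 \<le> bary \<sigma> v" by (simp add: bary_def)
  show "bary \<sigma> v \<le> 1"
  proof (cases "v |\<in>| \<sigma>")
    case True
    then have "0 < fcard \<sigma>" by (intro fcard_pos) auto
    then show ?thesis by (simp add: bary_def)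
  qed (simp add: bary_def)
qed

lemma weights_bary:
  assumes "is_complex C"
  shows "weights C bary"
  unfolding weights_def
proof (intro ballI conjI allI impI)
  fix \<sigma> v assume \<sigma>: "\<sigma> \<in> C"
  have pos: "0 < fcard \<sigma>" using face_nonempty[OF assms \<sigma>] by (rule fcard_pos)
  then show "v |\<in>| \<sigma> \<Longrightarrow> 0 < bary \<sigma> v" by (simp add: bary_def)
  show "v |\<notin>| \<sigma> \<Longrightarrow> bary \<sigma> v = 0" by (simp add: bary_def)
  have "sum (bary \<sigma>) (fset \<sigma>) = (\<Sum>v\<in>fset \<sigma>. 1 / real (fcard \<sigma>))"
    by (rule sum.cong) (auto simp: bary_def)
  then show "sum (bary \<sigma>) (fset \<sigma>) = 1" using pos by (auto simp: fcard.rep_eq)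
qed

section \<open>The realization of a simplicial map\<close>

definition push :: "'v smap \<Rightarrow> ('v \<Rightarrow> real) \<Rightarrow> 'v \<Rightarrow> real" where
  "push f p = (\<lambda>w. \<Sum>v\<in>verts (src f). if fn f v = w then p v else 0)"

lemma continuous_on_push: "continuous_on S (push f)"
  unfolding push_def
proof (intro continuous_on_coordinatewise_then_product continuous_on_sum)
  fix w v show "continuous_on S (\<lambda>p. if fn f v = w then p v else (0::real))"
    by (cases "fn f v = w") (simp_all add: continuous_on_coordinate)
qed

lemma push_in_points:
  assumes "simplicial f" "finite (src f)" "p \<in> points (src f)"
  shows "push f p \<in> points (tgt f)"
proof -
  obtain \<sigma> where \<sigma>: "\<sigma> \<in> src f" "\<And>v. v |\<notin>| \<sigma> \<Longrightarrow> p v = 0" 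
    using assms(3) by (rule pointsE) blast
  have "fn f |`| \<sigma> \<in> tgt f" using assms(1) \<sigma>(1) by (simp add: simplicial_def)
  moreover have "push f p w = 0" if "w |\<notin>| fn f |`| \<sigma>" for w
    unfolding push_def using that \<sigma>(2) by (intro sum.neutral) auto
  moreover have "sum (push f p) (fset (fn f |`| \<sigma>)) = 1"
  proof -
    have "sum (push f p) (fset (fn f |`| \<sigma>)) =
        (\<Sum>v\<in>verts (src f). \<Sum>w\<in>fset (fn f |`| \<sigma>). if fn f v = w then p v else 0)"
      unfolding push_def by (rule sum.swap)
    also have "\<dots> = (\<Sum>v\<in>verts (src f). p v)"
    proof (rule sum.cong)
      fix v
      show "(\<Sum>w\<in>fset (fn f |`| \<sigma>). if fn f v = w then p v else 0) = p v"
        using \<sigma>(2)[of v] by (cases "v |\<in>| \<sigma>") (auto simp: sum.delta')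
    qed simp
    also have "\<dots> = 1"
      using assms by (intro points_sum[of _ "src f"]) (auto simp: finite_verts)
    finally show ?thesis .
  qed
  moreover have "0 \<le> push f p w" for w
    unfolding push_def using points_nonneg[OF assms(3)] by (intro sum_nonneg) auto
  ultimately show ?thesis unfolding points_def by blast
qed

text \<open>The fibre over \<open>fn f v\<close> contains \<open>v\<close> and the other summands
  are nonnegative. This carries lower bounds on coordinates through the realization of
  \<open>f\<close>.\<close>

lemma push_ge:
  assumes "finite (src f)" "p \<in> points (src f)"
  shows "p v \<le> push f p (fn f v)"
proof (cases "v \<in> verts (src f)")
  case True
  have "(if fn f v = fn f v then p v else 0) \<le> push f p (fn f v)"
    unfolding push_def
    by (rule member_le_sum[OF True]) (use assms points_nonneg[OF assms(2)] in \<open>simp_all add: finite_verts\<close>)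
  then show ?thesis by simp
next
  case False
  then have "p v = 0" by (rule points_off_verts[OF assms(2)])
  moreover have "0 \<le> push f p (fn f v)"
    unfolding push_def using points_nonneg[OF assms(2)] by (intro sum_nonneg) simp
  ultimately show ?thesis by simp
qed

lemma push_comp:
  assumes "finite (src f)" "finite (src g)" "src f = tgt g" "simplicial g"
  shows "push (comp_smap f g) p = push f (push g p)"
proof
  fix w
  have fv: "fn g v \<in> verts (src f)" if v: "v \<in> verts (src g)" for v
  proof -
    obtain \<sigma> where "\<sigma> \<in> src g" "v |\<in>| \<sigma>" using v by (auto simp: verts_def)
    then have "fn g |`| \<sigma> \<in> src f" "fn g v |\<in>| fn g |`| \<sigma>"
      using assms(3,4) by (auto simp: simplicial_def)
    then show ?thesis using face_subset_verts by blast
  qed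
  have "push f (push g p) w = (\<Sum>u\<in>verts (src f). \<Sum>v\<in>verts (src g).
      if fn f u = w \<and> fn g v = u then p v else 0)"
    unfolding push_def by (intro sum.cong) auto
  also have "\<dots> = (\<Sum>v\<in>verts (src g). \<Sum>u\<in>verts (src f).
      if fn f u = w \<and> fn g v = u then p v else 0)"
    by (rule sum.swap)
  also have "\<dots> = (\<Sum>v\<in>verts (src g). if fn f (fn g v) = w then p v else 0)"
  proof (rule sum.cong)
    fix v assume v: "v \<in> verts (src g)"
    have "(\<Sum>u\<in>verts (src f). if fn f u = w \<and> fn g v = u then p v else 0) =
       (\<Sum>u\<in>verts (src f). if fn g v = u then (if fn f (fn g v) = w then p v else 0) else 0)"
      by (intro sum.cong) auto
    also have "\<dots> = (if fn f (fn g v) = w then p v else 0)"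
      using fv[OF v] assms(1) by (simp add: sum.delta' finite_verts)
    finally show "(\<Sum>u\<in>verts (src f). if fn f u = w \<and> fn g v = u then p v else 0) =
      (if fn f (fn g v) = w then p v else 0)" .
  qed simp
  also have "\<dots> = push (comp_smap f g) p w"
    unfolding push_def comp_smap_def by (intro sum.cong) auto
  finally show "push (comp_smap f g) p w = push f (push g p) w" by simp
qed

text \<open>With these weights, the realization of \<open>f\<close> sends the weighted centre of a face \<open>\<sigma>\<close> to
  the barycentre of \<open>f \<sigma>\<close>, even if \<open>f\<close> is not injective on \<open>\<sigma>\<close>.\<close>

definition fibre_weights :: "('v \<Rightarrow> 'v) \<Rightarrow> 'v fset \<Rightarrow> 'v \<Rightarrow> real" where
  "fibre_weights \<phi> \<sigma> v = (if v |\<in>| \<sigma> then 1 / (real (fcard (\<phi> |`| \<sigma>)) *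
     real (card {u \<in> fset \<sigma>. \<phi> u = \<phi> v})) else 0)"

text \<open>The image face gives each of its vertices the same mass, and each fibre shares the mass
  of its vertex equally.\<close>

lemma sum_fibre_weights:
  "(\<Sum>v\<in>fset \<sigma>. if \<phi> v = u then fibre_weights \<phi> \<sigma> v else 0) = bary (\<phi> |`| \<sigma>) u"
proof -
  let ?F = "{v \<in> fset \<sigma>. \<phi> v = u}"
  have "(\<Sum>v\<in>fset \<sigma>. if \<phi> v = u then fibre_weights \<phi> \<sigma> v else 0) = (\<Sum>v\<in>?F. fibre_weights \<phi> \<sigma> v)"
    by (simp add: sum.If_cases Int_def)
  also have "\<dots> = (\<Sum>v\<in>?F. 1 / (real (fcard (\<phi> |`| \<sigma>)) * real (card ?F)))"
    by (rule sum.cong) (auto simp: fibre_weights_def)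
  also have "\<dots> = bary (\<phi> |`| \<sigma>) u"
  proof (cases "u |\<in>| \<phi> |`| \<sigma>")
    case True
    then have "?F \<noteq> {}" by auto
    moreover have "finite ?F" by simp
    ultimately have "card ?F > 0" by (simp only: card_gt_0_iff) simp
    then show ?thesis using True by (auto simp: bary_def)
  next
    case False
    then have "?F = {}" by auto
    then show ?thesis using False unfolding bary_def by (simp only: sum.empty if_False)
  qed
  finally show ?thesis .
qed

lemma weights_fibre_weights:
  assumes "is_complex C"
  shows "weights C (fibre_weights \<phi>)"
  unfolding weights_def
proof (intro ballI conjI allI impI)
  fix \<sigma> v assume \<sigma>: "\<sigma> \<in> C"
  have pos: "0 < fcard (\<phi> |`| \<sigma>)" using face_nonempty[OF assms \<sigma>] by (intro fcard_pos) auto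
  show "0 < fibre_weights \<phi> \<sigma> v" if "v |\<in>| \<sigma>"
  proof -
    have "card {u \<in> fset \<sigma>. \<phi> u = \<phi> v} > 0" using that by (auto simp: card_gt_0_iff)
    then show ?thesis using pos that by (simp add: fibre_weights_def)
  qed
  show "v |\<notin>| \<sigma> \<Longrightarrow> fibre_weights \<phi> \<sigma> v = 0" by (simp add: fibre_weights_def)
  have "sum (fibre_weights \<phi> \<sigma>) (fset \<sigma>) =
      (\<Sum>v\<in>fset \<sigma>. \<Sum>u\<in>fset (\<phi> |`| \<sigma>). if \<phi> v = u then fibre_weights \<phi> \<sigma> v else 0)"
    by (intro sum.cong) (auto simp: sum.delta')
  also have "\<dots> = (\<Sum>u\<in>fset (\<phi> |`| \<sigma>). bary (\<phi> |`| \<sigma>) u)"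
    by (subst sum.swap) (simp add: sum_fibre_weights)
  also have "\<dots> = (\<Sum>u\<in>fset (\<phi> |`| \<sigma>). 1 / real (fcard (\<phi> |`| \<sigma>)))"
    by (rule sum.cong) (auto simp: bary_def)
  also have "\<dots> = 1" using pos by (auto simp: fcard.rep_eq)
  finally show "sum (fibre_weights \<phi> \<sigma>) (fset \<sigma>) = 1" .
qed

text \<open>Both sides are linear in \<open>p\<close>, and at the vertex
  \<open>Face \<sigma>\<close> both give the barycentre of the image of \<sigma>. So the realization
  of \<beta>f is conjugate to that of \<open>f\<close>, with different subdivision maps at the two
  ends; barycentric weights at both ends would fail for a non-injective \<open>f\<close>.\<close>

lemma push_wsub_fibre_weights:
  assumes "finite (src f)" "finite (tgt f)" "simplicial f"
  shows "wsub (tgt f) bary (push (sd_smap f) p) = push f (wsub (src f) (fibre_weights (fn f)) p)"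
proof
  fix u
  have im: "fn f |`| \<sigma> \<in> tgt f" if "\<sigma> \<in> src f" for \<sigma>
    using assms(3) that by (simp add: simplicial_def)
  have push_sd: "push (sd_smap f) p (Face \<tau>) = (\<Sum>\<sigma>\<in>src f. if fn f |`| \<sigma> = \<tau> then p (Face \<sigma>) else 0)" for \<tau>
    by (auto simp: push_def sd_smap_def verts_sd sum.reindex inj_on_def intro!: sum.cong)
  have "wsub (tgt f) bary (push (sd_smap f) p) u =
      (\<Sum>\<tau>\<in>tgt f. \<Sum>\<sigma>\<in>src f. if fn f |`| \<sigma> = \<tau> then bary \<tau> u * p (Face \<sigma>) else 0)"
    unfolding wsub_def push_sd by (auto simp: sum_distrib_left intro!: sum.cong)
  also have "\<dots> = (\<Sum>\<sigma>\<in>src f. \<Sum>\<tau>\<in>tgt f. if fn f |`| \<sigma> = \<tau> then bary \<tau> u * p (Face \<sigma>) else 0)"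
    by (rule sum.swap)
  also have "\<dots> = (\<Sum>\<sigma>\<in>src f. bary (fn f |`| \<sigma>) u * p (Face \<sigma>))"
    using im assms(2) by (intro sum.cong) (auto simp: sum.delta')
  also have "\<dots> = (\<Sum>\<sigma>\<in>src f. (\<Sum>v\<in>verts (src f). if fn f v = u then fibre_weights (fn f) \<sigma> v else 0) * p (Face \<sigma>))"
  proof (intro sum.cong refl arg_cong2[where f = "(*)"])
    fix \<sigma> assume \<sigma>: "\<sigma> \<in> src f"
    show "bary (fn f |`| \<sigma>) u = (\<Sum>v\<in>verts (src f). if fn f v = u then fibre_weights (fn f) \<sigma> v else 0)"
      unfolding sum_fibre_weights[symmetric]
      using face_subset_verts[OF \<sigma>] finite_verts[OF assms(1)]
      by (intro sum.mono_neutral_left) (auto simp: fibre_weights_def)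
  qed
  also have "\<dots> = (\<Sum>v\<in>verts (src f). \<Sum>\<sigma>\<in>src f.
      (if fn f v = u then fibre_weights (fn f) \<sigma> v else 0) * p (Face \<sigma>))"
    unfolding sum_distrib_right by (rule sum.swap)
  also have "\<dots> = push f (wsub (src f) (fibre_weights (fn f)) p) u"
    unfolding push_def wsub_def by (intro sum.cong) auto
  finally show "wsub (tgt f) bary (push (sd_smap f) p) u =
    push f (wsub (src f) (fibre_weights (fn f)) p) u" .
qed

section \<open>Near-homeomorphisms\<close>

lemma sd_inj: "sd C = sd D \<Longrightarrow> C = D"
  using verts_sd[of C] verts_sd[of D] by (metis inj_image_eq_iff injI vert.inject(2))

text \<open>Level 0 has a vertex of the form \<open>Atom v\<close>, while the vertices of all higher
  levels are of the form \<open>Face \<sigma>\<close>. The rest is injectivity of \<open>sd\<close>.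
  This allows levels to be read off complexes.\<close>

lemma bsd_inj:
  assumes "A \<noteq> {}" "is_complex A"
  shows "bsd k A = bsd l A \<Longrightarrow> k = l"
proof (induction k arbitrary: l)
  case 0
  show ?case
  proof (cases l)
    case (Suc m)
    obtain \<sigma> v where "\<sigma> \<in> A" "v |\<in>| \<sigma>"
      using assms face_nonempty by fastforce
    then have "Atom v \<in> verts (bsd 0 A)" by (auto simp: bsd_0 verts_def)
    then have "Atom v \<in> verts (sd (bsd m A))" using 0 Suc by (simp add: bsd_Suc)
    then show ?thesis by (auto simp: verts_sd)
  qed simp
next
  case (Suc k)
  show ?case
  proof (cases l)
    case 0
    obtain \<sigma> v where "\<sigma> \<in> A" "v |\<in>| \<sigma>"
      using assms face_nonempty by fastforce
    then have "Atom v \<in> verts (bsd 0 A)" by (auto simp: bsd_0 verts_def)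
    then have "Atom v \<in> verts (sd (bsd k A))" using 0 Suc by (simp add: bsd_Suc)
    then show ?thesis by (auto simp: verts_sd)
  next
    case (Suc m)
    then show ?thesis using Suc.prems Suc.IH[of m] by (simp add: bsd_Suc sd_inj)
  qed
qed

text \<open>The empty complex is set apart because all its subdivisions coincide, so that levels
  would not be determined.\<close>

locale finite_complex =
  fixes A :: "'a scomplex"
  assumes is_complex: "is_complex A" and finite: "finite A" and nonempty: "A \<noteq> {}"
begin

lemma complex_bsd: "is_complex (bsd k A)" and finite_bsd_A: "finite (bsd k A)"
  by (simp_all add: is_complex is_complex_bsd finite finite_bsd)

lemma bsd_eq_iff: "bsd k A = bsd l A \<longleftrightarrow> k = l"
  using bsd_inj[OF nonempty is_complex] by blast

text \<open>Continuity of the inverse follows from compactness. The condition concerns subcomplexes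
  of \<open>A\<close> only, not all subcomplexes of its subdivisions: the weighted subdivision maps
  and their inverses satisfy it, and it is closed under composition.\<close>

definition homeo :: "nat \<Rightarrow> nat \<Rightarrow> (('a vert \<Rightarrow> real) \<Rightarrow> 'a vert \<Rightarrow> real) \<Rightarrow> bool" where
  "homeo k l H \<longleftrightarrow> continuous_on (points (bsd k A)) H \<and>
     (\<forall>B. is_complex B \<and> B \<subseteq> A \<longrightarrow> bij_betw H (points (bsd k B)) (points (bsd l B)))"

lemma homeo_bij: "homeo k l H \<Longrightarrow> bij_betw H (points (bsd k A)) (points (bsd l A))"
  by (simp add: homeo_def is_complex)

lemma homeo_in: "homeo k l H \<Longrightarrow> p \<in> points (bsd k A) \<Longrightarrow> H p \<in> points (bsd l A)"
  using homeo_bij bij_betwE by blast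

lemma homeo_comp:
  assumes "homeo k l H" "homeo j k G"
  shows "homeo j l (H \<circ> G)"
proof -
  have "G ` points (bsd j A) = points (bsd k A)"
    using homeo_bij[OF assms(2)] by (simp add: bij_betw_def)
  then show ?thesis
    using assms unfolding homeo_def
    by (intro conjI allI impI continuous_on_compose) (auto intro: bij_betw_trans)
qed

lemma homeo_id: "homeo k k (\<lambda>p. p)"
  unfolding homeo_def using bij_betw_id by (auto simp: id_def)

text \<open>A continuous bijection from a compact space to a Hausdorff space is a homeomorphism; the
  inverse respects each \<open>B\<close> because \<open>H\<close> maps the points of
  \<open>B\<close> onto those of \<open>B\<close>.\<close>

lemma homeo_inv:
  assumes "homeo k l H"
  obtains G where "homeo l k G" "\<And>p. p \<in> points (bsd k A) \<Longrightarrow> G (H p) = p"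
proof -
  let ?K = "points (bsd k A)" and ?L = "points (bsd l A)"
  have bij: "bij_betw H ?K ?L" using assms by (rule homeo_bij)
  have "homeomorphic_map (top_of_set ?K) (top_of_set ?L) H"
  proof (rule continuous_imp_homeomorphic_map)
    show "continuous_map (top_of_set ?K) (top_of_set ?L) H"
      using assms bij by (auto simp: homeo_def bij_betw_def)
    show "compact_space (top_of_set ?K)"
      using compact_points[OF finite_bsd_A] by (simp add: compact_space_subtopology)
    show "Hausdorff_space (top_of_set ?L)"
      by (simp add: Hausdorff_space_euclidean_fun Hausdorff_space_subtopology)
  qed (use bij in \<open>auto simp: bij_betw_def\<close>)
  then obtain G where G: "homeomorphic_maps (top_of_set ?K) (top_of_set ?L) H G"
    using homeomorphic_map_maps by blast
  then have inv: "\<And>p. p \<in> ?K \<Longrightarrow> G (H p) = p"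
    by (simp add: homeomorphic_maps_def)
  have "bij_betw G (points (bsd l B)) (points (bsd k B))" if "is_complex B" "B \<subseteq> A" for B
  proof (rule bij_betw_byWitness[where f' = H])
    have B: "bij_betw H (points (bsd k B)) (points (bsd l B))"
      using assms that by (simp add: homeo_def)
    have sub: "points (bsd k B) \<subseteq> ?K" using that by (simp add: points_mono bsd_mono)
    have GB: "H (G q) = q \<and> G q \<in> points (bsd k B)" if q: "q \<in> points (bsd l B)" for q
    proof -
      obtain p where "p \<in> points (bsd k B)" "q = H p"
        using B q by (auto simp: bij_betw_def)
      then show ?thesis using inv[of p] sub by auto
    qed
    then show "\<forall>q\<in>points (bsd l B). H (G q) = q" by blast
    show "\<forall>p\<in>points (bsd k B). G (H p) = p" using inv sub by blast
    show "G ` points (bsd l B) \<subseteq> points (bsd k B)"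
      using GB by blast
    show "H ` points (bsd k B) \<subseteq> points (bsd l B)"
      using B by (auto simp: bij_betw_def)
  qed
  moreover have "continuous_on ?L G"
    using G by (simp add: homeomorphic_maps_def continuous_map_in_subtopology)
  ultimately have "homeo l k G" by (simp add: homeo_def)
  then show ?thesis using that inv by blast
qed

lemma homeo_uniform:
  assumes "homeo k l H" "\<epsilon> > 0"
  obtains \<delta> where "\<delta> > 0" "\<And>p q v. p \<in> points (bsd k A) \<Longrightarrow> q \<in> points (bsd k A) \<Longrightarrow>
    (\<And>v. \<bar>p v - q v\<bar> < \<delta>) \<Longrightarrow> \<bar>H p v - H q v\<bar> < \<epsilon>"
proof -
  have "\<exists>\<delta>>0. \<forall>p\<in>points (bsd k A). \<forall>q\<in>points (bsd k A). (\<forall>v. \<bar>p v - q v\<bar> < \<delta>) \<longrightarrow>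
      (\<forall>w. \<bar>H p w - H q w\<bar> < \<epsilon>)"
    using assms homeo_in[OF assms(1)]
    by (intro points_uniformly_continuous[OF finite_bsd_A finite_bsd_A]) (auto simp: homeo_def)
  then show ?thesis using that by blast
qed

lemma homeo_wsub: "weights (bsd k A) w \<Longrightarrow> homeo (Suc k) k (wsub (bsd k A) w)"
  unfolding homeo_def bsd_Suc
  by (intro conjI continuous_on_wsub allI impI bij_betw_wsub complex_bsd finite_bsd_A)
     (auto simp: is_complex_bsd bsd_mono)

abbreviation std :: "nat \<Rightarrow> ('a vert \<Rightarrow> real) \<Rightarrow> 'a vert \<Rightarrow> real" where
  "std k \<equiv> wsub (bsd k A) bary"

lemma homeo_std: "homeo (Suc k) k (std k)"
  by (intro homeo_wsub weights_bary complex_bsd)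

definition near_homeo :: "nat \<Rightarrow> nat \<Rightarrow> 'a vert smap \<Rightarrow> bool" where
  "near_homeo k l f \<longleftrightarrow> src f = bsd k A \<and> tgt f = bsd l A \<and>
     (\<forall>\<epsilon>>0. \<exists>H. homeo k l H \<and> (\<forall>p\<in>points (bsd k A). \<forall>v. \<bar>push f p v - H p v\<bar> < \<epsilon>))"

lemma near_homeo_selection:
  assumes "elementary_selection (bsd k A) s"
  shows "near_homeo (Suc k) k s"
  unfolding near_homeo_def
proof (intro conjI allI impI)
  let ?C = "bsd k A"
  show "src s = bsd (Suc k) A" "tgt s = ?C"
    using assms by (simp_all add: elementary_selection_def bsd_Suc)
  fix \<epsilon> :: real assume "\<epsilon> > 0"
  \<comment> \<open>Mixing in the barycentre with factor \<open>t > 0\<close> makes all weights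
    positive, \<open>t < 1\<close> keeps the selected part nonnegative, and no coordinate moves by
    more than \<open>t < \<epsilon>\<close>.\<close>
  define t where "t = min (1/2) (\<epsilon> / 2)"
  have t: "0 < t" "t < 1" "t < \<epsilon>" using \<open>\<epsilon> > 0\<close> by (auto simp: t_def)
  let ?i = "\<lambda>\<sigma> v. if fn s (Face \<sigma>) = v then 1 else (0::real)"
  define w where "w = (\<lambda>\<sigma> v. (1 - t) * ?i \<sigma> v + t * bary \<sigma> v)"
  have sel: "fn s (Face \<sigma>) |\<in>| \<sigma>" if "\<sigma> \<in> ?C" for \<sigma>
    using assms that by (simp add: elementary_selection_def)
  note wb = weights_bary[OF complex_bsd, of k, unfolded weights_def, rule_format]
  have "weights ?C w"
    unfolding weights_def
  proof (intro ballI conjI allI impI)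
    fix \<sigma> v assume \<sigma>: "\<sigma> \<in> ?C"
    show "v |\<in>| \<sigma> \<Longrightarrow> 0 < w \<sigma> v"
      using wb[OF \<sigma>] t by (auto simp: w_def intro!: add_nonneg_pos)
    show "v |\<notin>| \<sigma> \<Longrightarrow> w \<sigma> v = 0"
      using wb[OF \<sigma>] sel[OF \<sigma>] by (auto simp: w_def)
    have "sum (w \<sigma>) (fset \<sigma>) = (1 - t) * sum (?i \<sigma>) (fset \<sigma>) + t * sum (bary \<sigma>) (fset \<sigma>)"
      unfolding w_def sum.distrib sum_distrib_left ..
    also have "sum (?i \<sigma>) (fset \<sigma>) = 1" using sel[OF \<sigma>] by (simp add: sum.delta')
    also have "sum (bary \<sigma>) (fset \<sigma>) = 1" using wb[OF \<sigma>] by blast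
    also have "(1 - t) * 1 + t * 1 = 1" by simp
    finally show "sum (w \<sigma>) (fset \<sigma>) = 1" .
  qed
  then have "homeo (Suc k) k (wsub ?C w)" by (rule homeo_wsub)
  moreover have "\<bar>push s p v - wsub ?C w p v\<bar> < \<epsilon>" if p: "p \<in> points (bsd (Suc k) A)" for p v
  proof -
    have psd: "p \<in> points (sd ?C)" using p by (simp add: bsd_Suc)
    have "push s p v = (\<Sum>\<sigma>\<in>?C. ?i \<sigma> v * p (Face \<sigma>))"
      using assms by (auto simp: push_def elementary_selection_def verts_sd sum.reindex inj_on_def
          intro!: sum.cong)
    then have "push s p v - wsub ?C w p v = (\<Sum>\<sigma>\<in>?C. (?i \<sigma> v - w \<sigma> v) * p (Face \<sigma>))"
      by (simp add: wsub_def sum_subtractf left_diff_distrib)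
    also have "\<dots> = (\<Sum>\<sigma>\<in>?C. t * ((?i \<sigma> v - bary \<sigma> v) * p (Face \<sigma>)))"
      by (intro sum.cong) (auto simp: w_def algebra_simps)
    finally have "\<bar>push s p v - wsub ?C w p v\<bar> \<le> (\<Sum>\<sigma>\<in>?C. \<bar>t * ((?i \<sigma> v - bary \<sigma> v) * p (Face \<sigma>))\<bar>)"
      by (simp add: sum_abs)
    also have "\<dots> \<le> (\<Sum>\<sigma>\<in>?C. t * p (Face \<sigma>))"
    proof (rule sum_mono)
      fix \<sigma> 
      have "\<bar>?i \<sigma> v - bary \<sigma> v\<bar> \<le> 1" using bary_bounds[of \<sigma> v] by auto
      then have "\<bar>?i \<sigma> v - bary \<sigma> v\<bar> * p (Face \<sigma>) \<le> 1 * p (Face \<sigma>)"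
        by (rule mult_right_mono) (rule points_nonneg[OF p])
      then show "\<bar>t * ((?i \<sigma> v - bary \<sigma> v) * p (Face \<sigma>))\<bar> \<le> t * p (Face \<sigma>)"
        using t points_nonneg[OF p, of "Face \<sigma>"] by (simp add: abs_mult)
    qed
    also have "\<dots> = t"
      using points_sd_sum[OF finite_bsd_A subset_refl psd] by (simp flip: sum_distrib_left)
    finally show ?thesis using t by simp
  qed
  ultimately show "\<exists>H. homeo (Suc k) k H \<and>
      (\<forall>p\<in>points (bsd (Suc k) A). \<forall>v. \<bar>push s p v - H p v\<bar> < \<epsilon>)" by blast
qed

lemma near_homeo_id: "near_homeo k k (id_smap (bsd k A))"
  unfolding near_homeo_def
proof (intro conjI allI impI)
  fix \<epsilon> :: real assume "\<epsilon> > 0"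
  have "push (id_smap (bsd k A)) p v = p v" if p: "p \<in> points (bsd k A)" for p v
  proof -
    have "push (id_smap (bsd k A)) p v = (\<Sum>u\<in>verts (bsd k A). if u = v then p u else 0)"
      by (auto simp: push_def id_smap_def intro!: sum.cong)
    also have "\<dots> = p v"
      using points_off_verts[OF p] by (simp add: finite_verts finite_bsd_A)
    finally show ?thesis .
  qed
  then show "\<exists>H. homeo k k H \<and> (\<forall>p\<in>points (bsd k A). \<forall>v. \<bar>push (id_smap (bsd k A)) p v - H p v\<bar> < \<epsilon>)"
    using homeo_id \<open>\<epsilon> > 0\<close> by (intro exI[of _ "\<lambda>p. p"]) auto
qed (simp_all add: id_smap_def)

text \<open>\<open>H\<close> approximates \<open>f\<close> within \<epsilon>/2. The tolerance
  \<delta> for \<open>g\<close> comes from the uniform continuity of \<open>push f\<close>, so that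
  \<open>push f\<close> of the error in \<open>g\<close> costs the other \<epsilon>/2.\<close>

lemma near_homeo_comp:
  assumes "near_homeo k l f" "near_homeo j k g" "simplicial f" "simplicial g"
  shows "near_homeo j l (comp_smap f g)"
  unfolding near_homeo_def
proof (intro conjI allI impI)
  show "src (comp_smap f g) = bsd j A" "tgt (comp_smap f g) = bsd l A"
    using assms by (simp_all add: comp_smap_def near_homeo_def)
  have lev: "src f = bsd k A" "tgt f = bsd l A" "src g = bsd j A" "tgt g = bsd k A"
    using assms by (simp_all add: near_homeo_def)
  fix \<epsilon> :: real assume "\<epsilon> > 0"
  then obtain H where H: "homeo k l H" "\<And>p v. p \<in> points (bsd k A) \<Longrightarrow> \<bar>push f p v - H p v\<bar> < \<epsilon> / 2"
    using assms(1) unfolding near_homeo_def by (meson half_gt_zero)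
  have "push f p \<in> points (bsd l A)" if "p \<in> points (bsd k A)" for p
    using push_in_points[OF assms(3), of p] that lev finite_bsd_A by simp
  then have im: "push f ` points (bsd k A) \<subseteq> points (bsd l A)" by blast
  have "\<epsilon> / 2 > 0" using \<open>\<epsilon> > 0\<close> by simp
  then obtain \<delta> where \<delta>: "\<delta> > 0" "\<forall>p\<in>points (bsd k A). \<forall>q\<in>points (bsd k A).
      (\<forall>v. \<bar>p v - q v\<bar> < \<delta>) \<longrightarrow> (\<forall>w. \<bar>push f p w - push f q w\<bar> < \<epsilon> / 2)"
    using points_uniformly_continuous[OF finite_bsd_A finite_bsd_A continuous_on_push im] by metis
  obtain G where G: "homeo j k G" "\<And>p v. p \<in> points (bsd j A) \<Longrightarrow> \<bar>push g p v - G p v\<bar> < \<delta>"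
    using assms(2) \<delta>(1) unfolding near_homeo_def by meson
  have "\<bar>push (comp_smap f g) p v - (H \<circ> G) p v\<bar> < \<epsilon>" if p: "p \<in> points (bsd j A)" for p v
  proof -
    have gp: "push g p \<in> points (bsd k A)"
      using push_in_points[OF assms(4), of p] p lev finite_bsd_A by simp
    have "push (comp_smap f g) p = push f (push g p)"
      using assms lev finite_bsd_A by (intro push_comp) auto
    moreover have "\<bar>push f (push g p) v - push f (G p) v\<bar> < \<epsilon> / 2"
      using \<delta>(2) gp homeo_in[OF G(1) p] G(2)[OF p] by blast
    moreover have "\<bar>push f (G p) v - H (G p) v\<bar> < \<epsilon> / 2"
      using H(2) homeo_in[OF G(1) p] by blast
    ultimately show ?thesis
      using abs_triangle_ineq[of "push f (push g p) v - push f (G p) v" "push f (G p) v - H (G p) v"]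
      by simp
  qed
  then show "\<exists>H. homeo j l H \<and> (\<forall>p\<in>points (bsd j A). \<forall>v. \<bar>push (comp_smap f g) p v - H p v\<bar> < \<epsilon>)"
    using homeo_comp[OF H(1) G(1)] by blast
qed

text \<open>By \<open>push_wsub_fibre_weights\<close> the realization of \<beta>f is
  \<open>push f\<close> preceded by the fibre-weighted subdivision \<open>?W\<close> and followed by
  the inverse \<open>G\<close> of \<open>std l\<close>. Replace \<open>push f\<close> by a
  homeomorphism that is close in terms of the modulus of continuity of \<open>G\<close>.\<close>

lemma near_homeo_sd:
  assumes "near_homeo k l f" "simplicial f" "simplicial (sd_smap f)"
  shows "near_homeo (Suc k) (Suc l) (sd_smap f)"
  unfolding near_homeo_def
proof (intro conjI allI impI)
  have lev: "src f = bsd k A" "tgt f = bsd l A" using assms by (simp_all add: near_homeo_def)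
  then show lev': "src (sd_smap f) = bsd (Suc k) A" "tgt (sd_smap f) = bsd (Suc l) A"
    by (simp_all add: sd_smap_def bsd_Suc)
  fix \<epsilon> :: real assume "\<epsilon> > 0"
  obtain G where G: "homeo l (Suc l) G" "\<And>p. p \<in> points (bsd (Suc l) A) \<Longrightarrow> G (std l p) = p"
    using homeo_inv[OF homeo_std] by blast
  obtain \<delta> where \<delta>: "\<delta> > 0" "\<And>p q v. p \<in> points (bsd l A) \<Longrightarrow> q \<in> points (bsd l A) \<Longrightarrow>
    (\<And>v. \<bar>p v - q v\<bar> < \<delta>) \<Longrightarrow> \<bar>G p v - G q v\<bar> < \<epsilon>"
    using homeo_uniform[OF G(1) \<open>\<epsilon> > 0\<close>] by blast
  obtain H where H: "homeo k l H" "\<And>p v. p \<in> points (bsd k A) \<Longrightarrow> \<bar>push f p v - H p v\<bar> < \<delta>"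
    using assms(1) \<delta>(1) unfolding near_homeo_def by meson
  let ?W = "wsub (bsd k A) (fibre_weights (fn f))"
  have W: "homeo (Suc k) k ?W" by (intro homeo_wsub weights_fibre_weights complex_bsd)
  have "\<bar>push (sd_smap f) p v - (G \<circ> (H \<circ> ?W)) p v\<bar> < \<epsilon>" if p: "p \<in> points (bsd (Suc k) A)" for p v
  proof -
    have "push (sd_smap f) p \<in> points (bsd (Suc l) A)"
      using push_in_points[OF assms(3), of p] p lev' finite_bsd_A by simp
    then have "push (sd_smap f) p = G (std l (push (sd_smap f) p))"
      using G(2) by simp
    also have "std l (push (sd_smap f) p) = push f (?W p)"
      using push_wsub_fibre_weights[OF _ _ assms(2)] lev finite_bsd_A by simp
    finally have "push (sd_smap f) p = G (push f (?W p))" .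
    moreover have Wp: "?W p \<in> points (bsd k A)" using homeo_in[OF W p] .
    then have "push f (?W p) \<in> points (bsd l A)"
      using push_in_points[OF assms(2)] lev finite_bsd_A by simp
    then have "\<bar>G (push f (?W p)) v - G (H (?W p)) v\<bar> < \<epsilon>"
      using \<delta>(2) H(2)[OF Wp] homeo_in[OF H(1) Wp] by blast
    ultimately show ?thesis by simp
  qed
  then show "\<exists>H. homeo (Suc k) (Suc l) H \<and>
      (\<forall>p\<in>points (bsd (Suc k) A). \<forall>v. \<bar>push (sd_smap f) p v - H p v\<bar> < \<epsilon>)"
    using homeo_comp[OF G(1) homeo_comp[OF H(1) W]] by blast
qed

lemma selection_maps_near_homeo:
  assumes "f \<in> selection_maps A"
  shows "\<exists>k l. near_homeo k l f"
  using assms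
proof induction
  case (selection k s)
  then show ?case using near_homeo_selection by blast
next
  case ident
  show ?case using near_homeo_id by blast
next
  case (comp f g)
  then obtain k l k' l' where *: "near_homeo k l f" "near_homeo k' l' g" by blast
  then have "k = l'" using comp.hyps by (simp add: near_homeo_def bsd_eq_iff)
  then show ?case
    using * near_homeo_comp comp.hyps simplicial_selection_maps[OF is_complex] by blast
next
  case (subdiv f)
  then show ?case
    using near_homeo_sd simplicial_selection_maps[OF is_complex] selection_maps.subdiv by blast
qed

text \<open>At the vertex point of \<open>v\<close> the realization of \<open>f\<close> has
  coordinate at least 1 at \<open>fn f v\<close>. A homeomorphism within distance less than 1 is
  still positive there, and it maps the points of \<open>B\<close> to points of \<open>B\<close>. So
  selection maps restrict to subcomplexes.\<close>

lemma near_homeo_vert: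
  assumes "near_homeo k l f" "is_complex B" "B \<subseteq> A" "v \<in> verts (bsd k B)"
  shows "fn f v \<in> verts (bsd l B)"
proof -
  have lev: "src f = bsd k A" using assms by (simp add: near_homeo_def)
  obtain H where H: "homeo k l H" "\<And>p v. p \<in> points (bsd k A) \<Longrightarrow> \<bar>push f p v - H p v\<bar> < 1"
    using assms(1) unfolding near_homeo_def by (meson zero_less_one)
  have vB: "vpoint v \<in> points (bsd k B)"
    using assms(2,4) by (simp add: vpoint_in_points is_complex_bsd)
  then have vA: "vpoint v \<in> points (bsd k A)"
    using points_mono[OF bsd_mono[OF assms(3)]] by blast
  have "H (vpoint v) \<in> points (bsd l B)"
    using H(1) assms(2,3) vB bij_betw_apply unfolding homeo_def by metis
  moreover have "vpoint v v \<le> push f (vpoint v) (fn f v)"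
    using push_ge[of f "vpoint v" v] lev vA finite_bsd_A by simp
  then have "0 < H (vpoint v) (fn f v)"
    using H(2)[OF vA, of "fn f v"] by (simp add: vpoint_def)
  ultimately show ?thesis by (rule pos_imp_vert)
qed

end

section \<open>Star approximation and mesh\<close>

text \<open>\<open>points {\<kappa>}\<close> serves as the closed face spanned by \<kappa>. The
  singleton need not be a complex; \<open>points\<close> only asks for a supporting face.\<close>

lemma points_simplexD: "p \<in> points {\<kappa>} \<Longrightarrow> v |\<notin>| \<kappa> \<Longrightarrow> p v = 0"
  by (auto simp: points_def)

lemma points_simplex_sum: "p \<in> points {\<kappa>} \<Longrightarrow> sum p (fset \<kappa>) = 1"
  by (auto simp: points_def)

lemma points_simplexI: "\<kappa> \<in> C \<Longrightarrow> p \<in> points {\<kappa>} \<Longrightarrow> p \<in> points C"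
  by (auto simp: points_def)

lemma vpoint_in_simplex: "v |\<in>| \<kappa> \<Longrightarrow> vpoint v \<in> points {\<kappa>}"
  by (auto simp: points_def vpoint_def)

lemma points_carrier_simplex:
  assumes "is_complex C" "p \<in> points C"
  obtains \<kappa> where "\<kappa> \<in> C" "p \<in> points {\<kappa>}" "\<And>v. v |\<in>| \<kappa> \<longleftrightarrow> 0 < p v"
proof -
  obtain \<kappa> where \<kappa>: "\<kappa> \<in> C" "\<And>v. v |\<in>| \<kappa> \<longleftrightarrow> 0 < p v" "sum p (fset \<kappa>) = 1"
    using points_carrier[OF assms] by blast
  have nonneg: "0 \<le> p v" for v using assms(2) by (rule points_nonneg)
  have "p v = 0" if "v |\<notin>| \<kappa>" for v
    using \<kappa>(2)[of v] nonneg[of v] that by simp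
  then have "p \<in> points {\<kappa>}" using \<kappa>(3) nonneg by (simp add: points_def)
  then show ?thesis using that[OF \<kappa>(1)] \<kappa>(2) by blast
qed

text \<open>A strong form of simplicial approximation: \<open>H\<close> sends the closed star of \<open>u\<close> into the open
  star of \<open>\<phi> u\<close>.\<close>

definition star_approx ::
    "'v scomplex \<Rightarrow> ('v \<Rightarrow> 'w) \<Rightarrow> (('v \<Rightarrow> real) \<Rightarrow> 'w \<Rightarrow> real) \<Rightarrow> bool" where
  "star_approx K \<phi> H \<longleftrightarrow> (\<forall>\<kappa>\<in>K. \<forall>u. u |\<in>| \<kappa> \<longrightarrow> (\<forall>p\<in>points {\<kappa>}. 0 < H p (\<phi> u)))"

lemma star_approxD: "star_approx K \<phi> H \<Longrightarrow> \<kappa> \<in> K \<Longrightarrow> u |\<in>| \<kappa> \<Longrightarrow> p \<in> points {\<kappa>} \<Longrightarrow> 0 < H p (\<phi> u)"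
  by (simp add: star_approx_def)

text \<open>The carrier of \<open>G p\<close> contains \<open>\<psi> u\<close>, so
  \<open>G p\<close> lies in the closed star of \<open>\<psi> u\<close>, where the hypothesis on
  \<open>H\<close> applies.\<close>

lemma star_approx_comp:
  assumes "star_approx L \<phi> H" "star_approx K \<psi> G" "is_complex L" "G ` points K \<subseteq> points L"
  shows "star_approx K (\<lambda>u. \<phi> (\<psi> u)) (H \<circ> G)"
  unfolding star_approx_def
proof (intro ballI allI impI)
  fix \<kappa> u p assume *: "\<kappa> \<in> K" "u |\<in>| \<kappa>" "p \<in> points {\<kappa>}"
  then have "G p \<in> points L" using assms(4) points_simplexI by blast
  then obtain \<tau> where \<tau>: "\<tau> \<in> L" "G p \<in> points {\<tau>}" "\<And>v. v |\<in>| \<tau> \<longleftrightarrow> 0 < G p v"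
    using points_carrier_simplex[OF assms(3)] by blast
  have "\<psi> u |\<in>| \<tau>" using \<tau>(3) star_approxD[OF assms(2) *] by blast
  then show "0 < (H \<circ> G) p (\<phi> (\<psi> u))"
    using star_approxD[OF assms(1) \<tau>(1) _ \<tau>(2)] by simp
qed

lemma star_approx_cong:
  assumes "\<And>u. u \<in> verts K \<Longrightarrow> \<phi> u = \<psi> u"
  shows "star_approx K \<phi> H \<longleftrightarrow> star_approx K \<psi> H"
proof -
  have "\<phi> u = \<psi> u" if "\<kappa> \<in> K" "u |\<in>| \<kappa>" for u \<kappa>
    using assms face_subset_verts[OF that(1)] that(2) by blast
  then show ?thesis unfolding star_approx_def by simp
qed

definition mesh_less :: "'v scomplex \<Rightarrow> (('v \<Rightarrow> real) \<Rightarrow> 'w \<Rightarrow> real) \<Rightarrow> real \<Rightarrow> bool" where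
  "mesh_less K \<Phi> \<epsilon> \<longleftrightarrow>
     (\<forall>\<kappa>\<in>K. \<forall>p\<in>points {\<kappa>}. \<forall>q\<in>points {\<kappa>}. \<forall>v. \<bar>\<Phi> p v - \<Phi> q v\<bar> < \<epsilon>)"

subsection \<open>Oscillation of affine functions on faces\<close>

text \<open>The coefficients \<open>a\<close> are the vertex values of a function that is affine on
  faces. Composition with the standard subdivision maps preserves this form, so the mesh estimate
  reduces to differences of vertex values.\<close>

definition face_osc :: "'v scomplex \<Rightarrow> real \<Rightarrow> (('v \<Rightarrow> real) \<Rightarrow> real) \<Rightarrow> bool" where
  "face_osc C D F \<longleftrightarrow> (\<exists>a. (\<forall>p\<in>points C. F p = (\<Sum>v\<in>verts C. a v * p v)) \<and>
     (\<forall>\<sigma>\<in>C. \<forall>u v. u |\<in>| \<sigma> \<longrightarrow> v |\<in>| \<sigma> \<longrightarrow> \<bar>a u - a v\<bar> \<le> D))"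

text \<open>The values on \<kappa> are convex combinations of vertex values that differ pairwise by
  at most \<open>D\<close>.\<close>

lemma face_osc_bound:
  assumes "finite C" "face_osc C D F" "\<kappa> \<in> C" "p \<in> points {\<kappa>}" "q \<in> points {\<kappa>}"
  shows "\<bar>F p - F q\<bar> \<le> D"
proof -
  obtain a where "\<forall>p\<in>points C. F p = (\<Sum>v\<in>verts C. a v * p v)"
      "\<forall>\<sigma>\<in>C. \<forall>u v. u |\<in>| \<sigma> \<longrightarrow> v |\<in>| \<sigma> \<longrightarrow> \<bar>a u - a v\<bar> \<le> D"
    using assms(2) unfolding face_osc_def by (elim exE conjE)
  then have a: "\<And>p. p \<in> points C \<Longrightarrow> F p = (\<Sum>v\<in>verts C. a v * p v)"
      "\<And>u v. u |\<in>| \<kappa> \<Longrightarrow> v |\<in>| \<kappa> \<Longrightarrow> \<bar>a u - a v\<bar> \<le> D"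
    using assms(3) by simp_all
  have F: "F p = (\<Sum>v\<in>fset \<kappa>. a v * p v)" if p: "p \<in> points {\<kappa>}" for p
  proof -
    have "F p = (\<Sum>v\<in>verts C. a v * p v)" using a(1) points_simplexI[OF assms(3) p] .
    also have "\<dots> = (\<Sum>v\<in>fset \<kappa>. a v * p v)"
      using face_subset_verts[OF assms(3)] finite_verts[OF assms(1)] points_simplexD[OF p]
      by (intro sum.mono_neutral_right) auto
    finally show ?thesis .
  qed
  have le: "F p \<le> F q + D" if p: "p \<in> points {\<kappa>}" and q: "q \<in> points {\<kappa>}" for p q
  proof -
    have "F p \<le> a w + D" if w: "w |\<in>| \<kappa>" for w
    proof -
      have "F p \<le> (\<Sum>v\<in>fset \<kappa>. (a w + D) * p v)"
        unfolding F[OF p]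
      proof (rule sum_mono)
        fix v assume "v |\<in>| \<kappa>"
        then have "a v \<le> a w + D" using a(2)[OF _ w, of v] by linarith
        then show "a v * p v \<le> (a w + D) * p v"
          using points_nonneg[OF p] by (rule mult_right_mono)
      qed
      also have "\<dots> = a w + D" using points_simplex_sum[OF p] by (simp flip: sum_distrib_left)
      finally show ?thesis .
    qed
    then have "(\<Sum>v\<in>fset \<kappa>. (F p - D) * q v) \<le> F q"
      unfolding F[OF q] using points_nonneg[OF q]
      by (intro sum_mono mult_right_mono) (auto simp: algebra_simps)
    moreover have "(\<Sum>v\<in>fset \<kappa>. (F p - D) * q v) = F p - D"
      using points_simplex_sum[OF q] by (simp flip: sum_distrib_left)
    ultimately show ?thesis by simp
  qed
  show ?thesis using le[OF assms(4,5)] le[OF assms(5,4)] by linarith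
qed

lemma face_osc_coordinate:
  assumes "finite C"
  shows "face_osc C 1 (\<lambda>p. p w)"
proof -
  have "p w = (\<Sum>v\<in>verts C. (if v = w then 1 else 0) * p v)" if p: "p \<in> points C" for p
  proof -
    have "(\<Sum>v\<in>verts C. (if v = w then 1 else 0) * p v) = (\<Sum>v\<in>verts C. if v = w then p v else 0)"
      by (intro sum.cong) auto
    also have "\<dots> = p w"
      using points_off_verts[OF p, of w] finite_verts[OF assms] by simp
    finally show ?thesis by simp
  qed
  then show ?thesis unfolding face_osc_def by (intro exI[of _ "\<lambda>v. if v = w then 1 else 0"]) auto
qed

text \<open>Of the \<open>n\<close> equally weighted differences from \<open>a v\<close>, the one at
  \<open>v\<close> itself vanishes, which leaves the fraction (n - 1)/n.\<close>

lemma mean_deviation: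
  fixes a :: "'v \<Rightarrow> real"
  assumes v: "v |\<in>| \<tau>" and osc: "\<And>w. w |\<in>| \<tau> \<Longrightarrow> \<bar>a v - a w\<bar> \<le> D"
  shows "\<bar>a v - (\<Sum>w\<in>fset \<tau>. bary \<tau> w * a w)\<bar> \<le> (1 - 1 / real (fcard \<tau>)) * D"
proof -
  define n where "n = real (fcard \<tau>)"
  have n: "n > 0" unfolding n_def using v fcard_pos[of \<tau>] by auto
  have card: "real (card (fset \<tau> - {v})) = n - 1"
    using v n by (simp add: n_def fcard.rep_eq of_nat_diff)
  have "a v = (\<Sum>w\<in>fset \<tau>. 1 / n * a v)"
    using n by (auto simp: n_def fcard.rep_eq)
  moreover have "(\<Sum>w\<in>fset \<tau>. bary \<tau> w * a w) = (\<Sum>w\<in>fset \<tau>. 1 / n * a w)"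
    by (intro sum.cong) (auto simp: bary_def n_def)
  ultimately have "a v - (\<Sum>w\<in>fset \<tau>. bary \<tau> w * a w) = (\<Sum>w\<in>fset \<tau>. 1 / n * (a v - a w))"
    by (simp only: right_diff_distrib sum_subtractf)
  also have "\<dots> = (\<Sum>w\<in>fset \<tau> - {v}. 1 / n * (a v - a w))"
    by (intro sum.mono_neutral_right) auto
  finally have "\<bar>a v - (\<Sum>w\<in>fset \<tau>. bary \<tau> w * a w)\<bar> \<le> (\<Sum>w\<in>fset \<tau> - {v}. \<bar>1 / n * (a v - a w)\<bar>)"
    by (simp only: sum_abs)
  also have "\<dots> \<le> (\<Sum>w\<in>fset \<tau> - {v}. 1 / n * D)"
    using n osc by (intro sum_mono) (auto simp: abs_mult divide_right_mono)
  also have "\<dots> = (n - 1) * (1 / n * D)"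
    using card by simp
  also have "\<dots> = (1 - 1 / n) * D" using n by (simp add: field_simps)
  finally show ?thesis by (simp add: n_def)
qed

text \<open>Average \<open>mean_deviation\<close> over the vertices of \<sigma>, all of which are
  vertices of \<tau>.\<close>

lemma mean_diff:
  fixes a :: "'v \<Rightarrow> real"
  assumes "\<sigma> |\<subseteq>| \<tau>" "\<sigma> \<noteq> {||}" and osc: "\<And>v w. v |\<in>| \<tau> \<Longrightarrow> w |\<in>| \<tau> \<Longrightarrow> \<bar>a v - a w\<bar> \<le> D"
  shows "\<bar>(\<Sum>v\<in>fset \<sigma>. bary \<sigma> v * a v) - (\<Sum>w\<in>fset \<tau>. bary \<tau> w * a w)\<bar> \<le> (1 - 1 / real (fcard \<tau>)) * D"
proof -
  let ?m = "\<Sum>w\<in>fset \<tau>. bary \<tau> w * a w" and ?r = "(1 - 1 / real (fcard \<tau>)) * D"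
  have one: "sum (bary \<sigma>) (fset \<sigma>) = 1"
  proof -
    \<comment> \<open>The full simplex on \<sigma>, introduced only to obtain the normalisation from
      \<open>weights_bary\<close>.\<close>
    have "is_complex {\<rho>. \<rho> \<noteq> {||} \<and> \<rho> |\<subseteq>| \<sigma>}" by (auto simp: is_complex_def)
    then show ?thesis using weights_bary assms(2) unfolding weights_def by blast
  qed
  then have "(\<Sum>v\<in>fset \<sigma>. bary \<sigma> v * a v) - ?m = (\<Sum>v\<in>fset \<sigma>. bary \<sigma> v * (a v - ?m))"
    by (simp add: right_diff_distrib sum_subtractf flip: sum_distrib_right)
  then have "\<bar>(\<Sum>v\<in>fset \<sigma>. bary \<sigma> v * a v) - ?m\<bar> \<le> (\<Sum>v\<in>fset \<sigma>. \<bar>bary \<sigma> v * (a v - ?m)\<bar>)"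
    by (simp only: sum_abs)
  also have "\<dots> \<le> (\<Sum>v\<in>fset \<sigma>. bary \<sigma> v * ?r)"
  proof (rule sum_mono)
    fix v assume "v |\<in>| \<sigma>"
    then have "v |\<in>| \<tau>" using assms(1) by blast
    then have "\<bar>a v - ?m\<bar> \<le> ?r" using osc by (intro mean_deviation)
    then show "\<bar>bary \<sigma> v * (a v - ?m)\<bar> \<le> bary \<sigma> v * ?r"
      using bary_bounds(1)[of \<sigma> v] by (simp add: abs_mult mult_left_mono)
  qed
  also have "\<dots> = ?r" using one by (simp flip: sum_distrib_right)
  finally show ?thesis .
qed

text \<open>The classical shrinking of barycentric subdivision. New vertex values are averages over
  faces, vertices of one new face come from nested faces, and \<open>mean_diff\<close> compares
  these; \<open>N\<close> makes the ratio uniform.\<close>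

lemma face_osc_sd:
  assumes "finite C" "is_complex C" "\<And>\<sigma>. \<sigma> \<in> C \<Longrightarrow> fcard \<sigma> \<le> N" "face_osc C D F"
  shows "face_osc (sd C) ((1 - 1 / real N) * D) (\<lambda>p. F (wsub C bary p))"
proof -
  obtain a where "\<forall>p\<in>points C. F p = (\<Sum>v\<in>verts C. a v * p v)"
      "\<forall>\<sigma>\<in>C. \<forall>u v. u |\<in>| \<sigma> \<longrightarrow> v |\<in>| \<sigma> \<longrightarrow> \<bar>a u - a v\<bar> \<le> D"
    using assms(4) unfolding face_osc_def by (elim exE conjE)
  then have a: "\<And>p. p \<in> points C \<Longrightarrow> F p = (\<Sum>v\<in>verts C. a v * p v)"
      "\<And>\<sigma> u v. \<sigma> \<in> C \<Longrightarrow> u |\<in>| \<sigma> \<Longrightarrow> v |\<in>| \<sigma> \<Longrightarrow> \<bar>a u - a v\<bar> \<le> D"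
    by simp_all
  define b where "b = (\<lambda>u. \<Sum>v\<in>fset (the_face u). bary (the_face u) v * a v)"
  have "F (wsub C bary p) = (\<Sum>u\<in>verts (sd C). b u * p u)" if p: "p \<in> points (sd C)" for p
  proof -
    have "F (wsub C bary p) = (\<Sum>v\<in>verts C. a v * wsub C bary p v)"
      using wsub_in_points[OF assms(1) weights_bary[OF assms(2)] subset_refl p] by (rule a(1))
    also have "\<dots> = (\<Sum>v\<in>verts C. \<Sum>\<sigma>\<in>C. bary \<sigma> v * a v * p (Face \<sigma>))"
      unfolding wsub_def by (simp add: sum_distrib_left mult_ac)
    also have "\<dots> = (\<Sum>\<sigma>\<in>C. (\<Sum>v\<in>verts C. bary \<sigma> v * a v) * p (Face \<sigma>))"
      by (subst sum.swap) (simp add: sum_distrib_right)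
    also have "\<dots> = (\<Sum>\<sigma>\<in>C. b (Face \<sigma>) * p (Face \<sigma>))"
    proof (intro sum.cong refl arg_cong2[where f = "(*)"])
      fix \<sigma> assume "\<sigma> \<in> C"
      then show "(\<Sum>v\<in>verts C. bary \<sigma> v * a v) = b (Face \<sigma>)"
        unfolding b_def vert.sel using face_subset_verts finite_verts[OF assms(1)]
        by (intro sum.mono_neutral_right) (auto simp: bary_def)
    qed
    also have "\<dots> = (\<Sum>u\<in>verts (sd C). b u * p u)"
      by (simp add: verts_sd sum.reindex inj_on_def)
    finally show ?thesis .
  qed
  moreover have "\<bar>b u - b u'\<bar> \<le> (1 - 1 / real N) * D" if \<kappa>: "\<kappa> \<in> sd C" "u |\<in>| \<kappa>" "u' |\<in>| \<kappa>" for \<kappa> u u'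
  proof -
    have main: "\<bar>b (Face \<sigma>) - b (Face \<tau>)\<bar> \<le> (1 - 1 / real N) * D"
      if "\<sigma> \<in> C" "\<tau> \<in> C" "\<sigma> |\<subseteq>| \<tau>" for \<sigma> \<tau>
    proof -
      have ne: "\<sigma> \<noteq> {||}" "\<tau> \<noteq> {||}" using that face_nonempty[OF assms(2)] by auto
      then obtain v where "v |\<in>| \<tau>" using ex_fin_conv by metis
      then have "0 \<le> D" using a(2)[OF that(2), of v v] by simp
      have "\<bar>b (Face \<sigma>) - b (Face \<tau>)\<bar> \<le> (1 - 1 / real (fcard \<tau>)) * D"
        unfolding b_def vert.sel using that ne a(2) by (intro mean_diff)
      also have "\<dots> \<le> (1 - 1 / real N) * D"
        using \<open>0 \<le> D\<close> assms(3)[OF that(2)] fcard_pos[OF ne(2)]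
        by (intro mult_right_mono) (auto simp: frac_le)
      finally show ?thesis .
    qed
    obtain S where S: "\<kappa> = Face |`| S" "fset S \<subseteq> C"
        "\<forall>\<sigma>\<in>fset S. \<forall>\<tau>\<in>fset S. \<sigma> |\<subseteq>| \<tau> \<or> \<tau> |\<subseteq>| \<sigma>"
      using \<kappa>(1) unfolding sd_def by blast
    obtain \<sigma> \<tau> where \<sigma>\<tau>: "u = Face \<sigma>" "u' = Face \<tau>" "\<sigma> |\<in>| S" "\<tau> |\<in>| S"
      using \<kappa>(2,3) unfolding S(1) by blast
    then have "\<sigma> \<in> C" "\<tau> \<in> C" using S(2) by auto
    moreover have "\<sigma> |\<subseteq>| \<tau> \<or> \<tau> |\<subseteq>| \<sigma>" using S(3) \<sigma>\<tau>(3,4) by simp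
    ultimately show ?thesis
      unfolding \<sigma>\<tau>(1,2) using main abs_minus_commute by metis
  qed
  ultimately show ?thesis unfolding face_osc_def by blast
qed

text \<open>Members of a chain have distinct cardinalities between 1 and \<open>N\<close>. So
  dimension does not grow and one contraction ratio serves all levels.\<close>

lemma fcard_sd_le:
  assumes "is_complex C" "\<And>\<sigma>. \<sigma> \<in> C \<Longrightarrow> fcard \<sigma> \<le> N" "\<kappa> \<in> sd C"
  shows "fcard \<kappa> \<le> N"
proof -
  obtain S where S: "\<kappa> = Face |`| S" "fset S \<subseteq> C"
    "\<forall>\<sigma>\<in>fset S. \<forall>\<tau>\<in>fset S. \<sigma> |\<subseteq>| \<tau> \<or> \<tau> |\<subseteq>| \<sigma>"
    using assms(3) unfolding sd_def by blast
  have "inj_on fcard (fset S)"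
  proof (rule inj_onI)
    fix \<sigma> \<tau> assume "\<sigma> |\<in>| S" "\<tau> |\<in>| S" "fcard \<sigma> = fcard \<tau>"
    then show "\<sigma> = \<tau>" using S(3) fcard_seteq by (metis order_refl)
  qed
  then have "fcard S = card (fcard ` fset S)" unfolding fcard.rep_eq[of S] by (rule card_image[symmetric])
  also have "\<dots> \<le> card {1..N}"
  proof (rule card_mono)
    show "fcard ` fset S \<subseteq> {1..N}"
      using S(2) assms(2) fcard_pos[OF face_nonempty[OF assms(1)]] by (force simp: Suc_le_eq)
  qed simp
  finally have "fcard S \<le> N" by simp
  then show ?thesis using S(1) by (simp add: fcard.rep_eq card_image inj_on_def)
qed

subsection \<open>Fine star approximations by selections\<close>

definition selection_of :: "'a vert scomplex \<Rightarrow> ('a vert fset \<Rightarrow> 'a vert) \<Rightarrow> 'a vert smap" where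
  "selection_of C c = \<lparr>src = sd C, tgt = C, fn = (\<lambda>v\<in>verts (sd C). c (the_face v))\<rparr>"

lemma elementary_selection_of:
  "(\<And>\<sigma>. \<sigma> \<in> C \<Longrightarrow> c \<sigma> |\<in>| \<sigma>) \<Longrightarrow> elementary_selection C (selection_of C c)"
  by (auto simp: elementary_selection_def selection_of_def verts_sd)

lemma sd_face_least:
  assumes "c \<in> sd C"
  obtains \<mu> where "\<mu> \<in> C" "Face \<mu> |\<in>| c" "\<And>\<tau>. Face \<tau> |\<in>| c \<Longrightarrow> \<mu> |\<subseteq>| \<tau>"
proof -
  obtain S where S: "c = Face |`| S" "S \<noteq> {||}" "fset S \<subseteq> C"
    "\<forall>\<sigma>\<in>fset S. \<forall>\<tau>\<in>fset S. \<sigma> |\<subseteq>| \<tau> \<or> \<tau> |\<subseteq>| \<sigma>"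
    using assms unfolding sd_def by blast
  have "Min (fcard ` fset S) \<in> fcard ` fset S" using S(2) by (intro Min_in) auto
  then obtain \<mu> where \<mu>: "\<mu> |\<in>| S" "fcard \<mu> = Min (fcard ` fset S)" by auto
  have "\<mu> |\<subseteq>| \<tau>" if "\<tau> |\<in>| S" for \<tau>
  proof -
    have "fcard \<mu> \<le> fcard \<tau>" using \<mu>(2) that by simp
    then show ?thesis using S(4) \<mu>(1) that fcard_seteq by blast
  qed
  then show ?thesis using that[of \<mu>] \<mu>(1) S(1,3) by blast
qed

lemma wsub_pos:
  assumes "finite C" "weights C w" "p \<in> points (sd C)" "\<sigma> \<in> C" "0 < p (Face \<sigma>)" "v |\<in>| \<sigma>"
  shows "0 < wsub C w p v"
  unfolding wsub_def
proof (rule sum_pos2[OF assms(1,4)])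
  show "0 < w \<sigma> v * p (Face \<sigma>)" using assms by (simp add: weights_def)
  show "0 \<le> w \<tau> v * p (Face \<tau>)" if "\<tau> \<in> C" for \<tau>
    using weights_nonneg[OF assms(2) that] points_nonneg[OF assms(3)] by simp
qed

lemma comp_smap_simps [simp]:
  "src (comp_smap f g) = src g" "tgt (comp_smap f g) = tgt f"
  "v \<in> verts (src g) \<Longrightarrow> fn (comp_smap f g) v = fn f (fn g v)"
  by (simp_all add: comp_smap_def)

context finite_complex
begin

text \<open>Selecting the least face of a chain of faces and then any vertex of that face picks a vertex
  of the carrier of every point of the closed star.\<close>

lemma double_step:
  "\<exists>e\<in>selection_maps A. src e = bsd (k + 2) A \<and> tgt e = bsd k A \<and>
     star_approx (bsd (k + 2) A) (fn e) (std k \<circ> std (Suc k))"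
proof -
  let ?C = "bsd k A"
  have C: "is_complex ?C" "finite ?C" by (simp_all add: complex_bsd finite_bsd_A)
  define c1 :: "'a vert fset \<Rightarrow> 'a vert" where "c1 = (\<lambda>\<sigma>. SOME v. v |\<in>| \<sigma>)"
  have c1: "c1 \<sigma> |\<in>| \<sigma>" if "\<sigma> \<in> ?C" for \<sigma>
  proof -
    have "\<exists>v. v |\<in>| \<sigma>" using face_nonempty[OF C(1) that] by (simp add: ex_fin_conv)
    then show ?thesis unfolding c1_def by (rule someI_ex)
  qed
  have "\<exists>\<mu>. \<mu> \<in> ?C \<and> Face \<mu> |\<in>| c \<and> (\<forall>\<tau>. Face \<tau> |\<in>| c \<longrightarrow> \<mu> |\<subseteq>| \<tau>)"
    if "c \<in> sd ?C" for c
    by (rule sd_face_least[OF that]) blast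
  then have "\<forall>c\<in>sd ?C. \<exists>\<mu>. \<mu> \<in> ?C \<and> Face \<mu> |\<in>| c \<and> (\<forall>\<tau>. Face \<tau> |\<in>| c \<longrightarrow> \<mu> |\<subseteq>| \<tau>)"
    by (rule ballI)
  from bchoice[OF this] obtain m where "\<forall>c\<in>sd ?C. m c \<in> ?C \<and> Face (m c) |\<in>| c \<and>
      (\<forall>\<tau>. Face \<tau> |\<in>| c \<longrightarrow> m c |\<subseteq>| \<tau>)" by (elim exE)
  then have m: "m c \<in> ?C \<and> Face (m c) |\<in>| c \<and> (\<forall>\<tau>. Face \<tau> |\<in>| c \<longrightarrow> m c |\<subseteq>| \<tau>)"
    if "c \<in> sd ?C" for c
    using that by (rule bspec)
  define s1 where "s1 = selection_of ?C c1"
  define s2 where "s2 = selection_of (sd ?C) (\<lambda>c. Face (m c))"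
  have "elementary_selection ?C s1"
    unfolding s1_def using c1 by (rule elementary_selection_of)
  then have s1: "s1 \<in> selection_maps A" by (rule selection_maps.selection)
  have "elementary_selection (bsd (Suc k) A) s2"
    unfolding s2_def bsd_Suc using m by (intro elementary_selection_of) blast
  then have s2: "s2 \<in> selection_maps A" by (rule selection_maps.selection)
  define e where "e = comp_smap s1 s2"
  have "e \<in> selection_maps A"
    unfolding e_def using s1 s2 by (rule selection_maps.comp) (simp add: s1_def s2_def selection_of_def)
  moreover have "src e = bsd (k + 2) A" "tgt e = ?C"
    by (simp_all add: e_def s1_def s2_def selection_of_def bsd_Suc)
  moreover have "star_approx (bsd (k + 2) A) (fn e) (std k \<circ> std (Suc k))"
    unfolding star_approx_def
  proof (intro ballI allI impI)
    fix \<kappa> u p assume "\<kappa> \<in> bsd (k + 2) A" and u: "u |\<in>| \<kappa>" and p: "p \<in> points {\<kappa>}"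
    then have \<kappa>: "\<kappa> \<in> sd (sd ?C)" by (simp add: bsd_Suc)
    have psd: "p \<in> points (sd (sd ?C))" using \<kappa> p by (rule points_simplexI)
    obtain v where v: "0 < p v" using points_ex_pos[OF p] by blast
    then have "v |\<in>| \<kappa>" using points_simplexD[OF p] by force
    obtain S where S: "\<kappa> = Face |`| S" "fset S \<subseteq> sd ?C"
        "\<forall>\<sigma>\<in>fset S. \<forall>\<tau>\<in>fset S. \<sigma> |\<subseteq>| \<tau> \<or> \<tau> |\<subseteq>| \<sigma>"
      using \<kappa> unfolding sd_def[of "sd ?C"] by blast
    obtain c c' where cS: "u = Face c" "v = Face c'" "c |\<in>| S" "c' |\<in>| S"
      using u \<open>v |\<in>| \<kappa>\<close> unfolding S(1) by blast
    then have c: "u = Face c" "v = Face c'" "c \<in> sd ?C" "c' \<in> sd ?C" "c |\<subseteq>| c' \<or> c' |\<subseteq>| c"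
      using S(2,3) by auto
    \<comment> \<open>Take \<tau> to be \<open>m c\<close> if \<open>c\<close> is contained in
      \<open>c'\<close>, and \<open>m c'\<close> otherwise, where minimality in \<open>c\<close>
      gives the inclusion. As \<open>p\<close> has mass at \<open>Face c'\<close>, its image has
      mass at \<open>Face \<tau>\<close> and then at every vertex of \<tau>, in particular at the
      one selected from \<open>m c\<close>.\<close>
    have "\<exists>\<tau>\<in>?C. Face \<tau> |\<in>| c' \<and> m c |\<subseteq>| \<tau>"
      using c(5)
    proof
      assume "c |\<subseteq>| c'"
      then show ?thesis using m[OF c(3)] by blast
    next
      assume "c' |\<subseteq>| c"
      then have "m c |\<subseteq>| m c'" using m[OF c(3)] m[OF c(4)] by blast
      then show ?thesis using m[OF c(4)] by blast
    qed
    then obtain \<tau> where \<tau>: "\<tau> \<in> ?C" "Face \<tau> |\<in>| c'" "m c |\<subseteq>| \<tau>" by blast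
    have "0 < std (Suc k) p (Face \<tau>)"
      unfolding bsd_Suc
      using wsub_pos[OF finite_sd[OF C(2)] weights_bary[OF is_complex_sd] psd c(4) _ \<tau>(2)] v c(2)
      by simp
    moreover have "std (Suc k) p \<in> points (sd ?C)"
      using homeo_in[OF homeo_std, of p "Suc k"] psd by (simp add: bsd_Suc)
    moreover have "c1 (m c) |\<in>| \<tau>" using c1 m[OF c(3)] \<tau>(3) by blast
    ultimately have "0 < std k (std (Suc k) p) (c1 (m c))"
      using wsub_pos[OF C(2) weights_bary[OF C(1)]] \<tau>(1) by blast
    moreover have "fn e u = c1 (m c)"
    proof -
      have "Face (m c) \<in> verts (sd ?C)" "Face c \<in> verts (sd (sd ?C))"
        using m[OF c(3)] c(3) by (auto simp: verts_sd)
      then show ?thesis by (simp add: e_def s1_def s2_def selection_of_def c(1))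
    qed
    ultimately show "0 < (std k \<circ> std (Suc k)) p (fn e u)" by simp
  qed
  ultimately show ?thesis by blast
qed

definition max_face :: nat where "max_face = card (verts A)"

lemma max_face_pos: "0 < max_face"
proof -
  obtain \<sigma> where "\<sigma> \<in> A" using nonempty by blast
  then have "verts A \<noteq> {}"
    using face_nonempty[OF is_complex \<open>\<sigma> \<in> A\<close>] face_subset_verts by fastforce
  then show ?thesis using finite_verts[OF finite] by (simp add: max_face_def card_gt_0_iff)
qed

lemma fcard_bsd_le: "\<kappa> \<in> bsd k A \<Longrightarrow> fcard \<kappa> \<le> max_face"
proof (induction k arbitrary: \<kappa>)
  case 0
  then obtain \<sigma> where \<sigma>: "\<sigma> \<in> A" "\<kappa> = Atom |`| \<sigma>" by (auto simp: bsd_0)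
  then have "fcard \<kappa> = card (fset \<sigma>)" by (simp add: fcard.rep_eq card_image inj_on_def)
  then show ?case
    using card_mono[OF finite_verts[OF finite] face_subset_verts[OF \<sigma>(1)]] by (simp add: max_face_def)
next
  case (Suc k)
  show ?case
    using Suc.prems unfolding bsd_Suc by (rule fcard_sd_le[OF complex_bsd, rotated]) (rule Suc.IH)
qed

text \<open>Each double step consists of two subdivisions, each contributing a factor
  \<open>r\<close>. The count starts with one double step, since the identity on a complex with an
  edge is not a star approximation of itself.\<close>

lemma fine_selection_aux:
  fixes r :: real
  defines "r \<equiv> 1 - 1 / real max_face"
  shows "\<exists>e\<in>selection_maps A. \<exists>m S. src e = bsd m A \<and> tgt e = bsd k A \<and> homeo m k S \<and>
    star_approx (bsd m A) (fn e) S \<and>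
    (\<forall>D F. face_osc (bsd k A) D F \<longrightarrow> face_osc (bsd m A) (r ^ (2 * Suc j) * D) (\<lambda>p. F (S p)))"
proof (induction j)
  have osc: "face_osc (bsd (m + 2) A) (r ^ 2 * D) (\<lambda>p. F ((std m \<circ> std (Suc m)) p))"
    if "face_osc (bsd m A) D F" for m D F
  proof -
    have osc_sd: "face_osc (bsd (Suc m) A) (r * D) (\<lambda>p. F (std m p))"
      if "face_osc (bsd m A) D F" for m D F
      unfolding r_def bsd_Suc
      by (rule face_osc_sd[OF finite_bsd_A complex_bsd _ that]) (rule fcard_bsd_le)
    have "face_osc (bsd (Suc (Suc m)) A) (r * (r * D)) (\<lambda>p. F (std m (std (Suc m) p)))"
      using osc_sd[OF osc_sd[OF that]] .
    then show ?thesis by (simp add: power2_eq_square mult.assoc)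
  qed
  have hom: "homeo (m + 2) m (std m \<circ> std (Suc m))" for m
    using homeo_comp[OF homeo_std homeo_std] by simp
  {
    case 0
    define T where "T = std k \<circ> std (Suc k)"
    obtain e where "e \<in> selection_maps A" "src e = bsd (k + 2) A" "tgt e = bsd k A"
        "star_approx (bsd (k + 2) A) (fn e) T"
      using double_step unfolding T_def by blast
    moreover have "homeo (k + 2) k T" using hom unfolding T_def .
    moreover have "face_osc (bsd (k + 2) A) (r ^ (2 * Suc 0) * D) (\<lambda>p. F (T p))"
      if "face_osc (bsd k A) D F" for D F
      using osc[OF that, folded T_def] by simp
    ultimately show ?case by blast
  next
    case (Suc j)
    then obtain e m S where e: "e \<in> selection_maps A" "src e = bsd m A" "tgt e = bsd k A"
        "homeo m k S" "star_approx (bsd m A) (fn e) S"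
      and oscS: "\<And>D F. face_osc (bsd k A) D F \<Longrightarrow>
          face_osc (bsd m A) (r ^ (2 * Suc j) * D) (\<lambda>p. F (S p))"
      by blast
    obtain d where d: "d \<in> selection_maps A" "src d = bsd (m + 2) A" "tgt d = bsd m A"
        "star_approx (bsd (m + 2) A) (fn d) (std m \<circ> std (Suc m))"
      using double_step by blast
    let ?T = "std m \<circ> std (Suc m)"
    have "comp_smap e d \<in> selection_maps A"
      using e d by (intro selection_maps.comp) auto
    moreover have "star_approx (bsd (m + 2) A) (\<lambda>u. fn e (fn d u)) (S \<circ> ?T)"
      using homeo_in[OF hom] by (intro star_approx_comp[OF e(5) d(4) complex_bsd]) auto
    then have "star_approx (bsd (m + 2) A) (fn (comp_smap e d)) (S \<circ> ?T)"
      by (subst star_approx_cong[where \<psi> = "\<lambda>u. fn e (fn d u)"]) (simp_all add: d(2))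
    moreover have "face_osc (bsd (m + 2) A) (r ^ (2 * Suc (Suc j)) * D) (\<lambda>p. F ((S \<circ> ?T) p))"
      if "face_osc (bsd k A) D F" for D F
      using osc[OF oscS[OF that]] by (simp add: power2_eq_square mult_ac)
    moreover have "homeo (m + 2) k (S \<circ> ?T)" using homeo_comp[OF e(4) hom] .
    moreover have "src (comp_smap e d) = bsd (m + 2) A" "tgt (comp_smap e d) = bsd k A"
      using e(3) d(2) by simp_all
    ultimately show ?case by blast
  }
qed

text \<open>Coordinate functions have oscillation at most 1 on faces, and \<open>r < 1\<close>, so
  enough double steps bring the mesh below \<eta>.\<close>

lemma fine_selection:
  assumes "\<eta> > 0"
  obtains e m S where "e \<in> selection_maps A" "src e = bsd m A" "tgt e = bsd k A" "homeo m k S"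
    "star_approx (bsd m A) (fn e) S" "mesh_less (bsd m A) S \<eta>"
proof -
  define r where "r = 1 - 1 / real max_face"
  have r: "0 \<le> r" "r < 1" using max_face_pos by (auto simp: r_def)
  then obtain j where j: "r ^ j < \<eta>" using real_arch_pow_inv[OF assms] by blast
  have "r ^ (2 * Suc j) \<le> r ^ j" using r by (intro power_decreasing) auto
  then have small: "r ^ (2 * Suc j) * 1 < \<eta>" using j by simp
  obtain e m S where e: "e \<in> selection_maps A" "src e = bsd m A" "tgt e = bsd k A"
        "homeo m k S" "star_approx (bsd m A) (fn e) S"
      and osc: "\<And>D F. face_osc (bsd k A) D F \<Longrightarrow>
          face_osc (bsd m A) (r ^ (2 * Suc j) * D) (\<lambda>p. F (S p))"
    using fine_selection_aux[of k j] unfolding r_def by blast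
  have "mesh_less (bsd m A) S \<eta>"
    unfolding mesh_less_def
  proof (intro ballI allI)
    fix \<kappa> p q v assume "\<kappa> \<in> bsd m A" "p \<in> points {\<kappa>}" "q \<in> points {\<kappa>}"
    then have "\<bar>S p v - S q v\<bar> \<le> r ^ (2 * Suc j) * 1"
      by (rule face_osc_bound[OF finite_bsd_A osc[OF face_osc_coordinate[OF finite_bsd_A]]])
    then show "\<bar>S p v - S q v\<bar> < \<eta>" using small by simp
  qed
  then show ?thesis using that e by blast
qed

end

section \<open>Star approximations of arbitrary selection maps\<close>

lemma finite_positive_lower_bound:
  fixes h :: "'b \<Rightarrow> real"
  assumes "finite X" "\<And>x. x \<in> X \<Longrightarrow> 0 < h x"
  shows "\<exists>\<delta>>0. \<forall>x\<in>X. \<delta> \<le> h x"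
  using assms
proof (induction X)
  case empty
  show ?case by (intro exI[of _ 1]) simp
next
  case (insert x X)
  then obtain \<delta> where "\<delta> > 0" "\<forall>x\<in>X. \<delta> \<le> h x" by auto
  then show ?case using insert.prems[of x] by (intro exI[of _ "min \<delta> (h x)"]) auto
qed

context finite_complex
begin

text \<open>A positive continuous function on a compact face has a positive minimum, and there are
  finitely many pairs of a face and one of its vertices. The margin \<delta> survives replacing a
  realization by a nearby homeomorphism.\<close>

lemma star_approx_lower_bound:
  assumes "homeo m k S" "star_approx (bsd m A) \<phi> S"
  obtains \<delta> where "\<delta> > 0" "\<And>\<kappa> u p. \<kappa> \<in> bsd m A \<Longrightarrow> u |\<in>| \<kappa> \<Longrightarrow> p \<in> points {\<kappa>} \<Longrightarrow> \<delta> \<le> S p (\<phi> u)"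
proof -
  let ?X = "Sigma (bsd m A) fset"
  have "\<forall>x\<in>?X. \<exists>d>0. \<forall>p\<in>points {fst x}. d \<le> S p (\<phi> (snd x))"
  proof
    fix x assume "x \<in> ?X"
    then obtain \<kappa> u where x: "x = (\<kappa>, u)" "\<kappa> \<in> bsd m A" "u |\<in>| \<kappa>" by auto
    have "continuous_on (points {\<kappa>}) S"
      using assms(1) x(2) points_simplexI unfolding homeo_def
      by (meson continuous_on_subset subsetI)
    then have "continuous_on (points {\<kappa>}) (\<lambda>p. S p (\<phi> u))"
      by (rule continuous_on_product_then_coordinatewise)
    moreover have "compact (points {\<kappa>})" by (simp add: compact_points)
    moreover have "points {\<kappa>} \<noteq> {}" using vpoint_in_simplex[OF x(3)] by blast
    ultimately obtain q where "q \<in> points {\<kappa>}" "\<forall>p\<in>points {\<kappa>}. S q (\<phi> u) \<le> S p (\<phi> u)"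
      using continuous_attains_inf by blast
    then show "\<exists>d>0. \<forall>p\<in>points {fst x}. d \<le> S p (\<phi> (snd x))"
      using star_approxD[OF assms(2) x(2,3)] x(1) by auto
  qed
  then obtain d where d: "\<And>x. x \<in> ?X \<Longrightarrow> 0 < d x" "\<And>x p. x \<in> ?X \<Longrightarrow> p \<in> points {fst x} \<Longrightarrow> d x \<le> S p (\<phi> (snd x))"
    by metis
  have "finite ?X" using finite_bsd_A by auto
  then obtain \<delta> where "\<delta> > 0" "\<forall>x\<in>?X. \<delta> \<le> d x"
    using finite_positive_lower_bound[of ?X d] d(1) by blast
  then show ?thesis using that[of \<delta>] d(2) by fastforce
qed

text \<open>Two refinements, as the choices depend on each other. The first, \<open>e0\<close>,
  gives the margin \<delta> that determines \<open>H\<close>. Only then is the composite of \<Psi>,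
  \<open>H\<close> and \<open>S0\<close> fixed, and its modulus of continuity tells how fine
  \<open>e1\<close> must be for the mesh bound; composing with \<open>e1\<close> keeps the star
  property.\<close>

lemma approximation_step:
  assumes g: "near_homeo n k g" and \<Psi>: "homeo k l \<Psi>" and "\<epsilon> > 0"
  obtains e m H where "e \<in> selection_maps A" "src e = bsd m A" "tgt e = bsd n A" "homeo m k H"
    "star_approx (bsd m A) (\<lambda>u. fn g (fn e u)) H" "mesh_less (bsd m A) (\<Psi> \<circ> H) \<epsilon>"
proof -
  have srcg: "src g = bsd n A" using g by (simp add: near_homeo_def)
  obtain e0 m0 S0 where e0: "e0 \<in> selection_maps A" "src e0 = bsd m0 A" "tgt e0 = bsd n A"
      \<comment> \<open>The mesh bound 1 is an arbitrary choice; the mesh is controlled later by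
        \<open>e1\<close>.\<close>
      "homeo m0 n S0" "star_approx (bsd m0 A) (fn e0) S0"
    using fine_selection[of 1] by (metis zero_less_one)
  obtain \<delta> where \<delta>: "\<delta> > 0" "\<And>\<kappa> u p. \<kappa> \<in> bsd m0 A \<Longrightarrow> u |\<in>| \<kappa> \<Longrightarrow> p \<in> points {\<kappa>} \<Longrightarrow> \<delta> \<le> S0 p (fn e0 u)"
    using star_approx_lower_bound[OF e0(4,5)] by blast
  obtain H where H: "homeo n k H" "\<And>p v. p \<in> points (bsd n A) \<Longrightarrow> \<bar>push g p v - H p v\<bar> < \<delta>"
    using g \<delta>(1) unfolding near_homeo_def by meson
  have HS: "homeo m0 k (H \<circ> S0)" using homeo_comp[OF H(1) e0(4)] .
  have sa: "star_approx (bsd m0 A) (\<lambda>u. fn g (fn e0 u)) (H \<circ> S0)"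
    unfolding star_approx_def
  proof (intro ballI allI impI)
    fix \<kappa> u p assume *: "\<kappa> \<in> bsd m0 A" "u |\<in>| \<kappa>" "p \<in> points {\<kappa>}"
    have Sp: "S0 p \<in> points (bsd n A)"
      using homeo_in[OF e0(4)] points_simplexI[OF *(1,3)] by blast
    have "\<delta> \<le> S0 p (fn e0 u)" using \<delta>(2)[OF *] .
    also have "\<dots> \<le> push g (S0 p) (fn g (fn e0 u))"
      using push_ge[of g "S0 p"] Sp srcg finite_bsd_A by simp
    finally show "0 < (H \<circ> S0) p (fn g (fn e0 u))"
      using H(2)[OF Sp, of "fn g (fn e0 u)"] by simp
  qed
  obtain \<eta> where \<eta>: "\<eta> > 0" "\<And>p q v. p \<in> points (bsd m0 A) \<Longrightarrow> q \<in> points (bsd m0 A) \<Longrightarrow>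
      (\<And>v. \<bar>p v - q v\<bar> < \<eta>) \<Longrightarrow> \<bar>(\<Psi> \<circ> (H \<circ> S0)) p v - (\<Psi> \<circ> (H \<circ> S0)) q v\<bar> < \<epsilon>"
    using homeo_uniform[OF homeo_comp[OF \<Psi> HS] \<open>\<epsilon> > 0\<close>] by blast
  obtain e1 m S1 where e1: "e1 \<in> selection_maps A" "src e1 = bsd m A" "tgt e1 = bsd m0 A"
      "homeo m m0 S1" "star_approx (bsd m A) (fn e1) S1" "mesh_less (bsd m A) S1 \<eta>"
    using fine_selection[OF \<eta>(1)] by metis
  show ?thesis
  proof (rule that)
    show "comp_smap e0 e1 \<in> selection_maps A"
      using e0 e1 by (intro selection_maps.comp) auto
    show "src (comp_smap e0 e1) = bsd m A" "tgt (comp_smap e0 e1) = bsd n A"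
      using e0 e1 by simp_all
    show "homeo m k ((H \<circ> S0) \<circ> S1)" using homeo_comp[OF HS e1(4)] .
    have "star_approx (bsd m A) (\<lambda>u. fn g (fn e0 (fn e1 u))) ((H \<circ> S0) \<circ> S1)"
      using homeo_in[OF e1(4)] by (intro star_approx_comp[OF sa e1(5) complex_bsd]) auto
    then show "star_approx (bsd m A) (\<lambda>u. fn g (fn (comp_smap e0 e1) u)) ((H \<circ> S0) \<circ> S1)"
      by (subst star_approx_cong[where \<psi> = "\<lambda>u. fn g (fn e0 (fn e1 u))"]) (simp_all add: e1(2))
    show "mesh_less (bsd m A) (\<Psi> \<circ> ((H \<circ> S0) \<circ> S1)) \<epsilon>"
      unfolding mesh_less_def
    proof (intro ballI allI)
      fix \<kappa> p q v assume *: "\<kappa> \<in> bsd m A" "p \<in> points {\<kappa>}" "q \<in> points {\<kappa>}"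
      then have "\<And>v. \<bar>S1 p v - S1 q v\<bar> < \<eta>" using e1(6) unfolding mesh_less_def by blast
      moreover have "S1 p \<in> points (bsd m0 A)" "S1 q \<in> points (bsd m0 A)"
        using homeo_in[OF e1(4)] points_simplexI * by blast+
      ultimately show "\<bar>(\<Psi> \<circ> ((H \<circ> S0) \<circ> S1)) p v - (\<Psi> \<circ> ((H \<circ> S0) \<circ> S1)) q v\<bar> < \<epsilon>"
        using \<eta>(2)[of "S1 p" "S1 q" v] by simp
    qed
  qed
qed

end

section \<open>Generic sequences\<close>

lemma src_seq_comp: "n \<le> m \<Longrightarrow> src (seq_comp f n m) = src (f m)"
proof (induction rule: inc_induct)
  case base
  show ?case by (simp add: seq_comp_def)
next
  case (step n)
  have "seq_comp f n m = comp_smap (f n) (seq_comp f (Suc n) m)"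
    using step.hyps by (simp add: seq_comp_def upt_rec[of n m])
  then show ?case using step.IH by simp
qed

lemma fn_seq_comp:
  assumes "x (Suc m) \<in> verts (src (f m))"
  shows "n \<le> m \<Longrightarrow> (\<And>i. n \<le> i \<Longrightarrow> i \<le> m \<Longrightarrow> fn (f i) (x (Suc i)) = x i) \<Longrightarrow>
    fn (seq_comp f n m) (x (Suc m)) = x n"
proof (induction rule: inc_induct)
  case base
  then show ?case by (simp add: seq_comp_def)
next
  case (step n)
  have "seq_comp f n m = comp_smap (f n) (seq_comp f (Suc n) m)"
    using step.hyps by (simp add: seq_comp_def upt_rec[of n m])
  moreover have "x (Suc m) \<in> verts (src (seq_comp f (Suc n) m))"
    using assms step.hyps by (simp add: src_seq_comp)
  moreover have "fn (seq_comp f (Suc n) m) (x (Suc m)) = x (Suc n)"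
    using step.prems by (intro step.IH) simp
  ultimately show ?case using step.prems[of n] step.hyps by simp
qed

text \<open>A finite initial part of an element of \<open>lim_verts\<close>. Factorisations are
  stated for threads so that they apply to the finite stages from which a limit element is
  extracted.\<close>

definition thread :: "(nat \<Rightarrow> 'v smap) \<Rightarrow> nat \<Rightarrow> (nat \<Rightarrow> 'v) \<Rightarrow> bool" where
  "thread f n x \<longleftrightarrow> (\<forall>i\<le>n. x i \<in> verts (tgt (f i))) \<and> (\<forall>i<n. fn (f i) (x (Suc i)) = x i)"

lemma thread_lim_verts: "x \<in> lim_verts f \<Longrightarrow> thread f n x"
  by (simp add: thread_def lim_verts_def)

lemma thread_mono: "thread f n x \<Longrightarrow> m \<le> n \<Longrightarrow> thread f m x"
  by (simp add: thread_def)

lemma simplicial_edge: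
  "simplicial f \<Longrightarrow> {|u, v|} \<in> src f \<Longrightarrow> {|fn f u, fn f v|} \<in> tgt f"
  unfolding simplicial_def by force

context finite_complex
begin

lemma level_bsd: "level A (bsd k A) = k"
  unfolding level_def bsd_eq_iff by (rule Least_equality) auto

lemma near_homeo_levels:
  assumes "f \<in> selection_maps A" "src f = bsd k A" "tgt f = bsd l A"
  shows "near_homeo k l f"
proof -
  obtain k' l' where "near_homeo k' l' f" using selection_maps_near_homeo[OF assms(1)] by blast
  then show ?thesis using assms(2,3) by (auto simp: near_homeo_def bsd_eq_iff)
qed

lemma ex_selection_map_src: "\<exists>g\<in>selection_maps A. src g = bsd k A"
proof (induction k)
  case 0
  show ?case by (rule bexI[OF _ selection_maps.ident]) (simp add: id_smap_def)
next
  case (Suc k)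
  then obtain g where "g \<in> selection_maps A" "src g = bsd k A" by blast
  then show ?case
    by (intro bexI[OF _ selection_maps.subdiv[of g]]) (simp_all add: sd_smap_def bsd_Suc)
qed

lemma ex_homeo_0: "\<exists>\<Psi>. homeo k 0 \<Psi>"
proof (induction k)
  case 0
  show ?case using homeo_id by blast
next
  case (Suc k)
  then show ?case using homeo_comp homeo_std by blast
qed

end

locale generic_sequence = finite_complex A for A :: "'a scomplex" +
  fixes f :: "nat \<Rightarrow> 'a vert smap"
  assumes generic: "generic (selection_maps A) f"
begin

definition lev :: "nat \<Rightarrow> nat" where "lev n = level A (tgt (f n))"

lemma f_selection: "f n \<in> selection_maps A"
  using generic by (simp add: generic_def)

lemma tgt_f: "tgt (f n) = bsd (lev n) A"
proof -
  have "tgt (f n) \<in> objects (selection_maps A)"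
    unfolding objects_def using f_selection by blast
  then obtain k where "tgt (f n) = bsd k A" unfolding objects_selection_maps by blast
  then show ?thesis by (simp add: lev_def level_bsd)
qed

lemma src_f: "src (f n) = bsd (lev (Suc n)) A"
  using generic tgt_f[of "Suc n"] by (simp add: generic_def neat_def)

lemma near_homeo_f: "near_homeo (lev (Suc n)) (lev n) (f n)"
  using f_selection src_f tgt_f by (rule near_homeo_levels)

lemma simplicial_f: "simplicial (f n)"
  using simplicial_selection_maps[OF is_complex f_selection] .

text \<open>The second genericity condition, read on the coordinates of threads.\<close>

lemma generic_factor:
  assumes "e \<in> selection_maps A" "tgt e = bsd (lev n) A"
  obtains m g where "n < m" "g \<in> selection_maps A" "tgt g = src e" "src g = bsd (lev m) A"
    "\<And>x. thread f m x \<Longrightarrow> x n = fn e (fn g (x m))"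
proof -
  have "\<forall>n. \<forall>e\<in>selection_maps A. tgt e = tgt (f n) \<longrightarrow>
      (\<exists>m>n. \<exists>g\<in>selection_maps A. tgt g = src e \<and> seq_comp f n m = comp_smap e g)"
    using generic unfolding generic_def by (elim conjE)
  then have "\<exists>m>n. \<exists>g\<in>selection_maps A. tgt g = src e \<and> seq_comp f n m = comp_smap e g"
    using assms by (simp add: tgt_f)
  then obtain m g where m: "n < m" "g \<in> selection_maps A" "tgt g = src e" "seq_comp f n m = comp_smap e g"
    by (elim exE bexE conjE)
  have "src g = src (seq_comp f n m)" using m(4) by simp
  then have src: "src g = bsd (lev (Suc m)) A" using src_seq_comp[of n m f] m(1) src_f by simp
  have "x n = fn e (fn g (x (Suc m)))" if x: "thread f (Suc m) x" for x
  proof -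
    have v: "x (Suc m) \<in> verts (bsd (lev (Suc m)) A)"
      using x by (simp add: thread_def tgt_f)
    then have "fn (seq_comp f n m) (x (Suc m)) = x n"
      using x m(1) by (intro fn_seq_comp) (auto simp: thread_def src_f)
    then show ?thesis using m(4) v src by simp
  qed
  \<comment> \<open>The composite \<open>seq_comp f n m\<close> includes \<open>f m\<close>, so its
    source has index \<open>Suc m\<close>.\<close>
  then show ?thesis using that[of "Suc m" g] m src by simp
qed

end

text \<open>The interleaving: \<open>g i\<close> leads from the complex with index
  \<open>N i\<close> to level \<open>K i\<close>, and \<open>e i\<close> leads from level
  \<open>K (Suc i)\<close> back to index \<open>N i\<close>. Going around one way gives the
  composite of the given maps from \<open>N (Suc i)\<close> to \<open>N i\<close>; the other way
  gives \<open>g i\<close> after \<open>e i\<close>, which is the map with a star approximation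
  \<open>H\<close>. The homeomorphism \<open>\<Psi> i\<close> to level 0 accumulates these
  \<open>H\<close>.\<close>

locale approximating_sequence = generic_sequence A f for A :: "'a scomplex" and f +
  fixes N :: "nat \<Rightarrow> nat" and K :: "nat \<Rightarrow> nat" and g e :: "nat \<Rightarrow> 'a vert smap"
    and \<Psi> :: "nat \<Rightarrow> ('a vert \<Rightarrow> real) \<Rightarrow> 'a vert \<Rightarrow> real"
  assumes N: "N i < N (Suc i)"
    and g: "g i \<in> selection_maps A" "near_homeo (lev (N i)) (K i) (g i)"
    and e: "e i \<in> selection_maps A" "near_homeo (K (Suc i)) (lev (N i)) (e i)"
    and factor: "thread f (N (Suc i)) x \<Longrightarrow> x (N i) = fn (e i) (fn (g (Suc i)) (x (N (Suc i))))"
    and \<Psi>: "homeo (K i) 0 (\<Psi> i)"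
    and star: "\<exists>H. homeo (K (Suc i)) (K i) H \<and> \<Psi> (Suc i) = \<Psi> i \<circ> H \<and>
        star_approx (bsd (K (Suc i)) A) (\<lambda>u. fn (g i) (fn (e i) u)) H"
    and mesh: "mesh_less (bsd (K (Suc i)) A) (\<Psi> (Suc i)) (1 / (real i + 1))"

context generic_sequence
begin

text \<open>Dependent choice on states \<open>(n, k, g, \<Psi>)\<close>:
  \<open>approximation_step\<close> turns \<open>g\<close> and \<Psi> into \<open>e\<close> and
  \<open>H\<close>, and genericity applied to \<open>e\<close> yields the next \<open>g'\<close>.
  Any selection map with the right source can start.\<close>

lemma ex_approximating_sequence: "\<exists>N K g e \<Psi>. approximating_sequence A f N K g e \<Psi>"
proof -
  define P where "P = (\<lambda>(i::nat) (n, k, g :: 'a vert smap, \<Psi>).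
    g \<in> selection_maps A \<and> near_homeo (lev n) k g \<and> homeo k 0 \<Psi>)"
  define Q where "Q = (\<lambda>(i::nat) (n, k, g :: 'a vert smap, \<Psi> :: ('a vert \<Rightarrow> real) \<Rightarrow> 'a vert \<Rightarrow> real)
      (n', k', g' :: 'a vert smap, \<Psi>') e.
    e \<in> selection_maps A \<and> near_homeo k' (lev n) e \<and> n < n' \<and>
    (\<forall>x. thread f n' x \<longrightarrow> x n = fn e (fn g' (x n'))) \<and>
    (\<exists>H. homeo k' k H \<and> \<Psi>' = \<Psi> \<circ> H \<and> star_approx (bsd k' A) (\<lambda>u. fn g (fn e u)) H) \<and>
    mesh_less (bsd k' A) \<Psi>' (1 / (real i + 1)))"
  have "\<exists>S. \<forall>i. P i (S i) \<and> (\<exists>e. Q i (S i) (S (Suc i)) e)"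
  proof (rule dependent_nat_choice)
    obtain g where g: "g \<in> selection_maps A" "src g = bsd (lev 0) A"
      using ex_selection_map_src by blast
    then obtain k' k where "near_homeo k' k g" using selection_maps_near_homeo by blast
    then have "near_homeo (lev 0) k g" using g(2) by (auto simp: near_homeo_def bsd_eq_iff)
    moreover obtain \<Psi> where "homeo k 0 \<Psi>" using ex_homeo_0 by blast
    ultimately have "P 0 (0, k, g, \<Psi>)" using g(1) by (simp add: P_def)
    then show "\<exists>s. P 0 s" by blast
  next
    fix s i assume "P i s"
    moreover obtain n k g \<Psi> where s: "s = (n, k, g, \<Psi>)" by (metis prod_cases4)
    ultimately have g: "g \<in> selection_maps A" "near_homeo (lev n) k g" and \<Psi>: "homeo k 0 \<Psi>"
      by (simp_all add: P_def)
    have "1 / (real i + 1) > 0" by simp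
    from approximation_step[OF g(2) \<Psi> this] obtain e k' H where
      e: "e \<in> selection_maps A" "src e = bsd k' A" "tgt e = bsd (lev n) A" "homeo k' k H"
        "star_approx (bsd k' A) (\<lambda>u. fn g (fn e u)) H" "mesh_less (bsd k' A) (\<Psi> \<circ> H) (1 / (real i + 1))"
      by blast
    obtain n' g' where g': "n < n'" "g' \<in> selection_maps A" "tgt g' = src e" "src g' = bsd (lev n') A"
      "\<And>x. thread f n' x \<Longrightarrow> x n = fn e (fn g' (x n'))"
      using generic_factor[OF e(1,3)] by blast
    have "near_homeo (lev n') k' g'"
      using g'(2,4) g'(3)[unfolded e(2)] by (rule near_homeo_levels)
    moreover have "homeo k' 0 (\<Psi> \<circ> H)" using homeo_comp[OF \<Psi> e(4)] .
    ultimately have "P (Suc i) (n', k', g', \<Psi> \<circ> H)" using g'(2) by (simp add: P_def)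
    moreover have "near_homeo k' (lev n) e" using e(1-3) by (rule near_homeo_levels)
    then have "Q i s (n', k', g', \<Psi> \<circ> H) e"
      unfolding s Q_def prod.case using e g' by blast
    ultimately show "\<exists>s'. P (Suc i) s' \<and> (\<exists>e. Q i s s' e)" by blast
  qed
  then obtain S where S: "\<And>i. P i (S i)" "\<And>i. \<exists>e. Q i (S i) (S (Suc i)) e" by blast
  define E where "E = (\<lambda>i. SOME e. Q i (S i) (S (Suc i)) e)"
  have E: "Q i (S i) (S (Suc i)) (E i)" for i
    unfolding E_def using S(2) by (rule someI_ex)
  define N K G \<Psi> where "N = (\<lambda>i. fst (S i))" and "K = (\<lambda>i. fst (snd (S i)))"
    and "G = (\<lambda>i. fst (snd (snd (S i))))" and "\<Psi> = (\<lambda>i. snd (snd (snd (S i))))"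
  have eq: "S i = (N i, K i, G i, \<Psi> i)" for i by (simp add: N_def K_def G_def \<Psi>_def)
  have P: "G i \<in> selection_maps A" "near_homeo (lev (N i)) (K i) (G i)" "homeo (K i) 0 (\<Psi> i)" for i
    using S(1)[of i] unfolding eq P_def by simp_all
  note Q = E[unfolded eq Q_def prod.case]
  have "approximating_sequence A f N K G E \<Psi>"
    by unfold_locales (use P Q in simp_all)
  then show ?thesis by blast
qed

end

section \<open>Limit points\<close>

lemma eq_if_arbitrarily_close:
  fixes p q :: "'v \<Rightarrow> real"
  assumes "\<And>i a. \<bar>p a - q a\<bar> < c / (real i + 1)"
  shows "p = q"
proof (rule ext, rule ccontr)
  fix a assume "p a \<noteq> q a"
  then have pos: "\<bar>p a - q a\<bar> > 0" by simp
  obtain i :: nat where "c / \<bar>p a - q a\<bar> < real i" using reals_Archimedean2 by blast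
  then have "c < \<bar>p a - q a\<bar> * (real i + 1)"
    using pos by (simp add: pos_divide_less_eq mult.commute algebra_simps)
  then show False using assms[of a i] by (simp add: pos_less_divide_eq)
qed

text \<open>A diagonal argument: nested infinite index sets \<open>M n\<close>, where on
  \<open>M (Suc n)\<close> the entry with index \<open>n\<close> is constant by the pigeonhole
  principle.\<close>

lemma diagonal_finite_choice:
  fixes Z :: "nat \<Rightarrow> nat \<Rightarrow> 'v"
  assumes "\<And>n. finite (V n)" "\<And>m n. n \<le> m \<Longrightarrow> Z m n \<in> V n"
  shows "\<exists>x. \<forall>n. \<exists>m\<ge>n. \<forall>i\<le>n. Z m i = x i"
proof -
  have "\<exists>M. \<forall>n. infinite (M n) \<and> (M (Suc n) \<subseteq> M n \<and> (\<exists>v. \<forall>m\<in>M (Suc n). Z m n = v))"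
  proof (rule dependent_nat_choice)
    show "\<exists>M::nat set. infinite M" by (rule exI[of _ UNIV]) simp
    fix M :: "nat set" and n assume "infinite M"
    \<comment> \<open>Only indices \<open>m \<ge> n\<close> are known to have \<open>Z m n\<close>
      in the finite set \<open>V n\<close>.\<close>
    then have inf: "infinite (M \<inter> {n..})"
      by (metis Diff_infinite_finite Diff_Compl Compl_atLeast finite_lessThan)
    have "(\<lambda>m. Z m n) ` (M \<inter> {n..}) \<subseteq> V n" using assms(2) by auto
    then have "finite ((\<lambda>m. Z m n) ` (M \<inter> {n..}))" using assms(1) finite_subset by blast
    from pigeonhole_infinite[OF inf this] obtain m0 where
      "infinite {m \<in> M \<inter> {n..}. Z m n = Z m0 n}" by blast
    then show "\<exists>M'. infinite M' \<and> M' \<subseteq> M \<and> (\<exists>v. \<forall>m\<in>M'. Z m n = v)"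
      by (intro exI[of _ "{m \<in> M \<inter> {n..}. Z m n = Z m0 n}"]) auto
  qed
  then obtain M where M: "\<And>n. infinite (M n)" "\<And>n. M (Suc n) \<subseteq> M n"
      "\<And>n. \<exists>v. \<forall>m\<in>M (Suc n). Z m n = v"
    by blast
  define x where "x = (\<lambda>n. SOME v. \<forall>m\<in>M (Suc n). Z m n = v)"
  have x: "\<forall>m\<in>M (Suc n). Z m n = x n" for n
    unfolding x_def using M(3) by (rule someI_ex)
  have anti: "M j \<subseteq> M i" if "i \<le> j" for i j
    using that by (induction rule: dec_induct) (use M(2) in blast)+
  show ?thesis
  proof (intro exI[of _ x] allI)
    fix n
    obtain m where m: "m \<ge> n" "m \<in> M (Suc n)"
      using M(1)[of "Suc n"] unfolding infinite_nat_iff_unbounded_le by blast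
    have "Z m i = x i" if "i \<le> n" for i
    proof -
      have "m \<in> M (Suc i)" using anti[of "Suc i" "Suc n"] that m(2) by auto
      then show ?thesis using x by blast
    qed
    then show "\<exists>m\<ge>n. \<forall>i\<le>n. Z m i = x i" using m(1) by blast
  qed
qed

context generic_sequence
begin

text \<open>The vertex set of \<beta>^\<infinity>B, seen inside that of \<beta>^\<infinity>A; see
  \<open>lim_verts_restrict_seq\<close>.\<close>

definition lim_sub :: "'a scomplex \<Rightarrow> (nat \<Rightarrow> 'a vert) set" where
  "lim_sub B = {x \<in> lim_verts f. \<forall>n. x n \<in> verts (bsd (lev n) B)}"

lemma lim_sub_self: "lim_sub A = lim_verts f"
  by (auto simp: lim_sub_def lim_verts_def tgt_f)

lemma f_vert:
  "is_complex B \<Longrightarrow> B \<subseteq> A \<Longrightarrow> v \<in> verts (bsd (lev (Suc n)) B) \<Longrightarrow> fn (f n) v \<in> verts (bsd (lev n) B)"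
  by (rule near_homeo_vert[OF near_homeo_f])

text \<open>The lower entries are the images of \<open>v\<close>, and these stay in \<open>B\<close>
  because selection maps restrict to subcomplexes.\<close>

lemma ex_thread:
  assumes "is_complex B" "B \<subseteq> A"
  shows "v \<in> verts (bsd (lev n) B) \<Longrightarrow>
    \<exists>z. thread f n z \<and> z n = v \<and> (\<forall>i\<le>n. z i \<in> verts (bsd (lev i) B))"
proof (induction n arbitrary: v)
  case 0
  then show ?case
    using verts_mono[OF bsd_mono[OF assms(2)]]
    by (intro exI[of _ "\<lambda>_. v"]) (auto simp: thread_def tgt_f)
next
  case (Suc n)
  then obtain z where z: "thread f n z" "z n = fn (f n) v" "\<forall>i\<le>n. z i \<in> verts (bsd (lev i) B)"
    using f_vert[OF assms] by blast
  have "v \<in> verts (tgt (f (Suc n)))"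
    using verts_mono[OF bsd_mono[OF assms(2)]] Suc.prems by (auto simp: tgt_f)
  then show ?case using z Suc.prems
    by (intro exI[of _ "z(Suc n := v)"]) (auto simp: thread_def le_Suc_eq less_Suc_eq)
qed

lemma lim_verts_restrict_seq:
  assumes "B \<subseteq> A"
  shows "lim_verts (restrict_seq A f B) = lim_sub B"
proof -
  have tgt: "tgt (restrict_seq A f B n) = bsd (lev n) B" for n
    by (simp add: restrict_seq_def lev_def Let_def)
  have fn: "fn (restrict_seq A f B n) v = fn (f n) v" if "v \<in> verts (bsd (lev (Suc n)) B)" for n v
    using that by (simp add: restrict_seq_def Let_def src_f level_bsd)
  have "verts (bsd (lev n) B) \<subseteq> verts (bsd (lev n) A)" for n
    using assms by (simp add: bsd_mono verts_mono)
  then have sub: "x n \<in> verts (bsd (lev n) A)" if "\<forall>n. x n \<in> verts (bsd (lev n) B)" for x n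
    using that by blast
  show ?thesis
  proof (intro set_eqI iffI)
    fix x assume "x \<in> lim_verts (restrict_seq A f B)"
    then have B: "\<forall>n. x n \<in> verts (bsd (lev n) B)"
      and "\<And>n. fn (restrict_seq A f B n) (x (Suc n)) = x n"
      by (simp_all add: lim_verts_def tgt)
    then have "fn (f n) (x (Suc n)) = x n" for n using fn[of "x (Suc n)" n] by simp
    then show "x \<in> lim_sub B" using B sub[OF B] by (simp add: lim_sub_def lim_verts_def tgt_f)
  next
    fix x assume "x \<in> lim_sub B"
    then show "x \<in> lim_verts (restrict_seq A f B)"
      by (simp add: lim_sub_def lim_verts_def tgt fn)
  qed
qed

lemma lim_rel_iff:
  assumes "x \<in> lim_verts f" "y \<in> lim_verts f"
  shows "(x, y) \<in> lim_rel f \<longleftrightarrow> (\<forall>n. {|x n, y n|} \<in> bsd (lev n) A)"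
  using assms by (simp add: lim_rel_def lim_complex_def tgt_f)

text \<open>The maps are simplicial, so edges pass down to smaller indices and it suffices to find
  them at cofinally many.\<close>

lemma lim_edge_mono:
  assumes "x \<in> lim_verts f" "y \<in> lim_verts f" "m \<le> n" "{|x n, y n|} \<in> bsd (lev n) A"
  shows "{|x m, y m|} \<in> bsd (lev m) A"
  using assms(3,4)
proof (induction rule: inc_induct)
  case base
  then show ?case .
next
  case (step m)
  have "{|fn (f m) (x (Suc m)), fn (f m) (y (Suc m))|} \<in> tgt (f m)"
    using step by (intro simplicial_edge simplicial_f) (simp add: src_f)
  then show ?case using assms(1,2) by (simp add: tgt_f lim_verts_def)
qed

end

section \<open>Nested stars and the limit point of a thread\<close>

context approximating_sequence
begin

definition proj :: "nat \<Rightarrow> (nat \<Rightarrow> 'a vert) \<Rightarrow> 'a vert" where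
  "proj i x = fn (g i) (x (N i))"

text \<open>Stars are transported to level 0 by \<open>\<Psi> i\<close>, so that those of different
  stages can be compared in one space.\<close>

definition open_star :: "nat \<Rightarrow> 'a vert \<Rightarrow> ('a vert \<Rightarrow> real) set" where
  "open_star i v = \<Psi> i ` {p \<in> points (bsd (K i) A). 0 < p v}"

definition closed_star :: "nat \<Rightarrow> 'a vert \<Rightarrow> ('a vert \<Rightarrow> real) set" where
  "closed_star i v = \<Psi> i ` (\<Union>\<kappa>\<in>{\<kappa> \<in> bsd (K i) A. v |\<in>| \<kappa>}. points {\<kappa>})"

lemma closed_starI:
  "\<kappa> \<in> bsd (K i) A \<Longrightarrow> v |\<in>| \<kappa> \<Longrightarrow> p \<in> points {\<kappa>} \<Longrightarrow> \<Psi> i p \<in> closed_star i v"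
  unfolding closed_star_def by blast

lemma open_star_subset: "open_star i v \<subseteq> closed_star i v"
proof
  fix q assume "q \<in> open_star i v"
  then obtain p where p: "p \<in> points (bsd (K i) A)" "0 < p v" "q = \<Psi> i p"
    by (auto simp: open_star_def)
  obtain \<kappa> where "\<kappa> \<in> bsd (K i) A" "p \<in> points {\<kappa>}" "\<And>v. v |\<in>| \<kappa> \<longleftrightarrow> 0 < p v"
    using points_carrier_simplex[OF complex_bsd p(1)] by blast
  then show "q \<in> closed_star i v" using p by (auto intro: closed_starI)
qed

lemma closed_star_subset: "closed_star (Suc i) u \<subseteq> open_star i (fn (g i) (fn (e i) u))"
proof
  fix q assume "q \<in> closed_star (Suc i) u"
  then obtain \<kappa> p where p: "\<kappa> \<in> bsd (K (Suc i)) A" "u |\<in>| \<kappa>" "p \<in> points {\<kappa>}" "q = \<Psi> (Suc i) p"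
    by (auto simp: closed_star_def)
  obtain H where H: "homeo (K (Suc i)) (K i) H" "\<Psi> (Suc i) = \<Psi> i \<circ> H"
      "star_approx (bsd (K (Suc i)) A) (\<lambda>u. fn (g i) (fn (e i) u)) H"
    using star by blast
  have "0 < H p (fn (g i) (fn (e i) u))"
    using star_approxD[OF H(3) p(1-3)] .
  moreover have "H p \<in> points (bsd (K i) A)"
    using homeo_in[OF H(1) points_simplexI[OF p(1,3)]] .
  ultimately show "q \<in> open_star i (fn (g i) (fn (e i) u))"
    using p(4) H(2) by (simp add: open_star_def)
qed

lemma compact_closed_star: "compact (closed_star i v)"
proof -
  let ?S = "\<Union>\<kappa>\<in>{\<kappa> \<in> bsd (K i) A. v |\<in>| \<kappa>}. points {\<kappa>}"
  have "compact ?S"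
    by (intro compact_UN compact_points) (simp_all add: finite_bsd_A)
  moreover have "?S \<subseteq> points (bsd (K i) A)" using points_simplexI by blast
  then have "continuous_on ?S (\<Psi> i)"
    using \<Psi>[of i] continuous_on_subset unfolding homeo_def by blast
  ultimately show ?thesis unfolding closed_star_def by (rule compact_continuous_image[rotated])
qed

lemma closed_star_points: "closed_star i v \<subseteq> points (bsd 0 A)"
  unfolding closed_star_def using homeo_in[OF \<Psi>] points_simplexI by blast

text \<open>Each point of the star shares a face with the centre \<open>v\<close>, so the mesh bound
  enters twice.\<close>

lemma closed_star_diam:
  assumes "q \<in> closed_star (Suc i) v" "q' \<in> closed_star (Suc i) v"
  shows "\<bar>q a - q' a\<bar> < 2 / (real i + 1)"
proof -
  have near: "\<bar>q a - \<Psi> (Suc i) (vpoint v) a\<bar> < 1 / (real i + 1)" if "q \<in> closed_star (Suc i) v" for q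
  proof -
    obtain \<kappa> p where p: "\<kappa> \<in> bsd (K (Suc i)) A" "v |\<in>| \<kappa>" "p \<in> points {\<kappa>}" "q = \<Psi> (Suc i) p"
      using \<open>q \<in> closed_star (Suc i) v\<close> by (auto simp: closed_star_def)
    show ?thesis
      using mesh[of i] p(1,3) vpoint_in_simplex[OF p(2)] unfolding mesh_less_def p(4) by simp
  qed
  have "\<bar>q a - q' a\<bar> < 1 / (real i + 1) + 1 / (real i + 1)"
    using near[OF assms(1)] near[OF assms(2)] by linarith
  then show ?thesis by simp
qed

lemma proj_factor: "x \<in> lim_verts f \<Longrightarrow> x (N i) = fn (e i) (proj (Suc i) x)"
  unfolding proj_def by (rule factor[OF thread_lim_verts])

lemma proj_vert:
  assumes "is_complex B" "B \<subseteq> A" "x \<in> lim_sub B"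
  shows "proj i x \<in> verts (bsd (K i) B)"
  unfolding proj_def using assms by (intro near_homeo_vert[OF g(2)]) (auto simp: lim_sub_def)

text \<open>The factorisation of the sequence makes \<open>proj i x\<close> the image of
  \<open>proj (Suc i) x\<close> under \<open>e i\<close> and \<open>g i\<close>, the composite that
  has a star approximation.\<close>

lemma closed_star_proj:
  assumes "x \<in> lim_verts f"
  shows "closed_star (Suc i) (proj (Suc i) x) \<subseteq> open_star i (proj i x)"
  using closed_star_subset[of i "proj (Suc i) x"] unfolding proj_factor[OF assms, symmetric]
  by (simp add: proj_def)

lemma vpoint_closed_star:
  assumes "v \<in> verts (bsd (K i) A)"
  shows "\<Psi> i (vpoint v) \<in> closed_star i v"
proof -
  obtain \<kappa> where "\<kappa> \<in> bsd (K i) A" "v |\<in>| \<kappa>" using assms by (auto simp: verts_def)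
  then show ?thesis by (intro closed_starI vpoint_in_simplex)
qed

lemma limit_point_exists:
  assumes x: "x \<in> lim_verts f"
  shows "\<exists>q. \<forall>i. q \<in> closed_star i (proj i x)"
proof -
  let ?X = "top_of_set (points (bsd 0 A))" and ?C = "\<lambda>i. closed_star i (proj i x)"
  have "(\<Inter>i. ?C i) \<noteq> {}"
  proof (rule compact_space_imp_nest[of ?X])
    show "compact_space ?X"
      using compact_points[OF finite_bsd_A] by (simp add: compact_space_subtopology)
    show "closedin ?X (?C i)" for i
    proof (rule compactin_imp_closedin)
      show "Hausdorff_space ?X"
        by (simp add: Hausdorff_space_euclidean_fun Hausdorff_space_subtopology)
      show "compactin ?X (?C i)"
        using compact_closed_star closed_star_points by (simp add: compactin_subtopology)
    qed
    show "?C i \<noteq> {}" for i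
      using vpoint_closed_star proj_vert[OF is_complex subset_refl] x lim_sub_self by blast
    show "decseq ?C"
      using closed_star_proj[OF x] open_star_subset by (intro decseq_SucI) blast
  qed
  then show ?thesis by blast
qed

definition limit_point :: "(nat \<Rightarrow> 'a vert) \<Rightarrow> 'a vert \<Rightarrow> real" where
  "limit_point x = (SOME q. \<forall>i. q \<in> closed_star i (proj i x))"

lemma limit_point_closed: "x \<in> lim_verts f \<Longrightarrow> limit_point x \<in> closed_star i (proj i x)"
  unfolding limit_point_def using someI_ex[OF limit_point_exists] by blast

text \<open>Each closed star lies in the open star of the stage before. This makes
  \<open>proj i x\<close> a vertex of the carrier of the limit point at stage
  \<open>i\<close>.\<close>

lemma limit_point_open: "x \<in> lim_verts f \<Longrightarrow> limit_point x \<in> open_star i (proj i x)"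
  using closed_star_proj limit_point_closed by blast

lemma limit_point_points: "x \<in> lim_verts f \<Longrightarrow> limit_point x \<in> points (bsd 0 A)"
  using limit_point_closed closed_star_points by blast

lemma limit_point_unique:
  assumes "x \<in> lim_verts f" "\<And>i. q \<in> closed_star i (proj i x)"
  shows "limit_point x = q"
  by (rule eq_if_arbitrarily_close, rule closed_star_diam[OF limit_point_closed[OF assms(1)] assms(2)])

text \<open>If the limits agree, both projections lie in the carrier of one point and span a face;
  the simplicial map \<open>e n\<close> takes it to an edge at index \<open>N n \<ge> n\<close>,
  which passes down to \<open>n\<close>. Conversely, if the projections span a face, the two closed
  stars share the point \<open>?q\<close>, so the limits are within twice the diameter bound at
  every stage.\<close>

lemma limit_point_eq_iff:
  assumes x: "x \<in> lim_verts f" and y: "y \<in> lim_verts f"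
  shows "limit_point x = limit_point y \<longleftrightarrow> (x, y) \<in> lim_rel f"
proof
  assume eq: "limit_point x = limit_point y"
  have edge: "{|proj i x, proj i y|} \<in> bsd (K i) A" for i
  proof -
    obtain p where p: "p \<in> points (bsd (K i) A)" "0 < p (proj i x)" "limit_point x = \<Psi> i p"
      using limit_point_open[OF x, of i] by (auto simp: open_star_def)
    obtain q where q: "q \<in> points (bsd (K i) A)" "0 < q (proj i y)" "limit_point y = \<Psi> i q"
      using limit_point_open[OF y, of i] by (auto simp: open_star_def)
    have "p = q"
      using homeo_bij[OF \<Psi>, of i] p q eq unfolding bij_betw_def by (auto dest: inj_onD)
    obtain \<kappa> where "\<kappa> \<in> bsd (K i) A" "\<And>v. v |\<in>| \<kappa> \<longleftrightarrow> 0 < p v"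
      using points_carrier_simplex[OF complex_bsd p(1)] by blast
    moreover have "{|proj i x, proj i y|} |\<subseteq>| \<kappa>"
      using calculation(2) p(2) q(2) \<open>p = q\<close> by auto
    ultimately show ?thesis using complex_bsd[of "K i"] unfolding is_complex_def by blast
  qed
  have "{|x n, y n|} \<in> bsd (lev n) A" for n
  proof -
    have "n \<le> N n" by (rule strict_mono_imp_increasing) (simp add: strict_mono_Suc_iff N)
    moreover have "simplicial (e n)" using simplicial_selection_maps[OF is_complex e(1)] .
    then have "{|fn (e n) (proj (Suc n) x), fn (e n) (proj (Suc n) y)|} \<in> tgt (e n)"
      using edge[of "Suc n"] e(2)[of n] by (intro simplicial_edge) (simp_all add: near_homeo_def)
    then have "{|x (N n), y (N n)|} \<in> bsd (lev (N n)) A"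
      using e(2)[of n] by (simp add: proj_factor[OF x] proj_factor[OF y] near_homeo_def)
    ultimately show ?thesis by (rule lim_edge_mono[OF x y])
  qed
  then show "(x, y) \<in> lim_rel f" using lim_rel_iff[OF x y] by blast
next
  assume rel: "(x, y) \<in> lim_rel f"
  have "\<bar>limit_point x a - limit_point y a\<bar> < 4 / (real i + 1)" for i a
  proof -
    let ?\<kappa> = "{|proj (Suc i) x, proj (Suc i) y|}"
    have "{|x (N (Suc i)), y (N (Suc i))|} \<in> src (g (Suc i))"
      using rel lim_rel_iff[OF x y] g(2)[of "Suc i"] by (simp add: near_homeo_def)
    then have "?\<kappa> \<in> tgt (g (Suc i))"
      unfolding proj_def
      by (intro simplicial_edge simplicial_selection_maps[OF is_complex g(1)])
    then have \<kappa>: "?\<kappa> \<in> bsd (K (Suc i)) A" using g(2)[of "Suc i"] by (simp add: near_homeo_def)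
    let ?q = "\<Psi> (Suc i) (vpoint (proj (Suc i) x))"
    have "?q \<in> closed_star (Suc i) (proj (Suc i) x)" "?q \<in> closed_star (Suc i) (proj (Suc i) y)"
      using \<kappa> by (auto intro!: closed_starI[OF \<kappa>] vpoint_in_simplex)
    then have "\<bar>limit_point x a - ?q a\<bar> < 2 / (real i + 1)" "\<bar>limit_point y a - ?q a\<bar> < 2 / (real i + 1)"
      using closed_star_diam limit_point_closed x y by blast+
    then have "\<bar>limit_point x a - limit_point y a\<bar> < 2 / (real i + 1) + 2 / (real i + 1)" by linarith
    then show ?thesis by simp
  qed
  then show "limit_point x = limit_point y" by (rule eq_if_arbitrarily_close)
qed

text \<open>The images of the vertex points \<open>proj (Suc i) x\<close> lie in \<open>B\<close>
  and approach the limit. The positive coordinates of the limit are at least \<delta>, so a close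
  enough such image is positive there too; its carrier contains that of the limit, which is
  therefore a face in \<open>B\<close>.\<close>

lemma limit_point_sub:
  assumes B: "is_complex B" "B \<subseteq> A" and x: "x \<in> lim_sub B"
  shows "limit_point x \<in> points (bsd 0 B)"
proof -
  have x': "x \<in> lim_verts f" using x by (simp add: lim_sub_def)
  obtain \<sigma> where \<sigma>: "\<sigma> \<in> bsd 0 A" "limit_point x \<in> points {\<sigma>}" "\<And>v. v |\<in>| \<sigma> \<longleftrightarrow> 0 < limit_point x v"
    using points_carrier_simplex[OF complex_bsd limit_point_points[OF x']] by blast
  obtain \<delta> where \<delta>: "\<delta> > 0" "\<forall>v\<in>fset \<sigma>. \<delta> \<le> limit_point x v"
    using finite_positive_lower_bound[of "fset \<sigma>" "limit_point x", OF finite_fset] \<sigma>(3) by metis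
  obtain i :: nat where "2 / \<delta> < real i" using reals_Archimedean2 by blast
  then have i: "2 / (real i + 1) < \<delta>" using \<delta>(1) by (simp add: field_simps)
  let ?v = "proj (Suc i) x"
  let ?q = "\<Psi> (Suc i) (vpoint ?v)"
  have v: "?v \<in> verts (bsd (K (Suc i)) B)" using proj_vert[OF B x] .
  have "vpoint ?v \<in> points (bsd (K (Suc i)) B)"
    using vpoint_in_points[OF is_complex_bsd[OF B(1)] v] .
  moreover have "bij_betw (\<Psi> (Suc i)) (points (bsd (K (Suc i)) B)) (points (bsd 0 B))"
    using \<Psi>[of "Suc i"] B unfolding homeo_def by blast
  ultimately have "?q \<in> points (bsd 0 B)" by (rule bij_betw_apply[rotated])
  then obtain \<tau> where \<tau>: "\<tau> \<in> bsd 0 B" "\<And>v. v |\<in>| \<tau> \<longleftrightarrow> 0 < ?q v"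
    using points_carrier_simplex[OF is_complex_bsd[OF B(1)]] by blast
  have "?q \<in> closed_star (Suc i) ?v"
    using v verts_mono[OF bsd_mono[OF B(2)]] by (intro vpoint_closed_star) blast
  then have close: "\<bar>limit_point x a - ?q a\<bar> < \<delta>" for a
    using closed_star_diam[OF limit_point_closed[OF x']] i by (meson less_trans)
  have "\<sigma> |\<subseteq>| \<tau>"
  proof
    fix a assume "a |\<in>| \<sigma>"
    then have "\<delta> \<le> limit_point x a" using \<delta>(2) by blast
    then have "0 < ?q a" using close[of a] by linarith
    then show "a |\<in>| \<tau>" using \<tau>(2) by blast
  qed
  moreover have "\<sigma> \<noteq> {||}" using face_nonempty[OF complex_bsd \<sigma>(1)] .
  ultimately have "\<sigma> \<in> bsd 0 B"
    using is_complex_bsd[OF B(1), of 0] \<tau>(1) unfolding is_complex_def by blast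
  then show ?thesis using \<sigma>(2) by (rule points_simplexI)
qed

lemma open_star_step: "q \<in> open_star (Suc i) u \<Longrightarrow> q \<in> open_star i (fn (g i) (fn (e i) u))"
  using open_star_subset closed_star_subset by blast

text \<open>At each stage \<open>q\<close> lies in the open star of some vertex \<open>w i\<close>
  over \<open>B\<close>, but these vertices need not be compatible. Each is extended downwards to a
  finite thread, and \<open>x\<close> agrees on every initial part with one of these
  threads.\<close>

lemma limit_point_surj:
  assumes B: "is_complex B" "B \<subseteq> A" and q: "q \<in> points (bsd 0 B)"
  shows "\<exists>x\<in>lim_sub B. limit_point x = q"
proof -
  have Nmono: "strict_mono N" by (simp add: strict_mono_Suc_iff N)
  have Nge: "n \<le> N n" for n using Nmono by (rule strict_mono_imp_increasing)
  have "\<exists>w. w \<in> verts (bsd (K i) B) \<and> q \<in> open_star i w" for i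
  proof -
    have bij: "bij_betw (\<Psi> i) (points (bsd (K i) B)) (points (bsd 0 B))"
      using \<Psi>[of i] B unfolding homeo_def by blast
    then obtain p where p: "p \<in> points (bsd (K i) B)" "q = \<Psi> i p"
      using q unfolding bij_betw_def by blast
    obtain w where w: "0 < p w" using points_ex_pos[OF p(1)] by blast
    have "p \<in> points (bsd (K i) A)" using p(1) points_mono[OF bsd_mono[OF B(2)]] by blast
    then have "q \<in> open_star i w" using p(2) w by (auto simp: open_star_def)
    then show ?thesis using pos_imp_vert[OF p(1) w] by blast
  qed
  then obtain w where w: "\<And>i. w i \<in> verts (bsd (K i) B)" "\<And>i. q \<in> open_star i (w i)" by metis
  have "\<exists>z. thread f (N m) z \<and> z (N m) = fn (e m) (w (Suc m)) \<and> (\<forall>i\<le>N m. z i \<in> verts (bsd (lev i) B))" for m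
    by (intro ex_thread[OF B] near_homeo_vert[OF e(2) B] w(1))
  then obtain Z where Z: "\<And>m. thread f (N m) (Z m)" "\<And>m. Z m (N m) = fn (e m) (w (Suc m))"
      "\<And>m i. i \<le> N m \<Longrightarrow> Z m i \<in> verts (bsd (lev i) B)"
    by metis
  have finB: "finite (verts (bsd (lev n) B))" for n
    using finite_verts[OF finite_bsd[OF finite_subset[OF B(2) finite]]] .
  have "\<exists>x. \<forall>n. \<exists>m\<ge>n. \<forall>i\<le>n. Z m i = x i"
  proof (rule diagonal_finite_choice[OF finB])
    fix m n :: nat assume "n \<le> m"
    then have "n \<le> N m" using Nge[of m] by simp
    then show "Z m n \<in> verts (bsd (lev n) B)" by (rule Z(3))
  qed
  then obtain x where x: "\<And>n. \<exists>m\<ge>n. \<forall>i\<le>n. Z m i = x i" by blast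
  have vert: "x n \<in> verts (bsd (lev n) B)" for n
  proof -
    obtain m where m: "m \<ge> n" "\<forall>i\<le>n. Z m i = x i" using x by blast
    then have "n \<le> N m" using Nge[of m] by simp
    then show ?thesis using Z(3)[of n m] m(2) by simp
  qed
  have "fn (f n) (x (Suc n)) = x n" for n
  proof -
    obtain m where m: "m \<ge> Suc n" "\<forall>i\<le>Suc n. Z m i = x i" using x by blast
    then have "n < N m" using Nge[of m] by simp
    then have "fn (f n) (Z m (Suc n)) = Z m n" using Z(1)[of m] by (simp add: thread_def)
    then show ?thesis using m(2) by simp
  qed
  then have xB: "x \<in> lim_sub B"
    unfolding lim_sub_def lim_verts_def tgt_f
    using vert verts_mono[OF bsd_mono[OF B(2)]] by blast
  have "q \<in> closed_star i (proj i x)" for i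
  proof -
    obtain m where m: "m \<ge> N i" "\<forall>j\<le>N i. Z m j = x j" using x by blast
    then have "i \<le> m" using Nge[of i] by simp
    \<comment> \<open>Downward induction from stage \<open>m\<close>, where
      \<open>u = w (Suc m)\<close>; one stage down, the new \<open>u\<close> is the image of the old
      one under \<open>e\<close> and \<open>g\<close>, and its open star still contains
      \<open>q\<close>.\<close>
    then have "\<exists>u. Z m (N i) = fn (e i) u \<and> q \<in> open_star (Suc i) u"
    proof (induction rule: inc_induct)
      case base
      show ?case using Z(2) w(2) by blast
    next
      case (step j)
      then obtain u where u: "Z m (N (Suc j)) = fn (e (Suc j)) u" "q \<in> open_star (Suc (Suc j)) u"
        by blast
      have "N (Suc j) \<le> N m" using step.hyps Nmono by (simp add: strict_mono_less_eq)
      then have "Z m (N j) = fn (e j) (fn (g (Suc j)) (Z m (N (Suc j))))"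
        using thread_mono[OF Z(1)] by (intro factor) blast
      then show ?case using open_star_step[OF u(2)] u(1) by auto
    qed
    then obtain u where u: "x (N i) = fn (e i) u" "q \<in> open_star (Suc i) u"
      using m(2) by auto
    then have "q \<in> open_star i (proj i x)"
      using open_star_step[OF u(2)] by (simp add: proj_def)
    then show ?thesis using open_star_subset by blast
  qed
  moreover have "x \<in> lim_verts f" using xB by (simp add: lim_sub_def)
  ultimately have "limit_point x = q" by (intro limit_point_unique)
  then show ?thesis using xB by blast
qed

lemma limit_point_image:
  "is_complex B \<Longrightarrow> B \<subseteq> A \<Longrightarrow> limit_point ` lim_sub B = points (bsd 0 B)"
  using limit_point_sub limit_point_surj by blast

lemma continuous_map_lim_proj:
  "continuous_map (lim_topology f) (discrete_topology (verts (tgt (f n)))) (\<lambda>x. x n)"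
  unfolding lim_topology_def
  by (intro continuous_map_from_subtopology continuous_map_product_projection) simp

text \<open>The single entry of \<open>x\<close> at index \<open>N (Suc i)\<close> determines
  \<open>proj (Suc i) x\<close>, and hence the limit point up to the diameter of one closed star.
  Cylinder sets are therefore suitable neighbourhoods.\<close>

lemma continuous_limit_point: "continuous_map (lim_topology f) euclideanreal (\<lambda>x. limit_point x a)"
  unfolding continuous_map_eq_topcontinuous_at
proof
  fix x assume "x \<in> topspace (lim_topology f)"
  then have x: "x \<in> lim_verts f" by (simp add: topspace_lim_topology)
  show "topcontinuous_at (lim_topology f) euclideanreal (\<lambda>x. limit_point x a) x"
    unfolding topcontinuous_at_def
  proof (intro conjI allI impI)
    show "x \<in> topspace (lim_topology f)" using x by (simp add: topspace_lim_topology)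
    show "(\<lambda>x. limit_point x a) \<in> topspace (lim_topology f) \<rightarrow> topspace euclideanreal" by simp
    fix V assume "openin euclideanreal V \<and> limit_point x a \<in> V"
    then obtain \<epsilon> where \<epsilon>: "\<epsilon> > 0" "\<And>t. \<bar>t - limit_point x a\<bar> < \<epsilon> \<Longrightarrow> t \<in> V"
      unfolding open_openin[symmetric] open_dist dist_real_def by metis
    obtain i :: nat where "2 / \<epsilon> < real i" using reals_Archimedean2 by blast
    then have i: "2 / (real i + 1) < \<epsilon>" using \<epsilon>(1) by (simp add: field_simps)
    let ?n = "N (Suc i)"
    let ?U = "{y \<in> topspace (lim_topology f). y ?n \<in> {x ?n}}"
    have "openin (lim_topology f) ?U"
      using x by (intro openin_continuous_map_preimage[OF continuous_map_lim_proj])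
        (simp add: lim_verts_def)
    moreover have "limit_point y a \<in> V" if "y \<in> ?U" for y
    proof (rule \<epsilon>(2))
      have y: "y \<in> lim_verts f" "proj (Suc i) y = proj (Suc i) x"
        using that by (simp_all add: topspace_lim_topology proj_def)
      have "\<bar>limit_point y a - limit_point x a\<bar> < 2 / (real i + 1)"
        using limit_point_closed[OF y(1), of "Suc i"] limit_point_closed[OF x, of "Suc i"]
        unfolding y(2) by (rule closed_star_diam)
      then show "\<bar>limit_point y a - limit_point x a\<bar> < \<epsilon>" using i by simp
    qed
    ultimately show "\<exists>U. openin (lim_topology f) U \<and> x \<in> U \<and> (\<forall>y\<in>U. limit_point y a \<in> V)"
      using x by (intro exI[of _ ?U]) (auto simp: topspace_lim_topology)
  qed
qed

end

context generic_sequence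
begin

text \<open>A closed subspace of a product of finite discrete spaces, as each bonding condition
  equates two continuous maps to a Hausdorff space.\<close>

lemma compact_lim: "compact_space (lim_topology f)"
proof -
  let ?P = "product_topology (\<lambda>n. discrete_topology (verts (tgt (f n)))) UNIV"
  have fin: "finite (verts (tgt (f n)))" for n
    by (simp add: tgt_f finite_verts finite_bsd_A)
  have "compact_space ?P"
    by (simp add: compact_space_product_topology compact_space_discrete_topology fin)
  moreover have "closedin ?P (lim_verts f)"
  proof -
    have proj: "continuous_map ?P (discrete_topology (verts (tgt (f n)))) (\<lambda>x. x n)" for n
      by (rule continuous_map_product_projection) simp
    have comp: "continuous_map ?P (discrete_topology (verts (tgt (f n)))) (\<lambda>x. fn (f n) (x (Suc n)))" for n
    proof -
      have "continuous_map (discrete_topology (verts (tgt (f (Suc n)))))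
          (discrete_topology (verts (tgt (f n)))) (fn (f n))"
        using f_vert[OF is_complex subset_refl] by (auto simp: tgt_f)
      from continuous_map_compose[OF proj this] show ?thesis by (simp only: comp_def)
    qed
    have "closedin ?P {x \<in> topspace ?P. fn (f n) (x (Suc n)) = x n}" for n
      by (rule closedin_continuous_maps_eq[OF _ comp proj]) (simp add: Hausdorff_space_discrete_topology)
    then have "closedin ?P (\<Inter>n. {x \<in> topspace ?P. fn (f n) (x (Suc n)) = x n})"
      by (intro closedin_Inter) auto
    moreover have "lim_verts f = (\<Inter>n. {x \<in> topspace ?P. fn (f n) (x (Suc n)) = x n})"
      by (auto simp: lim_verts_def PiE_iff)
    ultimately show ?thesis by simp
  qed
  ultimately show ?thesis
    unfolding lim_topology_def by (simp add: closedin_compact_space compact_space_subtopology)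
qed

end

section \<open>Comparison with the geometric realization\<close>

text \<open>Changes conventions: \<open>points\<close> has value 0 off the vertices and uses the
  vertices \<open>Atom i\<close>, while \<open>geom_points\<close> is extensional on
  \<open>verts A\<close>.\<close>

definition to_geom :: "'a scomplex \<Rightarrow> ('a vert \<Rightarrow> real) \<Rightarrow> 'a \<Rightarrow> real" where
  "to_geom A p = (\<lambda>i\<in>verts A. p (Atom i))"

lemma to_geom_points:
  assumes "finite A" "B \<subseteq> A" "p \<in> points (bsd 0 B)"
  shows "to_geom A p \<in> geom_points A B"
proof -
  obtain \<sigma> where \<sigma>: "\<sigma> \<in> B" "\<And>v. v |\<notin>| Atom |`| \<sigma> \<Longrightarrow> p v = 0" "sum p (fset (Atom |`| \<sigma>)) = 1"
    using assms(3) unfolding points_def bsd_0 by blast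
  have sub: "fset \<sigma> \<subseteq> verts A" using face_subset_verts \<sigma>(1) assms(2) by blast
  have "(\<Sum>i\<in>fset \<sigma>. to_geom A p i) = (\<Sum>i\<in>fset \<sigma>. p (Atom i))"
    using sub by (intro sum.cong) (auto simp: to_geom_def)
  also have "\<dots> = 1" using \<sigma>(3) by (simp add: sum.reindex inj_on_def)
  finally have one: "(\<Sum>i\<in>fset \<sigma>. to_geom A p i) = 1" .
  have "to_geom A p i = 0" if "i \<in> verts A - fset \<sigma>" for i
    using that \<sigma>(2)[of "Atom i"] by (auto simp: to_geom_def)
  then have "(\<Sum>i\<in>verts A. to_geom A p i) = (\<Sum>i\<in>fset \<sigma>. to_geom A p i)"
    using sub finite_verts[OF assms(1)] by (intro sum.mono_neutral_right) auto
  then show ?thesis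
    unfolding geom_points_def using one \<sigma>(1) points_nonneg[OF assms(3)] by (auto simp: to_geom_def)
qed

lemma to_geom_image:
  assumes "finite A" "B \<subseteq> A"
  shows "to_geom A ` points (bsd 0 B) = geom_points A B"
proof
  show "to_geom A ` points (bsd 0 B) \<subseteq> geom_points A B"
    using to_geom_points[OF assms] by blast
  show "geom_points A B \<subseteq> to_geom A ` points (bsd 0 B)"
  proof
    fix x assume x: "x \<in> geom_points A B"
    then obtain \<sigma> where \<sigma>: "\<sigma> \<in> B" "(\<Sum>i\<in>verts A. x i) = 1" "(\<Sum>i\<in>fset \<sigma>. x i) = 1"
      and nonneg: "\<And>i. i \<in> verts A \<Longrightarrow> 0 \<le> x i" and ext: "x \<in> extensional (verts A)"
      by (auto simp: geom_points_def)
    have sub: "fset \<sigma> \<subseteq> verts A" using face_subset_verts \<sigma>(1) assms(2) by blast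
    have "(\<Sum>i\<in>verts A - fset \<sigma>. x i) = 0"
      using sum_diff[OF finite_verts[OF assms(1)] sub, of x] \<sigma>(2,3) by simp
    then have zero: "x i = 0" if "i \<in> verts A - fset \<sigma>" for i
      using sum_nonneg_eq_0_iff[of "verts A - fset \<sigma>" x] nonneg finite_verts[OF assms(1)] that by auto
    define p where "p = (\<lambda>v. case v of Atom i \<Rightarrow> if i \<in> verts A then x i else 0 | Face _ \<Rightarrow> 0)"
    have "p v = 0" if "v |\<notin>| Atom |`| \<sigma>" for v
      using that zero by (cases v) (auto simp: p_def)
    moreover have "sum p (fset (Atom |`| \<sigma>)) = (\<Sum>i\<in>fset \<sigma>. p (Atom i))"
      by (simp add: sum.reindex inj_on_def)
    then have "sum p (fset (Atom |`| \<sigma>)) = 1"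
      using \<sigma>(3) sub by (simp add: p_def subset_iff cong: sum.cong)
    moreover have "0 \<le> p v" for v
      using nonneg by (cases v) (auto simp: p_def)
    ultimately have "p \<in> points (bsd 0 B)"
      using \<sigma>(1) unfolding points_def bsd_0 by blast
    moreover have "to_geom A p = x"
      using ext by (auto simp: to_geom_def p_def extensional_def)
    ultimately show "x \<in> to_geom A ` points (bsd 0 B)" by blast
  qed
qed

lemma inj_on_to_geom: "inj_on (to_geom A) (points (bsd 0 A))"
proof (rule inj_onI)
  fix p q assume p: "p \<in> points (bsd 0 A)" and q: "q \<in> points (bsd 0 A)" and eq: "to_geom A p = to_geom A q"
  have verts: "verts (bsd 0 A) = Atom ` verts A" by (auto simp: bsd_0 verts_def)
  show "p = q"
  proof
    fix v show "p v = q v"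
    proof (cases "v \<in> verts (bsd 0 A)")
      case True
      then obtain i where "i \<in> verts A" "v = Atom i" unfolding verts by blast
      then show ?thesis using fun_cong[OF eq, of i] by (simp add: to_geom_def)
    next
      case False
      then show ?thesis using points_off_verts[OF p] points_off_verts[OF q] by simp
    qed
  qed
qed

context approximating_sequence
begin

text \<open>The map \<Phi> is a continuous surjection from a compact space to a Hausdorff space,
  hence a quotient map. It has the same fibres as the projection to the realization, so the induced
  \<open>h\<close> is an injective quotient map.\<close>

lemma realization_homeomorphism:
  "\<exists>h. homeomorphic_map (realization f) (geom_realization A) h \<and>
     (\<forall>B. is_complex B \<and> B \<subseteq> A \<longrightarrow> h ` subrealization A f B = geom_points A B)"
proof -
  let ?X = "lim_topology f" and ?Y = "realization f" and ?Z = "geom_realization A"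
  let ?\<pi> = "\<lambda>x. lim_rel f `` {x}"
  define \<Phi> where "\<Phi> = (\<lambda>x. to_geom A (limit_point x))"
  have \<Phi>_sub: "\<Phi> ` lim_sub B = geom_points A B" if "is_complex B" "B \<subseteq> A" for B
    using to_geom_image[OF finite that(2)] limit_point_image[OF that]
    by (simp add: \<Phi>_def flip: image_image)
  have \<Phi>_eq: "\<Phi> x = \<Phi> y \<longleftrightarrow> (x, y) \<in> lim_rel f" if "x \<in> lim_verts f" "y \<in> lim_verts f" for x y
    using that limit_point_eq_iff[OF that] inj_onD[OF inj_on_to_geom]
      limit_point_points by (auto simp: \<Phi>_def)
  have surj: "\<Phi> ` topspace ?X = topspace ?Z"
    using \<Phi>_sub[OF is_complex subset_refl]
    by (simp add: topspace_lim_topology topspace_geom_realization lim_sub_self)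
  have cont: "continuous_map ?X ?Z \<Phi>"
    unfolding geom_realization_def
  proof (rule continuous_map_into_subtopology)
    show "continuous_map ?X (powertop_real (verts A)) \<Phi>"
      unfolding continuous_map_componentwise
    proof (intro conjI ballI)
      show "\<Phi> ` topspace ?X \<subseteq> extensional (verts A)" by (auto simp: \<Phi>_def to_geom_def)
      fix i assume i: "i \<in> verts A"
      then show "continuous_map ?X euclideanreal (\<lambda>x. \<Phi> x i)"
        using continuous_limit_point[of "Atom i"] by (simp add: \<Phi>_def to_geom_def)
    qed
    show "\<Phi> \<in> topspace ?X \<rightarrow> geom_points A A" using surj by (auto simp: topspace_geom_realization)
  qed
  have "Hausdorff_space ?Z"
    unfolding geom_realization_def
    by (intro Hausdorff_space_subtopology) (simp add: Hausdorff_space_product_topology)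
  then have quot: "quotient_map ?X ?Z \<Phi>"
    using continuous_imp_quotient_map[OF cont compact_lim _ surj] by blast
  have q\<pi>: "quotient_map ?X ?Y ?\<pi>"
    unfolding realization_def by (rule quotient_map_quotient_topology)
  \<comment> \<open>As the kernel of \<Phi>, \<open>lim_rel f\<close> is an equivalence relation on
    \<open>lim_verts f\<close>, and its classes are the fibres of \<Phi>.\<close>
  have class_eq: "?\<pi> x = {y \<in> lim_verts f. \<Phi> y = \<Phi> x}" if "x \<in> lim_verts f" for x
  proof -
    have "(x, y) \<in> lim_rel f \<longleftrightarrow> y \<in> lim_verts f \<and> \<Phi> y = \<Phi> x" for y
    proof (cases "y \<in> lim_verts f")
      case True
      then show ?thesis using \<Phi>_eq[OF that True] by auto
    next
      case False
      then show ?thesis by (simp add: lim_rel_def)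
    qed
    then show ?thesis by blast
  qed
  have \<pi>_eq: "?\<pi> x = ?\<pi> y \<longleftrightarrow> \<Phi> x = \<Phi> y" if "x \<in> lim_verts f" "y \<in> lim_verts f" for x y
    unfolding class_eq[OF that(1)] class_eq[OF that(2)] using that by force
  obtain h where h: "continuous_map ?Y ?Z h" "\<And>x. x \<in> topspace ?X \<Longrightarrow> h (?\<pi> x) = \<Phi> x"
    using quotient_map_lift_exists[OF q\<pi> cont] \<pi>_eq unfolding topspace_lim_topology by metis
  have "quotient_map ?X ?Z (h \<circ> ?\<pi>)"
    by (rule quotient_map_eq[OF quot]) (simp add: h(2))
  then have "quotient_map ?Y ?Z h"
    using quotient_map_from_composition[OF quotient_imp_continuous_map[OF q\<pi>] h(1)] by blast
  moreover have "inj_on h (topspace ?Y)"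
  proof (rule inj_onI)
    fix c d assume "c \<in> topspace ?Y" "d \<in> topspace ?Y" and eq: "h c = h d"
    then obtain x y where "x \<in> lim_verts f" "c = ?\<pi> x" "y \<in> lim_verts f" "d = ?\<pi> y"
      unfolding topspace_realization quotient_def by blast
    then show "c = d" using eq \<pi>_eq h(2) by (simp add: topspace_lim_topology)
  qed
  ultimately have "homeomorphic_map ?Y ?Z h" by (simp add: homeomorphic_map_def)
  moreover have "h ` subrealization A f B = geom_points A B" if B: "is_complex B" "B \<subseteq> A" for B
  proof -
    have "h ` subrealization A f B = (\<lambda>x. h (?\<pi> x)) ` lim_sub B"
      unfolding subrealization_def lim_verts_restrict_seq[OF B(2)] by (simp add: image_image)
    also have "\<dots> = \<Phi> ` lim_sub B"
      by (intro image_cong refl h(2)) (simp add: lim_sub_def topspace_lim_topology)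
    finally show ?thesis using \<Phi>_sub[OF B] by simp
  qed
  ultimately show ?thesis by blast
qed

end

theorem theorem3p6:
  fixes A :: "'a scomplex" and f :: "nat \<Rightarrow> 'a vert smap"
  assumes "is_complex A" and "finite A"
    and "generic (selection_maps A) f"
  shows "\<exists>h. homeomorphic_map (realization f) (geom_realization A) h \<and>
           (\<forall>B. is_complex B \<and> B \<subseteq> A \<longrightarrow> h ` subrealization A f B = geom_points A B)"
proof (cases "A = {}")
  case False
  interpret generic_sequence A f
    by unfold_locales (use assms False in auto)
  obtain N K g e \<Psi> where "approximating_sequence A f N K g e \<Psi>"
    using ex_approximating_sequence by blast
  then interpret approximating_sequence A f N K g e \<Psi> .
  show ?thesis by (rule realization_homeomorphism)
next
  case True
  \<comment> \<open>For the empty complex both spaces are empty, and the only subcomplex is empty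
    too, so any function will do.\<close>
  have bsd: "bsd k ({} :: 'a scomplex) = {}" for k
    by (induction k) (auto simp: bsd_0 bsd_Suc sd_def)
  have "tgt (f 0) \<in> objects (selection_maps A)"
    using assms(3) by (auto simp: objects_def generic_def)
  then have "tgt (f 0) = {}" using True bsd by (auto simp: objects_selection_maps)
  then have lim: "lim_verts f = {}" by (auto simp: lim_verts_def verts_def)
  have geom: "geom_points C {} = {}" for C :: "'a scomplex" by (simp add: geom_points_def)
  have "lim_verts (restrict_seq A f {}) = {}"
    by (auto simp: lim_verts_def restrict_seq_def bsd verts_def)
  then have sub: "subrealization A f {} = {}" by (simp add: subrealization_def)
  have "homeomorphic_map (realization f) (geom_realization A) (\<lambda>_. undefined)"
    unfolding homeomorphic_map_def quotient_map_def
    by (auto simp: topspace_realization topspace_geom_realization lim geom True)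
  then show ?thesis using True geom sub by auto
qed

end
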